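(* Let $A_\Gamma$ be an Artin group satisfying at least one of the following: 1. $A_\Gamma$ is balanced; 2. there exists a prime number $p$ dividing $\frac{l(e)}{2}$ for every $e\in E(\Gamma)$ with $l(e)>2$ even. Then $A_\Gamma$ satisfies the $\Sigma^1$-conjecture, i.e. $$\Sigma^1(A_\Gamma)=\{[\chi]\in S(A_\Gamma)\mid \mathrm{Liv}^\chi\text{ is connected and dominant}\}.$$
   Context: Let $\Gamma$ be a finite simplicial graph (no loops, no multiple edges) with vertex set $V(\Gamma)$, edge set $E(\Gamma)$ and labelling $l:E(\Gamma)\to\mathbb{N}_{\ge 2}$. The Artin group $A_\Gamma$ is generated by $V(\Gamma)$ with one relation $uvu\cdots=vuv\cdots$ ($l(e)$ letters on each side) for each $e=\{u,v\}\in E(\Gamma)$. Sigma-invariant: for a finitely generated group $G$, a character is a homomorphism $\chi:G\to\mathbb{R}$; $S(G)$ is the set of non-zero characters modulo multiplication by positive reals. Put $G_\chi=\{g\in G\mid\chi(g)\ge 0\}$. Then $[\chi]\in\Sigma^1(G)=\Sigma^1(G,\mathbb{Z})$ iff the trivial module $\mathbb{Z}$ is of type $FP_1$ over $\mathbb{Z}G_\chi$. Living subgraph: for a non-zero character $\chi$ of $A_\Gamma$, a vertex $v$ is dead if $\chi(v)=0$ and living otherwise; an edge $e=\{u,v\}$ is dead if $l(e)\ge 4$ is even and $\chi(u)+\chi(v)=0$. $\mathrm{Liv}^\chi$ is obtained from $\Gamma$ by deleting all dead vertices (with all incident edges) and the interiors of all dead edges. It is dominant if every dead vertex is adjacent in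 $\Gamma$ to some living vertex. Balanced: let $\Lambda$ be a graph (possibly with loops or multiple edges) whose edges are labelled by even integers $\ge 4$. An $n$-balanced colouring of $\Lambda$ is a map $\mathcal{C}:E(\Lambda)\to\{1,\dots,n\}$ such that for every $i$ there is a prime $p_i$ dividing $\frac{l(e)}{2}$ for every edge $e$ with $\mathcal{C}(e)=i$. $\Lambda$ is balanced if, for some $n$, it admits an $n$-balanced colouring such that every simple closed path (cycle) of even length contains exactly two or zero edges of each colour. Let $\Gamma_{>2}^{\mathrm{even}}$ be the graph obtained from $\Gamma$ by removing all edges with label $2$ and collapsing each edge with odd label to a single vertex (it need not be simplicial). $A_\Gamma$ is balanced if $\Gamma_{>2}^{\mathrm{even}}$ is balanced. *)

theory Defs
  imports "HOL-Algebra.Module" "HOL-Computational_Algebra.Primes" Complex_Main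
begin

section \<open>Groups given by generators and relations\<close>

text \<open>The letter \<open>(x, True)\<close> stands for the generator \<open>x\<close>, the letter \<open>(x, False)\<close> for its
  formal inverse.  A pair \<open>(r, s)\<close> in \<open>R\<close> stands for the relation \<open>r = s\<close>.\<close>

type_synonym 'x word = "('x \<times> bool) list"

definition words :: "'x set \<Rightarrow> 'x word set" where
  "words X = lists (X \<times> UNIV)"

inductive_set pres_cong :: "'x set \<Rightarrow> ('x word \<times> 'x word) set \<Rightarrow> ('x word \<times> 'x word) set"
  for X :: "'x set" and R :: "('x word \<times> 'x word) set"
where
  cong_refl: "w \<in> words X \<Longrightarrow> (w, w) \<in> pres_cong X R"
| cong_sym: "(w, w') \<in> pres_cong X R \<Longrightarrow> (w', w) \<in> pres_cong X R"
| cong_trans: "(w, w') \<in> pres_cong X R \<Longrightarrow> (w', w'') \<in> pres_cong X R \<Longrightarrow> (w, w'') \<in> pres_cong X R"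
| cong_cancel: "a \<in> words X \<Longrightarrow> b \<in> words X \<Longrightarrow> x \<in> X \<Longrightarrow>
    (a @ [(x, s), (x, \<not> s)] @ b, a @ b) \<in> pres_cong X R"
| cong_rel: "a \<in> words X \<Longrightarrow> b \<in> words X \<Longrightarrow> (r, r') \<in> R \<Longrightarrow> r \<in> words X \<Longrightarrow> r' \<in> words X \<Longrightarrow>
    (a @ r @ b, a @ r' @ b) \<in> pres_cong X R"

definition pres_group :: "'x set \<Rightarrow> ('x word \<times> 'x word) set \<Rightarrow> 'x word set monoid" where
  "pres_group X R =
    \<lparr>carrier = words X // pres_cong X R,
     monoid.mult = (\<lambda>A B. \<Union>a\<in>A. \<Union>b\<in>B. pres_cong X R `` {a @ b}),
     one = pres_cong X R `` {[]}\<rparr>"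


section \<open>Labelled graphs and Artin groups\<close>

definition labelled_graph :: "'v set \<Rightarrow> 'v set set \<Rightarrow> ('v set \<Rightarrow> nat) \<Rightarrow> bool" where
  "labelled_graph V E l \<longleftrightarrow>
     finite V \<and> (\<forall>e\<in>E. e \<subseteq> V \<and> card e = 2) \<and> (\<forall>e\<in>E. l e \<ge> 2)"

fun alt_word :: "'v \<Rightarrow> 'v \<Rightarrow> nat \<Rightarrow> 'v word" where
  "alt_word u v 0 = []"
| "alt_word u v (Suc n) = (u, True) # alt_word v u n"

definition artin_relations :: "'v set set \<Rightarrow> ('v set \<Rightarrow> nat) \<Rightarrow> ('v word \<times> 'v word) set" where
  "artin_relations E l =
     {(alt_word u v (l {u, v}), alt_word v u (l {u, v})) | u v. {u, v} \<in> E}"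

definition artin_group :: "'v set \<Rightarrow> 'v set set \<Rightarrow> ('v set \<Rightarrow> nat) \<Rightarrow> 'v word set monoid" where
  "artin_group V E l = pres_group V (artin_relations E l)"

definition artin_gen :: "'v set \<Rightarrow> 'v set set \<Rightarrow> ('v set \<Rightarrow> nat) \<Rightarrow> 'v \<Rightarrow> 'v word set" where
  "artin_gen V E l v = pres_cong V (artin_relations E l) `` {[(v, True)]}"


section \<open>Left modules and the finiteness property $FP_n$\<close>

text \<open>The locale \<open>module\<close> of the library requires a commutative ring of scalars.\<close>

locale left_module = R?: ring R + M?: abelian_group M for R (structure) and M (structure) +
  assumes smult_closed: "\<lbrakk>a \<in> carrier R; x \<in> carrier M\<rbrakk> \<Longrightarrow> a \<odot>\<^bsub>M\<^esub> x \<in> carrier M"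
    and smult_l_distr: "\<lbrakk>a \<in> carrier R; b \<in> carrier R; x \<in> carrier M\<rbrakk> \<Longrightarrow>
      (a \<oplus> b) \<odot>\<^bsub>M\<^esub> x = a \<odot>\<^bsub>M\<^esub> x \<oplus>\<^bsub>M\<^esub> b \<odot>\<^bsub>M\<^esub> x"
    and smult_r_distr: "\<lbrakk>a \<in> carrier R; x \<in> carrier M; y \<in> carrier M\<rbrakk> \<Longrightarrow>
      a \<odot>\<^bsub>M\<^esub> (x \<oplus>\<^bsub>M\<^esub> y) = a \<odot>\<^bsub>M\<^esub> x \<oplus>\<^bsub>M\<^esub> a \<odot>\<^bsub>M\<^esub> y"
    and smult_assoc: "\<lbrakk>a \<in> carrier R; b \<in> carrier R; x \<in> carrier M\<rbrakk> \<Longrightarrow>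
      (a \<otimes> b) \<odot>\<^bsub>M\<^esub> x = a \<odot>\<^bsub>M\<^esub> (b \<odot>\<^bsub>M\<^esub> x)"
    and smult_one: "x \<in> carrier M \<Longrightarrow> \<one> \<odot>\<^bsub>M\<^esub> x = x"

definition module_hom ::
  "('r, 'a) ring_scheme \<Rightarrow> ('r, 'm, 'b) module_scheme \<Rightarrow> ('r, 'n, 'c) module_scheme \<Rightarrow> ('m \<Rightarrow> 'n) set"
where
  "module_hom R M N = {f \<in> carrier M \<rightarrow> carrier N.
     (\<forall>x\<in>carrier M. \<forall>y\<in>carrier M. f (x \<oplus>\<^bsub>M\<^esub> y) = f x \<oplus>\<^bsub>N\<^esub> f y) \<and>
     (\<forall>a\<in>carrier R. \<forall>x\<in>carrier M. f (a \<odot>\<^bsub>M\<^esub> x) = a \<odot>\<^bsub>N\<^esub> f x)}"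

text \<open>The free left module of rank \<open>n\<close>.  The fields \<open>mult\<close> and \<open>one\<close> play no role in a module.\<close>

definition free_module :: "('r, 'a) ring_scheme \<Rightarrow> nat \<Rightarrow> ('r, nat \<Rightarrow> 'r) module" where
  "free_module R n =
    \<lparr>carrier = {..<n} \<rightarrow>\<^sub>E carrier R,
     monoid.mult = undefined, one = undefined,
     zero = (\<lambda>i\<in>{..<n}. \<zero>\<^bsub>R\<^esub>),
     add = (\<lambda>x y. \<lambda>i\<in>{..<n}. x i \<oplus>\<^bsub>R\<^esub> y i),
     smult = (\<lambda>a x. \<lambda>i\<in>{..<n}. a \<otimes>\<^bsub>R\<^esub> x i)\<rparr>"

text \<open>Finitely generated projective modules: the direct summands (retracts) of free modules of
  finite rank.\<close>

definition fg_projective :: "('r, 'a) ring_scheme \<Rightarrow> ('r, 'm, 'b) module_scheme \<Rightarrow> bool" where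
  "fg_projective R P \<longleftrightarrow> left_module R P \<and>
     (\<exists>n. \<exists>\<iota>\<in>module_hom R P (free_module R n). \<exists>\<pi>\<in>module_hom R (free_module R n) P.
        \<forall>x\<in>carrier P. \<pi> (\<iota> x) = x)"

text \<open>A module \<open>M\<close> is of type $FP_n$ if there is an exact sequence
  $P_n \to \dots \to P_0 \to M \to 0$ with all $P_i$ finitely generated projective.
  The modules \<open>P i\<close> live on the type of the free modules of finite rank; since every finitely
  generated projective module is isomorphic to a submodule of one of these, this is no restriction.\<close>

definition type_FP :: "('r, 'a) ring_scheme \<Rightarrow> ('r, 'm, 'b) module_scheme \<Rightarrow> nat \<Rightarrow> bool" where
  "type_FP R M n \<longleftrightarrow> left_module R M \<and>
     (\<exists>(P :: nat \<Rightarrow> ('r, nat \<Rightarrow> 'r) module) \<epsilon> \<delta>.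
        (\<forall>i\<le>n. fg_projective R (P i)) \<and>
        \<epsilon> \<in> module_hom R (P 0) M \<and> \<epsilon> ` carrier (P 0) = carrier M \<and>
        (\<forall>i<n. \<delta> i \<in> module_hom R (P (Suc i)) (P i) \<and>
           \<delta> i ` carrier (P (Suc i)) =
             {x \<in> carrier (P i).
                case i of 0 \<Rightarrow> \<epsilon> x = \<zero>\<^bsub>M\<^esub> | Suc j \<Rightarrow> \<delta> j x = \<zero>\<^bsub>P j\<^esub>}))"


section \<open>Monoid rings and the invariant $\Sigma^1$\<close>

text \<open>Elements of the integral monoid ring are the finitely supported functions from the monoid
  to the integers, extended by 0 outside of its carrier.\<close>

definition monoid_ring :: "('g, 'a) monoid_scheme \<Rightarrow> ('g \<Rightarrow> int) ring" where
  "monoid_ring M =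
    \<lparr>carrier = {f. finite {x. f x \<noteq> 0} \<and> {x. f x \<noteq> 0} \<subseteq> carrier M},
     monoid.mult = (\<lambda>f h x.
       \<Sum>(y, z) \<in> {(y, z). f y \<noteq> 0 \<and> h z \<noteq> 0 \<and> y \<otimes>\<^bsub>M\<^esub> z = x}. f y * h z),
     one = (\<lambda>x. if x = \<one>\<^bsub>M\<^esub> then 1 else 0),
     zero = (\<lambda>x. 0),
     add = (\<lambda>f h x. f x + h x)\<rparr>"

text \<open>The trivial module: every element of the monoid acts on the integers as the identity.\<close>

definition trivial_module :: "('g \<Rightarrow> int, int) module" where
  "trivial_module =
    \<lparr>carrier = UNIV, monoid.mult = (*), one = 1, zero = 0, add = (+),
     smult = (\<lambda>f k. (\<Sum>x | f x \<noteq> 0. f x) * k)\<rparr>"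

definition real_add_group :: "real monoid" where
  "real_add_group = \<lparr>carrier = UNIV, monoid.mult = (+), one = 0\<rparr>"

definition characters :: "('g, 'a) monoid_scheme \<Rightarrow> ('g \<Rightarrow> real) set" where
  "characters G = hom G real_add_group \<inter> extensional (carrier G)"

definition nonzero_characters :: "('g, 'a) monoid_scheme \<Rightarrow> ('g \<Rightarrow> real) set" where
  "nonzero_characters G = {\<chi> \<in> characters G. \<exists>g\<in>carrier G. \<chi> g \<noteq> 0}"

definition char_class :: "('g, 'a) monoid_scheme \<Rightarrow> ('g \<Rightarrow> real) \<Rightarrow> ('g \<Rightarrow> real) set" where
  "char_class G \<chi> = {\<psi> \<in> characters G. \<exists>r>0. \<forall>g\<in>carrier G. \<psi> g = r * \<chi> g}"

definition nonneg_submonoid :: "('g, 'a) monoid_scheme \<Rightarrow> ('g \<Rightarrow> real) \<Rightarrow> ('g, 'a) monoid_scheme" where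
  "nonneg_submonoid G \<chi> = G\<lparr>carrier := {g \<in> carrier G. \<chi> g \<ge> 0}\<rparr>"

definition Sigma1 :: "('g, 'a) monoid_scheme \<Rightarrow> ('g \<Rightarrow> real) set set" where
  "Sigma1 G = {char_class G \<chi> | \<chi>. \<chi> \<in> nonzero_characters G \<and>
     type_FP (monoid_ring (nonneg_submonoid G \<chi>)) trivial_module 1}"


section \<open>The living subgraph\<close>

text \<open>Here \<open>c v\<close> is the value of the character on the generator \<open>v\<close>.\<close>

definition living_verts :: "'v set \<Rightarrow> ('v \<Rightarrow> real) \<Rightarrow> 'v set" where
  "living_verts V c = {v \<in> V. c v \<noteq> 0}"

definition dead_edge :: "('v set \<Rightarrow> nat) \<Rightarrow> ('v \<Rightarrow> real) \<Rightarrow> 'v set \<Rightarrow> bool" where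
  "dead_edge l c e \<longleftrightarrow> l e \<ge> 4 \<and> even (l e) \<and> (\<exists>u v. e = {u, v} \<and> u \<noteq> v \<and> c u + c v = 0)"

definition living_edges ::
  "'v set \<Rightarrow> 'v set set \<Rightarrow> ('v set \<Rightarrow> nat) \<Rightarrow> ('v \<Rightarrow> real) \<Rightarrow> 'v set set" where
  "living_edges V E l c = {e \<in> E. e \<subseteq> living_verts V c \<and> \<not> dead_edge l c e}"

definition graph_connected :: "'v set \<Rightarrow> 'v set set \<Rightarrow> bool" where
  "graph_connected W F \<longleftrightarrow> (\<forall>u\<in>W. \<forall>v\<in>W. (u, v) \<in> {(a, b). {a, b} \<in> F}\<^sup>*)"

definition living_dominant :: "'v set \<Rightarrow> 'v set set \<Rightarrow> ('v \<Rightarrow> real) \<Rightarrow> bool" where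
  "living_dominant V E c \<longleftrightarrow>
     (\<forall>v \<in> V - living_verts V c. \<exists>u \<in> living_verts V c. {u, v} \<in> E)"


section \<open>Balanced graphs\<close>

text \<open>Graphs with loops and multiple edges: \<open>ends e\<close> is the set of endpoints of the edge \<open>e\<close>,
  a singleton if \<open>e\<close> is a loop.\<close>

record ('w, 'e) multigraph =
  verts :: "'w set"
  edges :: "'e set"
  ends :: "'e \<Rightarrow> 'w set"
  label :: "'e \<Rightarrow> nat"

definition is_cycle :: "('w, 'e) multigraph \<Rightarrow> 'w list \<Rightarrow> 'e list \<Rightarrow> bool" where
  "is_cycle \<Lambda> ws es \<longleftrightarrow>
     es \<noteq> [] \<and> length ws = length es \<and>
     distinct ws \<and> set ws \<subseteq> verts \<Lambda> \<and> distinct es \<and> set es \<subseteq> edges \<Lambda> \<and>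
     (\<forall>i<length es. ends \<Lambda> (es ! i) = {ws ! i, ws ! (Suc i mod length ws)})"

definition balanced_colouring :: "('w, 'e) multigraph \<Rightarrow> nat \<Rightarrow> ('e \<Rightarrow> nat) \<Rightarrow> bool" where
  "balanced_colouring \<Lambda> n C \<longleftrightarrow>
     C \<in> edges \<Lambda> \<rightarrow> {1..n} \<and>
     (\<forall>i\<in>{1..n}. \<exists>p::nat. prime p \<and> (\<forall>e\<in>edges \<Lambda>. C e = i \<longrightarrow> p dvd label \<Lambda> e div 2))"

definition balanced_graph :: "('w, 'e) multigraph \<Rightarrow> bool" where
  "balanced_graph \<Lambda> \<longleftrightarrow>
     (\<exists>n C. balanced_colouring \<Lambda> n C \<and>
        (\<forall>ws es. is_cycle \<Lambda> ws es \<and> even (length es) \<longrightarrow>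
           (\<forall>i\<in>{1..n}. card {e \<in> set es. C e = i} \<in> {0, 2})))"

definition odd_rel :: "'v set \<Rightarrow> 'v set set \<Rightarrow> ('v set \<Rightarrow> nat) \<Rightarrow> ('v \<times> 'v) set" where
  "odd_rel V E l = {(a, b). {a, b} \<in> E \<and> odd (l {a, b})}\<^sup>* \<inter> V \<times> V"

text \<open>The graph $\Gamma_{>2}^{\mathrm{even}}$: its vertices are the classes of vertices of $\Gamma$
  joined by paths of edges with odd label, its edges are the edges of $\Gamma$ with even
  label at least 4.\<close>

definition even_graph ::
  "'v set \<Rightarrow> 'v set set \<Rightarrow> ('v set \<Rightarrow> nat) \<Rightarrow> ('v set, 'v set) multigraph" where
  "even_graph V E l =
    \<lparr>verts = V // odd_rel V E l,
     edges = {e \<in> E. even (l e) \<and> l e > 2},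
     ends = (\<lambda>e. (\<lambda>v. odd_rel V E l `` {v}) ` e),
     label = l\<rparr>"

definition balanced_artin :: "'v set \<Rightarrow> 'v set set \<Rightarrow> ('v set \<Rightarrow> nat) \<Rightarrow> bool" where
  "balanced_artin V E l \<longleftrightarrow> balanced_graph (even_graph V E l)"

end

theory Submission
  imports Defs "HOL-Library.Function_Algebras"
begin

text \<open>
  Membership of $[\chi]$ in $\Sigma^1$ and the condition on the living subgraph depend on \<open>\<chi>\<close> alone, so
  for each non-zero character \<open>\<chi>\<close> of the Artin group \<open>G\<close> it has to be shown that the trivial module has
  type $FP_1$ over the monoid ring of $G_\chi$ iff the living subgraph is connected and dominant.
  Type $FP_1$ means that the augmentation ideal is finitely generated as a left ideal
  (\<open>augmentation_ideal_fg\<close>, \<open>type_FP1_if_ideal_fg\<close>).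

  To see that the condition is sufficient, one shows that the part of the Cayley graph
  above height 0 is connected, where the height of \<open>g\<close> is \<open>\<chi> g\<close>: along an edge from \<open>g\<close> to \<open>g s\<close>
  the basis element changes by \<open>g (s - 1)\<close>, so the augmentation ideal is then generated by finitely
  many elements \<open>s - 1\<close>.  A path can be pushed upwards by right translation with a
  generator \<open>t\<close> of positive height, provided that for each generator \<open>y\<close> the elements \<open>t\<close> and \<open>y t\<close>
  are joined above the height of the edge from 1 to \<open>y\<close> (\<open>nonneg_connected\<close>).  Such a detour is
  local.  Suppose that \<open>u\<close> and \<open>v\<close> are joined by an edge of even label $2k$, so that $(uv)^k$ is
  central in the subgroup generated by them.  If \<open>u\<close> is dead and \<open>v\<close> is living, this element has
  non-zero height, and shifting by it joins the upward direction $v^{\pm 1}$ to its translate by a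
  generator $u^{\pm 1}$; here dominance enters.  If both are
  living and of opposite signs, its height is non-zero unless the edge is dead or has label 2; it then
  joins the two upward directions \<open>v\<close> and $u^{-1}$, and for label 2 the commuting square does the same.
  For equal signs, which includes all edges of odd label between living vertices, the alternating
  product lies above both.  So connectedness of the living subgraph lets one fixed \<open>t\<close> serve for all
  generators.

  For the converse, let \<open>G\<close> act by affine maps on a space of formal series in which \<open>g\<close> raises
  degrees by \<open>\<chi> g\<close>.  The translation parts form a derivation \<open>D\<close>, and a finite set
  generating the augmentation ideal bounds the degrees in $D(G_\chi)$ from below
  (\<open>derivation_bounded_below\<close>).  If \<open>D a = 0\<close> for some \<open>a\<close> of negative height and \<open>D b \<noteq> 0\<close>,
  the elements $a^n b a^{-n-N}$ violate this bound (\<open>not_type_FP1_if_affine_action\<close>).  So it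
  suffices to find an affine action for which some generator of non-zero height fixes the origin
  and another generator moves it.

  If a dead vertex \<open>w\<close> has only dead neighbours, the reflection representation of a Coxeter group
  does this: it has a vector moved by \<open>w\<close> and fixed by all neighbours of \<open>w\<close>, so conjugating
  \<open>w\<close> alone by the translation by this vector respects all relations.
  If the living subgraph is disconnected, the generators in one component act with the fixed point 1
  and all others with the fixed point 0 on one-dimensional series.  The only relations at stake
  belong to dead edges between different components.  There \<open>u v\<close> preserves degrees and multiplies
  by a scalar \<open>\<lambda> u \<lambda> v\<close>, and the relation holds if this scalar is a non-trivial root of unity of order
  dividing half the label, for then the \<open>k\<close>-th powers of \<open>u v\<close> and \<open>v u\<close> are both the identity.
  The divisibility hypotheses provide such scalars.  With a common prime \<open>p\<close> one takes a primitive
  \<open>p\<close>-th root of unity on the vertices of positive height and 1 on the others.  In the balanced case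
  the cycles of dead edges between living vertices have even length, because the height changes sign along a dead edge, so
  they meet each colour in an even number of edges; hence for each colour there is a vertex
  2-colouring that changes exactly along the dead edges of this colour, and the scalars for the
  individual colours can be multiplied.
\<close>


section \<open>Integral monoid rings\<close>

abbreviation supp :: "('g \<Rightarrow> int) \<Rightarrow> 'g set" where
  "supp f \<equiv> {x. f x \<noteq> 0}"

definition augmentation :: "('g \<Rightarrow> int) \<Rightarrow> int" where
  "augmentation f = (\<Sum>x\<in>supp f. f x)"

definition basis_elt :: "'g \<Rightarrow> 'g \<Rightarrow> int" where
  "basis_elt g = (\<lambda>x. if x = g then 1 else 0)"

text \<open>The values lie in a ring so that integer multiples can be written as products with
  \<open>of_int\<close>; it is the additive group that matters.\<close>

definition linear_ext :: "('g \<Rightarrow> 'm::ring_1) \<Rightarrow> ('g \<Rightarrow> int) \<Rightarrow> 'm" where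
  "linear_ext D f = (\<Sum>x\<in>supp f. of_int (f x) * D x)"

lemma linear_ext_superset:
  assumes "finite A" "supp f \<subseteq> A"
  shows "linear_ext D f = (\<Sum>x\<in>A. of_int (f x) * D x)"
  unfolding linear_ext_def by (rule sum.mono_neutral_left) (use assms in auto)

lemma augmentation_linear_ext: "augmentation f = linear_ext (\<lambda>_. 1) f"
  by (simp add: augmentation_def linear_ext_def)

lemma supp_add: "supp (\<lambda>x. f x + h x) \<subseteq> supp f \<union> supp h"
  by auto

lemma linear_ext_add:
  assumes "finite (supp f)" "finite (supp h)"
  shows "linear_ext D (\<lambda>x. f x + h x) = linear_ext D f + linear_ext D h"
proof -
  let ?A = "supp f \<union> supp h"
  have A: "finite ?A" using assms by simp
  have "linear_ext D (\<lambda>x. f x + h x) = (\<Sum>x\<in>?A. of_int (f x + h x) * D x)"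
    by (rule linear_ext_superset[OF A]) (rule supp_add)
  also have "\<dots> = (\<Sum>x\<in>?A. of_int (f x) * D x) + (\<Sum>x\<in>?A. of_int (h x) * D x)"
    by (simp add: sum.distrib algebra_simps)
  also have "\<dots> = linear_ext D f + linear_ext D h"
    using linear_ext_superset[OF A, of f D] linear_ext_superset[OF A, of h D] by auto
  finally show ?thesis .
qed

lemma linear_ext_uminus: "linear_ext D (\<lambda>x. - f x) = - linear_ext D f"
  by (simp add: linear_ext_def sum_negf)

lemma linear_ext_basis: "linear_ext D (basis_elt g) = D g"
proof -
  have "supp (basis_elt g) = {g}" by (auto simp: basis_elt_def)
  then show ?thesis by (simp add: linear_ext_def) (simp add: basis_elt_def)
qed

lemma augmentation_add:
  "finite (supp f) \<Longrightarrow> finite (supp h) \<Longrightarrow>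
     augmentation (\<lambda>x. f x + h x) = augmentation f + augmentation h"
  by (simp add: augmentation_linear_ext linear_ext_add)

lemma augmentation_basis: "augmentation (basis_elt g) = 1"
  by (simp add: augmentation_linear_ext linear_ext_basis)

lemma augmentation_uminus: "augmentation (\<lambda>x. - f x) = - augmentation f"
  by (simp add: augmentation_linear_ext linear_ext_uminus)

lemma monoid_ring_carrier: "f \<in> carrier (monoid_ring M) \<longleftrightarrow> finite (supp f) \<and> supp f \<subseteq> carrier M"
  by (simp add: monoid_ring_def)

lemma monoid_ring_add [simp]: "f \<oplus>\<^bsub>monoid_ring M\<^esub> h = (\<lambda>x. f x + h x)"
  by (simp add: monoid_ring_def)

lemma monoid_ring_zero [simp]: "\<zero>\<^bsub>monoid_ring M\<^esub> = (\<lambda>x. 0)"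
  by (simp add: monoid_ring_def)

lemma monoid_ring_one: "\<one>\<^bsub>monoid_ring M\<^esub> = basis_elt \<one>\<^bsub>M\<^esub>"
  by (simp add: monoid_ring_def basis_elt_def)

text \<open>The supports may be enlarged, so that several products can be summed over common index sets.\<close>

lemma monoid_ring_mult:
  assumes "finite A" "finite B" "supp f \<subseteq> A" "supp h \<subseteq> B"
  shows "(f \<otimes>\<^bsub>monoid_ring M\<^esub> h) x = (\<Sum>y\<in>A. \<Sum>z\<in>B. if y \<otimes>\<^bsub>M\<^esub> z = x then f y * h z else 0)"
proof -
  let ?P = "{(y, z). f y \<noteq> 0 \<and> h z \<noteq> 0 \<and> y \<otimes>\<^bsub>M\<^esub> z = x}"
  have "(f \<otimes>\<^bsub>monoid_ring M\<^esub> h) x = (\<Sum>(y, z)\<in>?P. f y * h z)"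
    by (simp add: monoid_ring_def)
  also have "\<dots> = (\<Sum>(y, z)\<in>?P. if y \<otimes>\<^bsub>M\<^esub> z = x then f y * h z else 0)"
    by (rule sum.cong) auto
  also have "\<dots> = (\<Sum>(y, z)\<in>A \<times> B. if y \<otimes>\<^bsub>M\<^esub> z = x then f y * h z else 0)"
    by (rule sum.mono_neutral_left) (use assms in \<open>auto split: if_splits\<close>)
  finally show ?thesis by (simp add: sum.cartesian_product)
qed

lemma supp_mult:
  assumes "finite (supp f)" "finite (supp h)"
  shows "supp (f \<otimes>\<^bsub>monoid_ring M\<^esub> h) \<subseteq> (\<lambda>(y, z). y \<otimes>\<^bsub>M\<^esub> z) ` (supp f \<times> supp h)"
proof
  fix x assume "x \<in> supp (f \<otimes>\<^bsub>monoid_ring M\<^esub> h)"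
  then have "(\<Sum>y\<in>supp f. \<Sum>z\<in>supp h. if y \<otimes>\<^bsub>M\<^esub> z = x then f y * h z else 0) \<noteq> 0"
    using monoid_ring_mult[OF assms subset_refl subset_refl, of M x] by simp
  then obtain y where y: "y \<in> supp f" "(\<Sum>z\<in>supp h. if y \<otimes>\<^bsub>M\<^esub> z = x then f y * h z else 0) \<noteq> 0"
    by (rule sum.not_neutral_contains_not_neutral)
  from y(2) obtain z where "z \<in> supp h" "(if y \<otimes>\<^bsub>M\<^esub> z = x then f y * h z else 0) \<noteq> 0"
    by (rule sum.not_neutral_contains_not_neutral)
  then show "x \<in> (\<lambda>(y, z). y \<otimes>\<^bsub>M\<^esub> z) ` (supp f \<times> supp h)"
    using y by (auto simp: image_iff split: if_splits)
qed

text \<open>An additive functional of a product can be computed from the products of basis elements,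
  without collecting equal terms.  Multiplicativity of the augmentation, associativity of the
  multiplication and the behaviour of derivations are instances.\<close>

lemma linear_ext_mult:
  assumes "finite A" "finite B" "supp f \<subseteq> A" "supp h \<subseteq> B"
  shows "linear_ext D (f \<otimes>\<^bsub>monoid_ring M\<^esub> h) =
    (\<Sum>y\<in>A. \<Sum>z\<in>B. of_int (f y) * (of_int (h z) * D (y \<otimes>\<^bsub>M\<^esub> z)))"
proof -
  let ?W = "(\<lambda>(y, z). y \<otimes>\<^bsub>M\<^esub> z) ` (A \<times> B)"
  have fin: "finite (supp f)" "finite (supp h)" using assms finite_subset by auto
  have W: "finite ?W" using assms by simp
  have "supp (f \<otimes>\<^bsub>monoid_ring M\<^esub> h) \<subseteq> ?W"
    using supp_mult[OF fin, of M] assms by fast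
  then have "linear_ext D (f \<otimes>\<^bsub>monoid_ring M\<^esub> h) =
      (\<Sum>x\<in>?W. of_int ((f \<otimes>\<^bsub>monoid_ring M\<^esub> h) x) * D x)"
    by (rule linear_ext_superset[OF W])
  also have "\<dots> = (\<Sum>x\<in>?W. \<Sum>y\<in>A. \<Sum>z\<in>B.
      if x = y \<otimes>\<^bsub>M\<^esub> z then of_int (f y) * (of_int (h z) * D x) else 0)"
    unfolding monoid_ring_mult[OF assms] of_int_sum sum_distrib_right
    by (intro sum.cong refl) (auto simp: mult.assoc)
  also have "\<dots> = (\<Sum>y\<in>A. \<Sum>x\<in>?W. \<Sum>z\<in>B.
      if x = y \<otimes>\<^bsub>M\<^esub> z then of_int (f y) * (of_int (h z) * D x) else 0)"
    by (rule sum.swap)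
  also have "\<dots> = (\<Sum>y\<in>A. \<Sum>z\<in>B. \<Sum>x\<in>?W.
      if x = y \<otimes>\<^bsub>M\<^esub> z then of_int (f y) * (of_int (h z) * D x) else 0)"
    by (intro sum.cong refl sum.swap)
  also have "\<dots> = (\<Sum>y\<in>A. \<Sum>z\<in>B. of_int (f y) * (of_int (h z) * D (y \<otimes>\<^bsub>M\<^esub> z)))"
    by (intro sum.cong refl, subst sum.delta[OF W]) force
  finally show ?thesis .
qed

lemma augmentation_mult:
  assumes "finite (supp f)" "finite (supp h)"
  shows "augmentation (f \<otimes>\<^bsub>monoid_ring M\<^esub> h) = augmentation f * augmentation h"
proof -
  have "augmentation (f \<otimes>\<^bsub>monoid_ring M\<^esub> h) = (\<Sum>y\<in>supp f. \<Sum>z\<in>supp h. f y * h z)"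
    using linear_ext_mult[OF assms subset_refl subset_refl, of "\<lambda>_. 1::int" M]
    by (simp add: augmentation_linear_ext)
  then show ?thesis by (simp add: augmentation_def sum_product)
qed

text \<open>Evaluation at a point is itself an additive functional, so identities between elements reduce
  to identities between functionals.\<close>

lemma apply_eq_linear_ext:
  assumes "finite (supp f)"
  shows "f x = linear_ext (\<lambda>y. if y = x then 1 else 0) f"
proof -
  have "linear_ext (\<lambda>y. if y = x then 1 else 0) f = (\<Sum>y\<in>supp f. if y = x then f y else 0)"
    unfolding linear_ext_def by (rule sum.cong) simp_all
  also have "\<dots> = f x" unfolding sum.delta'[OF assms] sum.delta[OF assms] by simp
  finally show ?thesis by (rule sym)
qed

lemma basis_elt_carrier: "g \<in> carrier M \<Longrightarrow> basis_elt g \<in> carrier (monoid_ring M)"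
  by (auto simp: monoid_ring_carrier basis_elt_def)

context monoid
begin

abbreviation monoid_ring_times (infixl "\<star>" 70) where
  "f \<star> h \<equiv> f \<otimes>\<^bsub>monoid_ring G\<^esub> h"

lemma monoid_ring_mult_closed:
  assumes "f \<in> carrier (monoid_ring G)" "h \<in> carrier (monoid_ring G)"
  shows "f \<star> h \<in> carrier (monoid_ring G)"
proof -
  have f: "finite (supp f)" "supp f \<subseteq> carrier G" and h: "finite (supp h)" "supp h \<subseteq> carrier G"
    using assms by (auto simp: monoid_ring_carrier)
  have "(\<lambda>(y, z). y \<otimes> z) ` (supp f \<times> supp h) \<subseteq> carrier G"
    using f h by (auto intro!: m_closed)
  moreover have "finite ((\<lambda>(y, z). y \<otimes> z) ` (supp f \<times> supp h))" using f h by simp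
  ultimately show ?thesis
    using supp_mult[OF f(1) h(1), of G] unfolding monoid_ring_carrier by (meson finite_subset subset_trans)
qed

lemma monoid_ring_mult_assoc:
  assumes "f \<in> carrier (monoid_ring G)" "h \<in> carrier (monoid_ring G)" "k \<in> carrier (monoid_ring G)"
  shows "(f \<star> h) \<star> k =
    f \<star> (h \<star> k)"
proof
  fix x :: 'a
  let ?R = "monoid_ring G"
  let ?e = "\<lambda>y. if y = x then 1 else 0 :: int"
  have f: "finite (supp f)" "supp f \<subseteq> carrier G" and h: "finite (supp h)" "supp h \<subseteq> carrier G"
    and k: "finite (supp k)" "supp k \<subseteq> carrier G"
    using assms by (auto simp: monoid_ring_carrier)
  have fh: "finite (supp (f \<star> h))" and hk: "finite (supp (h \<star> k))"
    and l: "finite (supp ((f \<star> h) \<star> k))" and r: "finite (supp (f \<star> (h \<star> k)))"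
    using assms monoid_ring_mult_closed by (metis monoid_ring_carrier)+
  have "((f \<star> h) \<star> k) x = linear_ext ?e ((f \<star> h) \<star> k)"
    by (rule apply_eq_linear_ext[OF l])
  also have "\<dots> = linear_ext (\<lambda>w. \<Sum>z\<in>supp k. k z * ?e (w \<otimes> z)) (f \<star> h)"
    unfolding linear_ext_mult[OF fh k(1) subset_refl subset_refl, of ?e]
    by (simp add: linear_ext_def sum_distrib_left)
  also have "\<dots> = (\<Sum>y\<in>supp f. \<Sum>u\<in>supp h. f y * (h u * (\<Sum>z\<in>supp k. k z * ?e ((y \<otimes> u) \<otimes> z))))"
    by (simp only: linear_ext_mult[OF f(1) h(1) subset_refl subset_refl] of_int_eq_id id_apply)
  also have "\<dots> = (\<Sum>y\<in>supp f. f y * (\<Sum>u\<in>supp h. \<Sum>z\<in>supp k. h u * (k z * ?e (y \<otimes> (u \<otimes> z)))))"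
  proof (rule sum.cong[OF refl])
    fix y assume y: "y \<in> supp f"
    have "(\<Sum>u\<in>supp h. f y * (h u * (\<Sum>z\<in>supp k. k z * ?e ((y \<otimes> u) \<otimes> z)))) =
        (\<Sum>u\<in>supp h. f y * (\<Sum>z\<in>supp k. h u * (k z * ?e (y \<otimes> (u \<otimes> z)))))"
    proof (rule sum.cong[OF refl])
      fix u assume u: "u \<in> supp h"
      have "(\<Sum>z\<in>supp k. k z * ?e ((y \<otimes> u) \<otimes> z)) = (\<Sum>z\<in>supp k. k z * ?e (y \<otimes> (u \<otimes> z)))"
        by (rule sum.cong[OF refl]) (use y u f h k in \<open>auto simp: m_assoc subsetD\<close>)
      then show "f y * (h u * (\<Sum>z\<in>supp k. k z * ?e ((y \<otimes> u) \<otimes> z))) =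
          f y * (\<Sum>z\<in>supp k. h u * (k z * ?e (y \<otimes> (u \<otimes> z))))"
        by (simp only: sum_distrib_left)
    qed
    then show "(\<Sum>u\<in>supp h. f y * (h u * (\<Sum>z\<in>supp k. k z * ?e ((y \<otimes> u) \<otimes> z)))) =
        f y * (\<Sum>u\<in>supp h. \<Sum>z\<in>supp k. h u * (k z * ?e (y \<otimes> (u \<otimes> z))))"
      by (simp only: sum_distrib_left)
  qed
  also have "\<dots> = (\<Sum>y\<in>supp f. f y * linear_ext (\<lambda>w. ?e (y \<otimes> w)) (h \<star> k))"
    by (simp only: linear_ext_mult[OF h(1) k(1) subset_refl subset_refl] of_int_eq_id id_apply)
  also have "\<dots> = linear_ext ?e (f \<star> (h \<star> k))"
    unfolding linear_ext_mult[OF f(1) hk subset_refl subset_refl]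
    by (simp only: linear_ext_def of_int_eq_id id_apply sum_distrib_left)
  also have "\<dots> = (f \<star> (h \<star> k)) x"
    by (rule apply_eq_linear_ext[OF r, symmetric])
  finally show "((f \<star> h) \<star> k) x = (f \<star> (h \<star> k)) x" .
qed

lemma monoid_ring_distrib:
  assumes "f \<in> carrier (monoid_ring G)" "h \<in> carrier (monoid_ring G)" "k \<in> carrier (monoid_ring G)"
  shows "(\<lambda>x. f x + h x) \<star> k = (\<lambda>x. (f \<star> k) x + (h \<star> k) x)"
    and "k \<star> (\<lambda>x. f x + h x) = (\<lambda>x. (k \<star> f) x + (k \<star> h) x)"
proof -
  let ?A = "supp f \<union> supp h"
  have A: "finite ?A" "supp f \<subseteq> ?A" "supp h \<subseteq> ?A" "supp (\<lambda>x. f x + h x) \<subseteq> ?A"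
    and k: "finite (supp k)"
    using assms by (auto simp: monoid_ring_carrier)
  show "(\<lambda>x. f x + h x) \<star> k = (\<lambda>x. (f \<star> k) x + (h \<star> k) x)"
    unfolding fun_eq_iff monoid_ring_mult[OF A(1) k A(2) subset_refl] monoid_ring_mult[OF A(1) k A(3) subset_refl]
      monoid_ring_mult[OF A(1) k A(4) subset_refl] sum.distrib[symmetric]
    by (intro allI sum.cong refl) (simp add: algebra_simps)
  show "k \<star> (\<lambda>x. f x + h x) = (\<lambda>x. (k \<star> f) x + (k \<star> h) x)"
    unfolding fun_eq_iff monoid_ring_mult[OF k A(1) subset_refl A(2)] monoid_ring_mult[OF k A(1) subset_refl A(3)]
      monoid_ring_mult[OF k A(1) subset_refl A(4)] sum.distrib[symmetric]
    by (intro allI sum.cong refl) (simp add: algebra_simps)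
qed

lemma monoid_ring_basis_mult:
  assumes "finite (supp f)"
  shows "basis_elt g \<star> f = (\<lambda>x. \<Sum>z\<in>supp f. if g \<otimes> z = x then f z else 0)"
    and "f \<star> basis_elt g = (\<lambda>x. \<Sum>z\<in>supp f. if z \<otimes> g = x then f z else 0)"
proof -
  have b: "supp (basis_elt g) \<subseteq> {g}" by (auto simp: basis_elt_def)
  show "basis_elt g \<star> f = (\<lambda>x. \<Sum>z\<in>supp f. if g \<otimes> z = x then f z else 0)"
    unfolding fun_eq_iff monoid_ring_mult[OF finite.insertI[OF finite.emptyI] assms b subset_refl]
    by (auto simp: basis_elt_def intro!: sum.cong)
  show "f \<star> basis_elt g = (\<lambda>x. \<Sum>z\<in>supp f. if z \<otimes> g = x then f z else 0)"
    unfolding fun_eq_iff monoid_ring_mult[OF assms finite.insertI[OF finite.emptyI] subset_refl b]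
    by (auto simp: basis_elt_def intro!: sum.cong)
qed

lemma monoid_ring_unit:
  assumes "f \<in> carrier (monoid_ring G)"
  shows "basis_elt \<one> \<star> f = f" "f \<star> basis_elt \<one> = f"
proof -
  have f: "finite (supp f)" "supp f \<subseteq> carrier G" using assms by (auto simp: monoid_ring_carrier)
  have "(\<Sum>z\<in>supp f. if \<one> \<otimes> z = x then f z else 0) = f x"
    and "(\<Sum>z\<in>supp f. if z \<otimes> \<one> = x then f z else 0) = f x" for x
  proof -
    have "(\<Sum>z\<in>supp f. if \<one> \<otimes> z = x then f z else 0) = (\<Sum>z\<in>supp f. if z = x then f z else 0)"
      by (rule sum.cong) (use f in \<open>auto simp: subsetD\<close>)
    moreover have "(\<Sum>z\<in>supp f. if z \<otimes> \<one> = x then f z else 0) = (\<Sum>z\<in>supp f. if z = x then f z else 0)"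
      by (rule sum.cong) (use f in \<open>auto simp: subsetD\<close>)
    moreover have "(\<Sum>z\<in>supp f. if z = x then f z else 0) = f x" using f by (simp add: sum.delta')
    ultimately show "(\<Sum>z\<in>supp f. if \<one> \<otimes> z = x then f z else 0) = f x"
      "(\<Sum>z\<in>supp f. if z \<otimes> \<one> = x then f z else 0) = f x" by simp_all
  qed
  then show "basis_elt \<one> \<star> f = f" "f \<star> basis_elt \<one> = f"
    by (simp_all add: monoid_ring_basis_mult[OF f(1)])
qed

lemma monoid_ring_add_closed:
  assumes "f \<in> carrier (monoid_ring G)" "h \<in> carrier (monoid_ring G)"
  shows "(\<lambda>x. f x + h x) \<in> carrier (monoid_ring G)"
proof -
  have "supp (\<lambda>x. f x + h x) \<subseteq> supp f \<union> supp h" by (rule supp_add)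
  then show ?thesis using assms unfolding monoid_ring_carrier
    by (meson Un_least finite_UnI finite_subset subset_trans)
qed

lemma monoid_ring_uminus_closed:
  "f \<in> carrier (monoid_ring G) \<Longrightarrow> (\<lambda>x. - f x) \<in> carrier (monoid_ring G)"
  by (simp add: monoid_ring_carrier)

lemma monoid_ring_zero_closed: "(\<lambda>x. 0) \<in> carrier (monoid_ring G)"
  by (simp add: monoid_ring_carrier)

lemma ring_monoid_ring: "ring (monoid_ring G)"
proof (rule ringI)
  show "abelian_group (monoid_ring G)"
  proof (rule abelian_groupI)
    fix f assume "f \<in> carrier (monoid_ring G)"
    then show "\<exists>h\<in>carrier (monoid_ring G). h \<oplus>\<^bsub>monoid_ring G\<^esub> f = \<zero>\<^bsub>monoid_ring G\<^esub>"
      by (intro bexI[of _ "\<lambda>x. - f x"]) (simp_all add: monoid_ring_uminus_closed)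
  qed (simp_all add: monoid_ring_add_closed monoid_ring_zero_closed ac_simps)
  show "Group.monoid (monoid_ring G)"
    by (rule monoidI)
      (simp_all add: monoid_ring_mult_closed monoid_ring_mult_assoc monoid_ring_one monoid_ring_unit basis_elt_carrier)
qed (simp_all add: monoid_ring_distrib)

lemma basis_mult_basis:
  "basis_elt g \<star> basis_elt h = basis_elt (g \<otimes> h)"
proof -
  have "supp (basis_elt h) = {h}" by (auto simp: basis_elt_def)
  then show ?thesis
    by (subst monoid_ring_basis_mult(1)) (auto simp: fun_eq_iff basis_elt_def)
qed

lemma left_module_trivial: "left_module (monoid_ring G) trivial_module"
proof -
  have "abelian_group (trivial_module :: ('a \<Rightarrow> int, int) module)"
    by (rule abelian_groupI) (auto simp: trivial_module_def intro: exI[of _ "- _"])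
  moreover have "left_module_axioms (monoid_ring G) (trivial_module :: ('a \<Rightarrow> int, int) module)"
  proof
    fix a b :: "'a \<Rightarrow> int" and x :: int
    assume ab: "a \<in> carrier (monoid_ring G)" "b \<in> carrier (monoid_ring G)"
    show "(a \<oplus>\<^bsub>monoid_ring G\<^esub> b) \<odot>\<^bsub>trivial_module\<^esub> x =
        a \<odot>\<^bsub>trivial_module\<^esub> x \<oplus>\<^bsub>trivial_module\<^esub> b \<odot>\<^bsub>trivial_module\<^esub> x"
      using ab augmentation_add[of a b]
      by (simp add: trivial_module_def monoid_ring_carrier augmentation_def distrib_right)
    show "(a \<star> b) \<odot>\<^bsub>trivial_module\<^esub> x =
        a \<odot>\<^bsub>trivial_module\<^esub> (b \<odot>\<^bsub>trivial_module\<^esub> x)"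
      using ab augmentation_mult[of a b G]
      by (simp add: trivial_module_def monoid_ring_carrier augmentation_def mult.assoc)
  next
    fix x :: int
    show "\<one>\<^bsub>monoid_ring G\<^esub> \<odot>\<^bsub>trivial_module\<^esub> x = x"
      using augmentation_basis[of \<one>] by (simp add: monoid_ring_one trivial_module_def augmentation_def)
  qed (auto simp: trivial_module_def algebra_simps)
  ultimately show ?thesis
    by (simp add: left_module_def ring_monoid_ring)
qed

end


section \<open>Finite generation of the augmentation ideal\<close>

definition unit_vec :: "('r, 'a) ring_scheme \<Rightarrow> nat \<Rightarrow> nat \<Rightarrow> nat \<Rightarrow> 'r" where
  "unit_vec R n j = (\<lambda>i\<in>{..<n}. if i = j then \<one>\<^bsub>R\<^esub> else \<zero>\<^bsub>R\<^esub>)"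

lemma free_module_simps [simp]:
  "carrier (free_module R n) = {..<n} \<rightarrow>\<^sub>E carrier R"
  "\<zero>\<^bsub>free_module R n\<^esub> = (\<lambda>i\<in>{..<n}. \<zero>\<^bsub>R\<^esub>)"
  "x \<oplus>\<^bsub>free_module R n\<^esub> y = (\<lambda>i\<in>{..<n}. x i \<oplus>\<^bsub>R\<^esub> y i)"
  "a \<odot>\<^bsub>free_module R n\<^esub> x = (\<lambda>i\<in>{..<n}. a \<otimes>\<^bsub>R\<^esub> x i)"
  by (simp_all add: free_module_def)

lemma left_module_free:
  fixes R (structure)
  assumes "ring R"
  shows "left_module R (free_module R n)"
proof -
  interpret ring R by fact
  have "abelian_group (free_module R n)"
  proof (rule abelian_groupI)
    fix x assume "x \<in> carrier (free_module R n)"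
    then show "\<exists>y\<in>carrier (free_module R n). y \<oplus>\<^bsub>free_module R n\<^esub> x = \<zero>\<^bsub>free_module R n\<^esub>"
      by (intro bexI[of _ "\<lambda>i\<in>{..<n}. \<ominus> x i"])
        (auto simp: fun_eq_iff restrict_def PiE_mem l_neg PiE_def extensional_def Pi_def)
  qed (auto simp: fun_eq_iff restrict_def PiE_mem a_ac PiE_def extensional_def Pi_def)
  moreover have "left_module_axioms R (free_module R n)"
    by standard (auto simp: fun_eq_iff restrict_def l_distr r_distr m_assoc PiE_def extensional_def Pi_def)
  ultimately show ?thesis by (simp add: left_module_def assms)
qed

lemma fg_projective_free:
  assumes "ring R"
  shows "fg_projective R (free_module R n)"
  unfolding fg_projective_def
proof (intro conjI left_module_free[OF assms])
  have "(\<lambda>x. x) \<in> module_hom R (free_module R n) (free_module R n)"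
    by (simp add: module_hom_def)
  then show "\<exists>m. \<exists>\<iota>\<in>module_hom R (free_module R n) (free_module R m).
      \<exists>\<pi>\<in>module_hom R (free_module R m) (free_module R n). \<forall>x\<in>carrier (free_module R n). \<pi> (\<iota> x) = x"
    by (intro exI[of _ n] bexI[of _ "\<lambda>x. x"]) auto
qed

text \<open>An induction principle: a vector is built up from multiples of the unit vectors, one
  coordinate at a time.\<close>

lemma free_module_span:
  fixes R (structure)
  assumes "ring R"
    and zero: "\<zero>\<^bsub>free_module R n\<^esub> \<in> J"
    and unit: "\<And>j. j < n \<Longrightarrow> unit_vec R n j \<in> J"
    and add: "\<And>x y. x \<in> J \<Longrightarrow> y \<in> J \<Longrightarrow> x \<oplus>\<^bsub>free_module R n\<^esub> y \<in> J"
    and smult: "\<And>a x. a \<in> carrier R \<Longrightarrow> x \<in> J \<Longrightarrow> a \<odot>\<^bsub>free_module R n\<^esub> x \<in> J"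
    and z: "z \<in> carrier (free_module R n)"
  shows "z \<in> J"
proof -
  interpret ring R by fact
  define t where "t k = (\<lambda>i\<in>{..<n}. if i < k then z i else \<zero>)" for k
  have zi: "i < n \<Longrightarrow> z i \<in> carrier R" for i using z by auto
  have "k \<le> n \<Longrightarrow> t k \<in> J" for k
  proof (induction k)
    case 0
    then show ?case using zero by (simp add: t_def restrict_def)
  next
    case (Suc k)
    have "t (Suc k) = t k \<oplus>\<^bsub>free_module R n\<^esub> (z k \<odot>\<^bsub>free_module R n\<^esub> unit_vec R n k)"
      using Suc.prems zi by (auto simp: t_def unit_vec_def fun_eq_iff restrict_def less_Suc_eq)
    moreover have "t k \<in> J" using Suc by simp
    moreover have "z k \<odot>\<^bsub>free_module R n\<^esub> unit_vec R n k \<in> J"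
      by (rule smult[OF zi unit]) (use Suc.prems in auto)
    ultimately show ?case using add by metis
  qed
  moreover have "t n = z" using z by (auto simp: t_def fun_eq_iff PiE_def extensional_def)
  ultimately show ?thesis by (metis order_refl)
qed

lemma (in left_module) smult_zero: "x \<in> carrier M \<Longrightarrow> \<zero> \<odot>\<^bsub>M\<^esub> x = \<zero>\<^bsub>M\<^esub>"
  using smult_l_distr[of \<zero> \<zero> x] smult_closed[of \<zero> x]
  by (metis M.add.l_cancel_one R.l_zero R.zero_closed)

lemma module_hom_zero:
  assumes "left_module R M" "left_module R N" "f \<in> module_hom R M N"
  shows "f \<zero>\<^bsub>M\<^esub> = \<zero>\<^bsub>N\<^esub>"
proof -
  interpret M: left_module R M by fact
  interpret N: left_module R N by fact
  have "f (\<zero>\<^bsub>R\<^esub> \<odot>\<^bsub>M\<^esub> \<zero>\<^bsub>M\<^esub>) = \<zero>\<^bsub>R\<^esub> \<odot>\<^bsub>N\<^esub> f \<zero>\<^bsub>M\<^esub>"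
    using assms(3) unfolding module_hom_def by simp
  moreover have "f \<zero>\<^bsub>M\<^esub> \<in> carrier N" using assms(3) unfolding module_hom_def by auto
  ultimately show ?thesis by (simp add: M.smult_zero N.smult_zero)
qed

lemma module_homD:
  assumes "f \<in> module_hom R M N"
  shows "x \<in> carrier M \<Longrightarrow> f x \<in> carrier N"
    and "x \<in> carrier M \<Longrightarrow> y \<in> carrier M \<Longrightarrow> f (x \<oplus>\<^bsub>M\<^esub> y) = f x \<oplus>\<^bsub>N\<^esub> f y"
    and "a \<in> carrier R \<Longrightarrow> x \<in> carrier M \<Longrightarrow> f (a \<odot>\<^bsub>M\<^esub> x) = a \<odot>\<^bsub>N\<^esub> f x"
  using assms unfolding module_hom_def by auto

lemma trivial_module_simps [simp]:
  "carrier trivial_module = UNIV"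
  "\<zero>\<^bsub>trivial_module\<^esub> = 0"
  "x \<oplus>\<^bsub>trivial_module\<^esub> y = x + y"
  "f \<odot>\<^bsub>trivial_module\<^esub> x = augmentation f * x"
  by (simp_all add: trivial_module_def augmentation_def)

definition augmentation_ideal :: "('g, 'a) monoid_scheme \<Rightarrow> ('g \<Rightarrow> int) set" where
  "augmentation_ideal M = {f \<in> carrier (monoid_ring M). augmentation f = 0}"

text \<open>Closure under negation follows from multiplication by \<open>-1\<close>.\<close>

definition left_ideal :: "('r, 'a) ring_scheme \<Rightarrow> 'r set \<Rightarrow> bool" where
  "left_ideal R J \<longleftrightarrow> \<zero>\<^bsub>R\<^esub> \<in> J \<and> (\<forall>x\<in>J. \<forall>y\<in>J. x \<oplus>\<^bsub>R\<^esub> y \<in> J) \<and>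
     (\<forall>a\<in>carrier R. \<forall>x\<in>J. a \<otimes>\<^bsub>R\<^esub> x \<in> J)"

context monoid
begin

lemma monoid_ring_sum_closed:
  assumes "finite A" "\<And>j. j \<in> A \<Longrightarrow> f j \<in> carrier (monoid_ring G)"
  shows "(\<lambda>x. \<Sum>j\<in>A. f j x) \<in> carrier (monoid_ring G)"
  using assms
proof (induction rule: finite_induct)
  case empty
  then show ?case using monoid_ring_zero_closed by simp
next
  case (insert a A)
  then show ?case using monoid_ring_add_closed[of "f a" "\<lambda>x. \<Sum>j\<in>A. f j x"] by simp
qed

lemma monoid_ring_scale_closed:
  assumes "f \<in> carrier (monoid_ring G)"
  shows "(\<lambda>x. (m::int) * f x) \<in> carrier (monoid_ring G)"
proof -
  have "supp (\<lambda>x. m * f x) \<subseteq> supp f" by auto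
  then show ?thesis using assms unfolding monoid_ring_carrier by (meson finite_subset subset_trans)
qed

lemma augmentation_scale:
  assumes "f \<in> carrier (monoid_ring G)"
  shows "augmentation (\<lambda>x. m * f x) = m * augmentation f"
proof -
  have f: "finite (supp f)" using assms by (simp add: monoid_ring_carrier)
  have "augmentation (\<lambda>x. m * f x) = (\<Sum>x\<in>supp f. m * f x)"
    unfolding augmentation_linear_ext by (subst linear_ext_superset[OF f]) auto
  then show ?thesis by (simp add: augmentation_def sum_distrib_left)
qed

lemma monoid_ring_mult_scale:
  assumes "a \<in> carrier (monoid_ring G)" "f \<in> carrier (monoid_ring G)"
  shows "a \<star> (\<lambda>x. m * f x) = (\<lambda>x. m * (a \<star> f) x)"
proof -
  have a: "finite (supp a)" and f: "finite (supp f)" "supp (\<lambda>x. m * f x) \<subseteq> supp f"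
    using assms by (auto simp: monoid_ring_carrier)
  show ?thesis
    unfolding fun_eq_iff monoid_ring_mult[OF a f(1) subset_refl f(2)] monoid_ring_mult[OF a f(1) subset_refl subset_refl]
      sum_distrib_left
    by (intro allI sum.cong refl) simp
qed

lemma monoid_ring_mult_sum:
  assumes "finite A" "a \<in> carrier (monoid_ring G)" "\<And>j. j \<in> A \<Longrightarrow> f j \<in> carrier (monoid_ring G)"
  shows "a \<star> (\<lambda>x. \<Sum>j\<in>A. f j x) = (\<lambda>x. \<Sum>j\<in>A. (a \<star> f j) x)"
  using assms(1,3)
proof (induction rule: finite_induct)
  case empty
  interpret R: ring "monoid_ring G" by (rule ring_monoid_ring)
  show ?case using R.r_null[OF assms(2)] by simp
next
  case (insert b A)
  then show ?case
    using monoid_ring_distrib(2)[of "f b" "\<lambda>x. \<Sum>j\<in>A. f j x" a] monoid_ring_sum_closed[of A f] assms(2) by simp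
qed

text \<open>This is the argument of Schanuel's lemma.  As $P_0$ is a direct summand of a free module, the
  augmentation $\varepsilon$ of $P_0$ lifts to a module homomorphism \<open>K\<close> from $P_0$ to the monoid ring
  whose composition with the augmentation of the ring is $\varepsilon$.  Choose $x_0$ with
  $\varepsilon(x_0) = 1$ and put $r = K(x_0) - 1$.  If \<open>f\<close> lies in the augmentation ideal, then
  $f x_0$ is in the kernel of $\varepsilon$, hence in the image of $P_1$, and
  $f = K(f x_0) - f r$.  So \<open>r\<close> and the images under \<open>K\<close> of the generators of $P_1$ generate.\<close>

lemma augmentation_ideal_fg:
  assumes "type_FP (monoid_ring G) trivial_module 1"
  shows "\<exists>T. finite T \<and> T \<subseteq> augmentation_ideal G \<and>
    (\<forall>J. left_ideal (monoid_ring G) J \<longrightarrow> T \<subseteq> J \<longrightarrow> augmentation_ideal G \<subseteq> J)"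
proof -
  let ?R = "monoid_ring G"
  let ?Z = "trivial_module :: ('a \<Rightarrow> int, int) module"
  interpret R: ring ?R by (rule ring_monoid_ring)
  obtain P :: "nat \<Rightarrow> ('a \<Rightarrow> int, nat \<Rightarrow> 'a \<Rightarrow> int) module" and \<epsilon> \<delta>
    where H: "(\<forall>i\<le>1. fg_projective ?R (P i)) \<and>
        \<epsilon> \<in> module_hom ?R (P 0) ?Z \<and> \<epsilon> ` carrier (P 0) = carrier ?Z \<and>
        (\<forall>i<1. \<delta> i \<in> module_hom ?R (P (Suc i)) (P i) \<and>
           \<delta> i ` carrier (P (Suc i)) =
             {x \<in> carrier (P i).
                case i of 0 \<Rightarrow> \<epsilon> x = \<zero>\<^bsub>?Z\<^esub> | Suc j \<Rightarrow> \<delta> j x = \<zero>\<^bsub>P j\<^esub>})"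
    using conjunct2[OF assms[unfolded type_FP_def]] by (elim exE) (rule that, assumption)
  note P = conjunct1[OF H] and eps = conjunct1[OF conjunct2[OF H]]
      conjunct1[OF conjunct2[OF conjunct2[OF H]]]
    and del = conjunct2[OF conjunct2[OF conjunct2[OF H]]]
  have P0: "fg_projective ?R (P 0)" and P1: "fg_projective ?R (P 1)" using P by simp_all
  have del0: "\<delta> 0 \<in> module_hom ?R (P 1) (P 0)"
    and ker: "\<delta> 0 ` carrier (P 1) = {x \<in> carrier (P 0). \<epsilon> x = 0}"
    using del by auto
  interpret P0: left_module ?R "P 0" using P0 by (simp add: fg_projective_def)
  interpret P1: left_module ?R "P 1" using P1 by (simp add: fg_projective_def)
  obtain n \<iota>0 \<pi>0 where i0: "\<iota>0 \<in> module_hom ?R (P 0) (free_module ?R n)"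
    and p0: "\<pi>0 \<in> module_hom ?R (free_module ?R n) (P 0)"
    and ret0: "\<And>x. x \<in> carrier (P 0) \<Longrightarrow> \<pi>0 (\<iota>0 x) = x"
    using P0 unfolding fg_projective_def by blast
  obtain m \<iota>1 \<pi>1 where i1: "\<iota>1 \<in> module_hom ?R (P 1) (free_module ?R m)"
    and p1: "\<pi>1 \<in> module_hom ?R (free_module ?R m) (P 1)"
    and ret1: "\<And>x. x \<in> carrier (P 1) \<Longrightarrow> \<pi>1 (\<iota>1 x) = x"
    using P1 unfolding fg_projective_def by blast
  let ?Fn = "free_module ?R n" and ?Fm = "free_module ?R m"
  note Fn = left_module_free[OF R.ring_axioms, of n] and Fm = left_module_free[OF R.ring_axioms, of m]
  interpret Fn: left_module ?R "?Fn" by (rule Fn)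
  interpret Fm: left_module ?R "?Fm" by (rule Fm)
  have uv: "unit_vec ?R k j \<in> carrier (free_module ?R k)" for k j
    by (auto simp: unit_vec_def monoid_ring_zero_closed)

  \<comment> \<open>Each unit vector is sent to the integer multiple of 1 that has the same augmentation.\<close>
  define F where "F z = (\<lambda>x. \<Sum>j<n. \<epsilon> (\<pi>0 (unit_vec ?R n j)) * z j x)" for z :: "nat \<Rightarrow> 'a \<Rightarrow> int"
  have F_closed: "F z \<in> carrier ?R" if "z \<in> carrier ?Fn" for z
    unfolding F_def using that by (intro monoid_ring_sum_closed monoid_ring_scale_closed) auto
  have F_add: "F (z \<oplus>\<^bsub>?Fn\<^esub> z') = (\<lambda>x. F z x + F z' x)" for z z'
    unfolding F_def by (simp add: sum.distrib algebra_simps)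
  have F_smult: "F (a \<odot>\<^bsub>?Fn\<^esub> z) = a \<star> F z"
    if a: "a \<in> carrier ?R" and z: "z \<in> carrier ?Fn" for a z
  proof -
    have zj: "z j \<in> carrier ?R" if "j < n" for j using z that by auto
    have "a \<star> F z = (\<lambda>x. \<Sum>j<n. (a \<star> (\<lambda>x. \<epsilon> (\<pi>0 (unit_vec ?R n j)) * z j x)) x)"
      unfolding F_def by (rule monoid_ring_mult_sum) (use a zj monoid_ring_scale_closed in auto)
    also have "\<dots> = (\<lambda>x. \<Sum>j<n. \<epsilon> (\<pi>0 (unit_vec ?R n j)) * (a \<star> z j) x)"
      by (rule ext, rule sum.cong) (use a zj monoid_ring_mult_scale in auto)
    finally show ?thesis by (simp add: F_def)
  qed
  have F_aug: "augmentation (F z) = \<epsilon> (\<pi>0 z)" if z: "z \<in> carrier ?Fn" for z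
  proof -
    let ?J = "{z \<in> carrier ?Fn. augmentation (F z) = \<epsilon> (\<pi>0 z)}"
    have "z \<in> ?J"
    proof (rule free_module_span[OF R.ring_axioms _ _ _ _ z])
      have "\<epsilon> (\<pi>0 \<zero>\<^bsub>?Fn\<^esub>) = 0"
        using module_hom_zero[OF Fn P0.left_module_axioms p0]
          module_hom_zero[OF P0.left_module_axioms left_module_trivial eps(1)] by simp
      then show "\<zero>\<^bsub>?Fn\<^esub> \<in> ?J"
        using Fn.zero_closed by (simp add: F_def augmentation_def)
    next
      fix j assume j: "j < n"
      have "F (unit_vec ?R n j) = (\<lambda>x. \<epsilon> (\<pi>0 (unit_vec ?R n j)) * basis_elt \<one> x)"
      proof
        fix x
        have "F (unit_vec ?R n j) x =
            (\<Sum>i<n. if i = j then \<epsilon> (\<pi>0 (unit_vec ?R n j)) * basis_elt \<one> x else 0)"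
          unfolding F_def by (rule sum.cong) (auto simp: unit_vec_def monoid_ring_one)
        then show "F (unit_vec ?R n j) x = \<epsilon> (\<pi>0 (unit_vec ?R n j)) * basis_elt \<one> x"
          using j by simp
      qed
      then show "unit_vec ?R n j \<in> ?J"
        using uv augmentation_scale[OF basis_elt_carrier[OF one_closed]] augmentation_basis[of \<one>] by auto
    next
      fix x y assume "x \<in> ?J"
        "y \<in> ?J"
      then have x: "x \<in> carrier ?Fn" "augmentation (F x) = \<epsilon> (\<pi>0 x)"
        and y: "y \<in> carrier ?Fn" "augmentation (F y) = \<epsilon> (\<pi>0 y)" by auto
      have "augmentation (F (x \<oplus>\<^bsub>?Fn\<^esub> y)) = augmentation (F x) + augmentation (F y)"
        unfolding F_add by (rule augmentation_add) (use F_closed x y in \<open>auto simp only: monoid_ring_carrier\<close>)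
      moreover have "\<epsilon> (\<pi>0 (x \<oplus>\<^bsub>?Fn\<^esub> y)) = \<epsilon> (\<pi>0 x) + \<epsilon> (\<pi>0 y)"
        using module_homD(2)[OF p0 x(1) y(1)]
          module_homD(2)[OF eps(1) module_homD(1)[OF p0 x(1)] module_homD(1)[OF p0 y(1)]] by simp
      ultimately show "x \<oplus>\<^bsub>?Fn\<^esub> y \<in> ?J"
        using x y Fn.add.m_closed[OF x(1) y(1)] by auto
    next
      fix a x assume a: "a \<in> carrier ?R"
        and "x \<in> ?J"
      then have x: "x \<in> carrier ?Fn" "augmentation (F x) = \<epsilon> (\<pi>0 x)" by auto
      have "augmentation (F (a \<odot>\<^bsub>?Fn\<^esub> x)) = augmentation a * augmentation (F x)"
        unfolding F_smult[OF a x(1)]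
        by (rule augmentation_mult) (use F_closed x a in \<open>auto simp only: monoid_ring_carrier\<close>)
      moreover have "\<epsilon> (\<pi>0 (a \<odot>\<^bsub>?Fn\<^esub> x)) = augmentation a * \<epsilon> (\<pi>0 x)"
        using module_homD(3)[OF p0 a x(1)] module_homD(3)[OF eps(1) a module_homD(1)[OF p0 x(1)]] by simp
      ultimately show "a \<odot>\<^bsub>?Fn\<^esub> x \<in> ?J"
        using x Fn.smult_closed[OF a x(1)] by auto
    qed
    then show ?thesis by simp
  qed

  define K where "K x = F (\<iota>0 x)" for x
  have K_closed: "K x \<in> carrier ?R" and K_aug: "augmentation (K x) = \<epsilon> x" if "x \<in> carrier (P 0)" for x
    using that F_closed F_aug module_homD(1)[OF i0] ret0 by (auto simp: K_def)
  have K_add: "K (x \<oplus>\<^bsub>P 0\<^esub> y) = (\<lambda>g. K x g + K y g)"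
    if "x \<in> carrier (P 0)" "y \<in> carrier (P 0)" for x y
    unfolding K_def module_homD(2)[OF i0 that] by (rule F_add)
  have K_smult: "K (a \<odot>\<^bsub>P 0\<^esub> x) = a \<star> K x"
    if "a \<in> carrier ?R" "x \<in> carrier (P 0)" for a x
    unfolding K_def module_homD(3)[OF i0 that] by (rule F_smult) (use that module_homD(1)[OF i0] in auto)
  obtain x0 where x0: "x0 \<in> carrier (P 0)" "\<epsilon> x0 = 1"
    using eps(2) by (metis UNIV_I imageE trivial_module_simps(1))
  define r where "r = (\<lambda>g. K x0 g + - basis_elt \<one> g)"
  define y where "y j = \<delta> 0 (\<pi>1 (unit_vec ?R m j))" for j
  have y: "y j \<in> carrier (P 0)" "\<epsilon> (y j) = 0" for j
    using ker module_homD(1)[OF p1 uv[of m j]] unfolding y_def by blast+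
  let ?T = "insert r ((\<lambda>j. K (y j)) ` {..<m})"
  have r_closed: "r \<in> carrier ?R"
    unfolding r_def by (intro monoid_ring_add_closed monoid_ring_uminus_closed K_closed x0 basis_elt_carrier one_closed)
  have "augmentation r = augmentation (K x0) + augmentation (\<lambda>g. - basis_elt \<one> g)"
    unfolding r_def
    by (rule augmentation_add)
      (use K_closed[OF x0(1)] monoid_ring_uminus_closed[OF basis_elt_carrier[OF one_closed]] in \<open>auto simp only: monoid_ring_carrier\<close>)
  then have r_aug: "augmentation r = 0"
    using K_aug x0 by (simp add: augmentation_uminus augmentation_basis)
  have "augmentation_ideal G \<subseteq> J" if J: "left_ideal ?R J" and T: "?T \<subseteq> J" for J
  proof
    fix f assume "f \<in> augmentation_ideal G"
    then have f: "f \<in> carrier ?R" "augmentation f = 0" by (auto simp: augmentation_ideal_def)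
    have zero: "(\<lambda>_. 0) \<in> J"
      and add: "\<And>x y. x \<in> J \<Longrightarrow> y \<in> J \<Longrightarrow> (\<lambda>g. x g + y g) \<in> J"
      and mult: "\<And>a x. a \<in> carrier ?R \<Longrightarrow> x \<in> J \<Longrightarrow> a \<star> x \<in> J"
      using J by (auto simp: left_ideal_def)
    have J1: "K (\<delta> 0 (\<pi>1 z)) \<in> J" if z: "z \<in> carrier ?Fm" for z
    proof -
      let ?J = "{z \<in> carrier ?Fm. K (\<delta> 0 (\<pi>1 z)) \<in> J}"
      note pc = module_homD(1)[OF p1] and dc = module_homD(1)[OF del0]
      have "z \<in> ?J"
      proof (rule free_module_span[OF R.ring_axioms _ _ _ _ z])
        have "K (\<delta> 0 (\<pi>1 \<zero>\<^bsub>?Fm\<^esub>)) = K \<zero>\<^bsub>P 0\<^esub>"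
          using module_hom_zero[OF Fm P1.left_module_axioms p1]
            module_hom_zero[OF P1.left_module_axioms P0.left_module_axioms del0] by simp
        also have "\<dots> = F \<zero>\<^bsub>?Fn\<^esub>"
          using module_hom_zero[OF P0.left_module_axioms Fn i0] by (simp add: K_def)
        also have "\<dots> = (\<lambda>_. 0)" by (simp add: F_def)
        finally show "\<zero>\<^bsub>?Fm\<^esub> \<in> ?J" using zero Fm.zero_closed by simp
      next
        fix j assume "j < m"
        then show "unit_vec ?R m j \<in> ?J" using T uv y_def by auto
      next
        fix x y assume "x \<in> ?J" "y \<in> ?J"
        then have x: "x \<in> carrier ?Fm" "K (\<delta> 0 (\<pi>1 x)) \<in> J"
          and y: "y \<in> carrier ?Fm" "K (\<delta> 0 (\<pi>1 y)) \<in> J" by auto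
        have "K (\<delta> 0 (\<pi>1 (x \<oplus>\<^bsub>?Fm\<^esub> y))) = (\<lambda>g. K (\<delta> 0 (\<pi>1 x)) g + K (\<delta> 0 (\<pi>1 y)) g)"
          unfolding module_homD(2)[OF p1 x(1) y(1)] module_homD(2)[OF del0 pc[OF x(1)] pc[OF y(1)]]
          by (rule K_add) (use pc dc x y in blast)+
        then show "x \<oplus>\<^bsub>?Fm\<^esub> y \<in> ?J"
          using add x y Fm.add.m_closed[OF x(1) y(1)] by auto
      next
        fix a x assume a: "a \<in> carrier ?R" and "x \<in> ?J"
        then have x: "x \<in> carrier ?Fm" "K (\<delta> 0 (\<pi>1 x)) \<in> J" by auto
        have "K (\<delta> 0 (\<pi>1 (a \<odot>\<^bsub>?Fm\<^esub> x))) = a \<star> K (\<delta> 0 (\<pi>1 x))"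
          unfolding module_homD(3)[OF p1 a x(1)] module_homD(3)[OF del0 a pc[OF x(1)]]
          by (rule K_smult[OF a]) (use pc dc x in blast)
        then show "a \<odot>\<^bsub>?Fm\<^esub> x \<in> ?J"
          using mult a x Fm.smult_closed[OF a x(1)] by auto
      qed
      then show ?thesis by simp
    qed
    have "f \<odot>\<^bsub>P 0\<^esub> x0 \<in> carrier (P 0)" "\<epsilon> (f \<odot>\<^bsub>P 0\<^esub> x0) = 0"
      using P0.smult_closed[OF f(1) x0(1)] module_homD(3)[OF eps(1) f(1) x0(1)] f(2) by auto
    then obtain y' where y': "y' \<in> carrier (P 1)" "f \<odot>\<^bsub>P 0\<^esub> x0 = \<delta> 0 y'"
      using ker by blast
    have "K (f \<odot>\<^bsub>P 0\<^esub> x0) \<in> J"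
      using J1[OF module_homD(1)[OF i1 y'(1)]] ret1[OF y'(1)] y'(2) by simp
    then have 1: "f \<star> K x0 \<in> J" using K_smult[OF f(1) x0(1)] by simp
    have 2: "(\<lambda>g. - f g) \<star> r \<in> J"
      using T by (intro mult monoid_ring_uminus_closed f(1)) auto
    have "K x0 = (\<lambda>g. basis_elt \<one> g + r g)" by (simp add: r_def)
    then have 3: "f \<star> K x0 = (\<lambda>g. f g + (f \<star> r) g)"
      using monoid_ring_distrib(2)[OF basis_elt_carrier[OF one_closed] r_closed f(1)] monoid_ring_unit(2)[OF f(1)] by simp
    have "(\<lambda>g. 0) = (\<lambda>g. f g + - f g) \<star> r"
      using R.l_null[OF r_closed] by simp
    also have "\<dots> = (\<lambda>g. (f \<star> r) g + ((\<lambda>g. - f g) \<star> r) g)"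
      by (rule monoid_ring_distrib(1)[OF f(1) monoid_ring_uminus_closed[OF f(1)] r_closed])
    finally have 4: "(f \<star> r) g + ((\<lambda>g. - f g) \<star> r) g = 0" for g
      by (metis)
    have "f = (\<lambda>g. (f \<star> K x0) g + ((\<lambda>g. - f g) \<star> r) g)"
      using 4 by (simp add: 3 fun_eq_iff add.assoc)
    then show "f \<in> J" using add[OF 1 2] by simp
  qed
  moreover have "?T \<subseteq> augmentation_ideal G"
    using r_closed K_closed y r_aug K_aug by (auto simp: augmentation_ideal_def)
  moreover have "finite ?T" by simp
  ultimately show ?thesis by blast
qed

end


section \<open>Modules of type $FP_1$ from connected Cayley graphs\<close>

lemma (in group) nonneg_submonoid_monoid:
  assumes "\<chi> \<in> hom G real_add_group"
  shows "Group.monoid (nonneg_submonoid G \<chi>)"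
proof -
  have mult: "\<chi> (x \<otimes> y) = \<chi> x + \<chi> y" if "x \<in> carrier G" "y \<in> carrier G" for x y
    using assms that by (simp add: hom_def real_add_group_def)
  have "\<chi> \<one> = 0" using mult[of \<one> \<one>] by simp
  then show ?thesis
    by (intro monoidI) (auto simp: nonneg_submonoid_def mult m_assoc)
qed

lemma module_homI:
  assumes "\<And>x. x \<in> carrier M \<Longrightarrow> f x \<in> carrier N"
    and "\<And>x y. x \<in> carrier M \<Longrightarrow> y \<in> carrier M \<Longrightarrow> f (x \<oplus>\<^bsub>M\<^esub> y) = f x \<oplus>\<^bsub>N\<^esub> f y"
    and "\<And>a x. a \<in> carrier R \<Longrightarrow> x \<in> carrier M \<Longrightarrow> f (a \<odot>\<^bsub>M\<^esub> x) = a \<odot>\<^bsub>N\<^esub> f x"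
  shows "f \<in> module_hom R M N"
  using assms by (auto simp: module_hom_def)

context monoid
begin

text \<open>The resolution consists of the ring itself, with its augmentation, and a free module whose
  unit vectors are mapped to the given generators.\<close>

lemma type_FP1_if_ideal_fg:
  assumes T: "finite T" "T \<subseteq> augmentation_ideal G"
    and gen: "\<And>J. left_ideal (monoid_ring G) J \<Longrightarrow> T \<subseteq> J \<Longrightarrow> augmentation_ideal G \<subseteq> J"
  shows "type_FP (monoid_ring G) (trivial_module :: ('a \<Rightarrow> int, int) module) 1"
proof -
  let ?R = "monoid_ring G" and ?Z = "trivial_module :: ('a \<Rightarrow> int, int) module"
  interpret R: ring ?R by (rule ring_monoid_ring)
  obtain ds where ds: "set ds = T" using T(1) finite_list by blast
  define n where "n = length ds"
  define d where "d = (!) ds"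
  have d: "d j \<in> carrier ?R" "augmentation (d j) = 0" if "j < n" for j
    using that T(2) ds nth_mem[of j ds] unfolding n_def d_def augmentation_ideal_def by blast+
  define P where "P i = free_module ?R (if i = 0 then 1 else n)" for i :: nat
  define eps where "eps x = augmentation (x 0)" for x :: "nat \<Rightarrow> 'a \<Rightarrow> int"
  define S where "S y = (\<lambda>x. \<Sum>j<n. (y j \<star> d j) x)" for y :: "nat \<Rightarrow> 'a \<Rightarrow> int"
  define del where "del i y = (\<lambda>k\<in>{..<1::nat}. S y)" for i :: nat and y :: "nat \<Rightarrow> 'a \<Rightarrow> int"
  have P0: "P 0 = free_module ?R 1" and P1: "P (Suc 0) = free_module ?R n" by (simp_all add: P_def)
  let ?Fn = "free_module ?R n"
  have S_closed: "S y \<in> carrier ?R" if "y \<in> carrier ?Fn" for y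
    unfolding S_def by (rule monoid_ring_sum_closed) (use that d monoid_ring_mult_closed in auto)
  have S_add: "S (\<lambda>i\<in>{..<n}. \<lambda>g. x i g + y i g) = (\<lambda>g. S x g + S y g)"
    if "x \<in> carrier ?Fn" "y \<in> carrier ?Fn" for x y
  proof -
    have "x j \<in> carrier ?R" "y j \<in> carrier ?R" if "j < n" for j
      using that \<open>x \<in> _\<close> \<open>y \<in> _\<close> by auto
    then show ?thesis
      unfolding S_def sum.distrib[symmetric] using d(1)
      by (intro ext sum.cong refl) (simp add: monoid_ring_distrib)
  qed
  have S_smult: "S (\<lambda>i\<in>{..<n}. a \<star> y i) = a \<star> S y"
    if "a \<in> carrier ?R" "y \<in> carrier ?Fn" for a y
  proof -
    have yj: "y j \<in> carrier ?R" if "j < n" for j using that \<open>y \<in> _\<close> by auto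
    have "a \<star> S y = (\<lambda>x. \<Sum>j<n. (a \<star> (y j \<star> d j)) x)"
      unfolding S_def by (rule monoid_ring_mult_sum) (use that yj d monoid_ring_mult_closed in auto)
    also have "\<dots> = S (\<lambda>i\<in>{..<n}. a \<star> y i)"
      unfolding S_def using that yj d(1) by (intro ext sum.cong refl) (simp add: monoid_ring_mult_assoc)
    finally show ?thesis by simp
  qed
  have S_aug: "augmentation (S y) = 0" if "y \<in> carrier ?Fn" for y
  proof -
    have yd: "y j \<star> d j \<in> carrier ?R" "augmentation (y j \<star> d j) = 0" if "j < n" for j
    proof -
      have yj: "y j \<in> carrier ?R" using that \<open>y \<in> _\<close> by auto
      show "y j \<star> d j \<in> carrier ?R" using yj d that monoid_ring_mult_closed by blast
      show "augmentation (y j \<star> d j) = 0"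
        by (subst augmentation_mult) (use yj d that in \<open>auto simp: monoid_ring_carrier\<close>)
    qed
    have "k \<le> n \<Longrightarrow> augmentation (\<lambda>x. \<Sum>j<k. (y j \<star> d j) x) = 0" for k
    proof (induction k)
      case 0
      then show ?case by (simp add: augmentation_def)
    next
      case (Suc k)
      have "(\<lambda>x. \<Sum>j<k. (y j \<star> d j) x) \<in> carrier ?R"
        by (rule monoid_ring_sum_closed) (use yd Suc.prems in auto)
      then show ?case
        using Suc yd[of k] augmentation_add[of "\<lambda>x. \<Sum>j<k. (y j \<star> d j) x" "y k \<star> d k"]
        by (simp add: monoid_ring_carrier)
    qed
    then show ?thesis unfolding S_def by blast
  qed
  have S_ideal: "left_ideal ?R (S ` carrier ?Fn)"
    unfolding left_ideal_def
  proof (intro conjI ballI)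
    have "S (\<lambda>i\<in>{..<n}. \<lambda>x. 0) = (\<lambda>x. 0)"
      unfolding S_def using d(1) R.l_null by (intro ext sum.neutral) simp
    then show "\<zero>\<^bsub>?R\<^esub> \<in> S ` carrier ?Fn"
      using monoid_ring_zero_closed by (intro image_eqI[of _ _ "\<lambda>i\<in>{..<n}. \<lambda>x. 0"]) auto
  next
    fix f h assume "f \<in> S ` carrier ?Fn" "h \<in> S ` carrier ?Fn"
    then obtain x y where x: "x \<in> carrier ?Fn" "f = S x"
      and y: "y \<in> carrier ?Fn" "h = S y" by blast
    have "(\<lambda>i\<in>{..<n}. \<lambda>g. x i g + y i g) \<in> carrier ?Fn"
      using x(1) y(1) monoid_ring_add_closed by auto
    then show "f \<oplus>\<^bsub>?R\<^esub> h \<in> S ` carrier ?Fn"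
      unfolding x(2) y(2) monoid_ring_add S_add[OF x(1) y(1), symmetric] by (rule imageI)
  next
    fix a f assume a: "a \<in> carrier ?R" and "f \<in> S ` carrier ?Fn"
    then obtain y where y: "y \<in> carrier ?Fn" "f = S y" by blast
    have "(\<lambda>i\<in>{..<n}. a \<star> y i) \<in> carrier ?Fn"
      using y(1) a monoid_ring_mult_closed by auto
    then show "a \<star> f \<in> S ` carrier ?Fn"
      unfolding y(2) S_smult[OF a y(1), symmetric] by (rule imageI)
  qed
  have S_gens: "T \<subseteq> S ` carrier ?Fn"
  proof
    fix t assume "t \<in> T"
    then obtain k where k: "k < n" "t = d k" using ds unfolding n_def d_def by (metis in_set_conv_nth)
    have "S (unit_vec ?R n k) = t"
    proof
      fix x
      have "S (unit_vec ?R n k) x = (\<Sum>j<n. if j = k then d k x else 0)"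
        unfolding S_def unit_vec_def
        using d(1) R.l_null R.l_one by (intro sum.cong refl) auto
      then show "S (unit_vec ?R n k) x = t x" using k by simp
    qed
    moreover have "unit_vec ?R n k \<in> carrier ?Fn"
      using R.one_closed R.zero_closed by (auto simp: unit_vec_def)
    ultimately show "t \<in> S ` carrier ?Fn" by blast
  qed
  have eps: "eps \<in> module_hom ?R (P 0) ?Z"
    unfolding P0 eps_def
  proof (rule module_homI)
    fix x y assume "x \<in> carrier (free_module ?R 1)" "y \<in> carrier (free_module ?R 1)"
    then have "x 0 \<in> carrier ?R" "y 0 \<in> carrier ?R" by auto
    then show "augmentation ((x \<oplus>\<^bsub>free_module ?R 1\<^esub> y) 0) = augmentation (x 0) \<oplus>\<^bsub>?Z\<^esub> augmentation (y 0)"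
      using augmentation_add[of "x 0" "y 0"] by (simp add: monoid_ring_carrier)
  next
    fix a x assume a: "a \<in> carrier ?R" and "x \<in> carrier (free_module ?R 1)"
    then have "x 0 \<in> carrier ?R" by auto
    then show "augmentation ((a \<odot>\<^bsub>free_module ?R 1\<^esub> x) 0) = a \<odot>\<^bsub>?Z\<^esub> augmentation (x 0)"
      using a augmentation_mult[of a "x 0" G] by (simp add: monoid_ring_carrier)
  qed simp
  have surj: "eps ` carrier (P 0) = carrier ?Z"
  proof -
    have "k \<in> eps ` carrier (P 0)" for k :: int
    proof (rule image_eqI)
      show "k = eps (\<lambda>i\<in>{..<1::nat}. \<lambda>x. k * basis_elt \<one> x)"
        using augmentation_scale[OF basis_elt_carrier[OF one_closed], of k] augmentation_basis[of \<one>]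
        by (simp add: eps_def)
      show "(\<lambda>i\<in>{..<1::nat}. \<lambda>x. k * basis_elt \<one> x) \<in> carrier (P 0)"
        unfolding P0 using monoid_ring_scale_closed[OF basis_elt_carrier[OF one_closed]] by auto
    qed
    then show ?thesis by auto
  qed
  have del: "del 0 \<in> module_hom ?R (P (Suc 0)) (P 0)"
    unfolding P0 P1
  proof (rule module_homI)
    fix x y assume "x \<in> carrier ?Fn" "y \<in> carrier ?Fn"
    then show "del 0 (x \<oplus>\<^bsub>?Fn\<^esub> y) = del 0 x \<oplus>\<^bsub>free_module ?R 1\<^esub> del 0 y"
      using S_add[of x y] by (simp add: del_def fun_eq_iff)
  next
    fix a x assume "a \<in> carrier ?R" "x \<in> carrier ?Fn"
    then show "del 0 (a \<odot>\<^bsub>?Fn\<^esub> x) = a \<odot>\<^bsub>free_module ?R 1\<^esub> del 0 x"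
      using S_smult[of a x] by (simp add: del_def fun_eq_iff)
  next
    fix x assume "x \<in> carrier ?Fn"
    then show "del 0 x \<in> carrier (free_module ?R 1)"
      using S_closed[of x] by (auto simp: del_def)
  qed
  have ker: "del 0 ` carrier (P (Suc 0)) = {x \<in> carrier (P 0). eps x = 0}"
  proof (intro equalityI subsetI)
    fix x assume "x \<in> del 0 ` carrier (P (Suc 0))"
    then obtain y where y: "y \<in> carrier ?Fn" "x = del 0 y" unfolding P1 by blast
    then show "x \<in> {x \<in> carrier (P 0). eps x = 0}"
      using S_closed[OF y(1)] S_aug[OF y(1)] unfolding P0 by (auto simp: eps_def del_def)
  next
    fix x assume "x \<in> {x \<in> carrier (P 0). eps x = 0}"
    then have x: "x \<in> carrier (free_module ?R 1)" "augmentation (x 0) = 0" by (auto simp: P0 eps_def)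
    then have "x 0 \<in> carrier ?R" by auto
    then have "x 0 \<in> S ` carrier ?Fn"
      using gen[OF S_ideal S_gens] x(2) by (auto simp: augmentation_ideal_def)
    then obtain y where y: "y \<in> {..<n} \<rightarrow>\<^sub>E carrier ?R" "x 0 = S y" by auto
    have "x = del 0 y" using x(1) y(2)[symmetric] by (auto simp: del_def fun_eq_iff PiE_def extensional_def)
    then show "x \<in> del 0 ` carrier (P (Suc 0))" using y(1) unfolding P1 by simp
  qed
  show ?thesis
    unfolding type_FP_def
  proof (intro conjI left_module_trivial exI[of _ P] exI[of _ eps] exI[of _ del])
    show "\<forall>i\<le>1. fg_projective ?R (P i)"
      by (simp add: P_def fg_projective_free[OF R.ring_axioms])
    show "\<forall>i<1. del i \<in> module_hom ?R (P (Suc i)) (P i) \<and>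
        del i ` carrier (P (Suc i)) = {x \<in> carrier (P i).
          case i of 0 \<Rightarrow> eps x = \<zero>\<^bsub>?Z\<^esub> | Suc j \<Rightarrow> del j x = \<zero>\<^bsub>P j\<^esub>}"
      using del ker by simp
  qed (use eps surj in simp_all)
qed

definition right_mult_edges :: "'a set \<Rightarrow> ('a \<times> 'a) set" where
  "right_mult_edges S = {(g, g \<otimes> s) | g s. g \<in> carrier G \<and> s \<in> S}"

text \<open>An edge from \<open>g\<close> to \<open>g s\<close> contributes the multiple \<open>g (s - 1)\<close> of \<open>s - 1\<close>, so a path from 1
  to \<open>g\<close> writes \<open>g - 1\<close> as a combination of finitely many generators, and the elements \<open>g - 1\<close> span the
  augmentation ideal.\<close>

lemma type_FP1_if_connected:
  assumes S: "finite S" "S \<subseteq> carrier G"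
    and conn: "\<And>g. g \<in> carrier G \<Longrightarrow> (\<one>, g) \<in> (right_mult_edges S \<union> (right_mult_edges S)\<inverse>)\<^sup>*"
  shows "type_FP (monoid_ring G) (trivial_module :: ('a \<Rightarrow> int, int) module) 1"
proof -
  let ?R = "monoid_ring G"
  interpret R: ring ?R by (rule ring_monoid_ring)
  define d where "d s = (\<lambda>x. basis_elt s x + - basis_elt \<one> x)" for s
  have b: "basis_elt g \<in> carrier ?R" if "g \<in> carrier G" for g using that by (rule basis_elt_carrier)
  have nb: "(\<lambda>x. - basis_elt \<one> x) \<in> carrier ?R" by (rule monoid_ring_uminus_closed[OF b[OF one_closed]])
  have d: "d g \<in> augmentation_ideal G" if "g \<in> carrier G" for g
  proof -
    have "augmentation (d g) = augmentation (basis_elt g) + augmentation (\<lambda>x. - basis_elt \<one> x)"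
      unfolding d_def by (rule augmentation_add) (use b[OF that] nb in \<open>auto simp only: monoid_ring_carrier\<close>)
    then show ?thesis
      using monoid_ring_add_closed[OF b[OF that] nb]
      by (simp add: augmentation_ideal_def d_def augmentation_uminus augmentation_basis)
  qed
  have scalar: "(\<lambda>x. k * basis_elt \<one> x) \<star> f = (\<lambda>x. k * f x)" if f: "f \<in> carrier ?R" for k f
  proof
    fix x
    have fin: "finite (supp f)" using f by (simp add: monoid_ring_carrier)
    have s1: "supp (\<lambda>x. k * basis_elt \<one> x) \<subseteq> {\<one>}" "supp (basis_elt \<one>) \<subseteq> {\<one>}"
      by (auto simp: basis_elt_def)
    have "((\<lambda>x. k * basis_elt \<one> x) \<star> f) x = k * (basis_elt \<one> \<star> f) x"
      unfolding monoid_ring_mult[OF finite.insertI[OF finite.emptyI] fin s1(1) subset_refl]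
        monoid_ring_mult[OF finite.insertI[OF finite.emptyI] fin s1(2) subset_refl] sum_distrib_left
      by (intro sum.cong refl) simp
    then show "((\<lambda>x. k * basis_elt \<one> x) \<star> f) x = k * f x"
      using monoid_ring_unit(1)[OF f] by simp
  qed
  show ?thesis
  proof (rule type_FP1_if_ideal_fg[of "d ` S"])
    fix J assume J: "left_ideal ?R J" and gens: "d ` S \<subseteq> J"
    have zero: "(\<lambda>x. 0) \<in> J"
      and add: "f \<in> J \<Longrightarrow> h \<in> J \<Longrightarrow> (\<lambda>x. f x + h x) \<in> J"
      and mult: "a \<in> carrier ?R \<Longrightarrow> f \<in> J \<Longrightarrow> a \<star> f \<in> J" for a f h
      using J by (auto simp: left_ideal_def)
    have scale: "(\<lambda>x. k * f x) \<in> J" if "f \<in> J" "f \<in> carrier ?R" for k f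
      using mult[OF monoid_ring_scale_closed[OF b[OF one_closed]] that(1)] scalar[OF that(2)] by metis
    have dc: "d g \<in> carrier ?R" if "g \<in> carrier G" for g
      using d[OF that] by (simp add: augmentation_ideal_def)
    have edge: "(\<lambda>x. basis_elt (g \<otimes> s) x + - basis_elt g x) \<in> J"
      "(\<lambda>x. - (basis_elt (g \<otimes> s) x + - basis_elt g x)) \<in> J" if g: "g \<in> carrier G" "s \<in> S" for g s
    proof -
      have s: "s \<in> carrier G" using g S by blast
      have "basis_elt g \<star> (\<lambda>x. (-1) * basis_elt \<one> x) =
          (\<lambda>x. (-1) * (basis_elt g \<star> basis_elt \<one>) x)"
        by (rule monoid_ring_mult_scale[OF b[OF g(1)] b[OF one_closed]])
      then have eq: "basis_elt g \<star> d s = (\<lambda>x. basis_elt (g \<otimes> s) x + - basis_elt g x)"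
        unfolding d_def monoid_ring_distrib(2)[OF b[OF s] nb b[OF g(1)]] using g(1) by (simp add: basis_mult_basis)
      have 1: "basis_elt g \<star> d s \<in> J" using gens g by (intro mult b) auto
      then show "(\<lambda>x. basis_elt (g \<otimes> s) x + - basis_elt g x) \<in> J" unfolding eq .
      from scale[OF 1 monoid_ring_mult_closed[OF b[OF g(1)] dc[OF s]], of "-1"]
      show "(\<lambda>x. - (basis_elt (g \<otimes> s) x + - basis_elt g x)) \<in> J" unfolding eq by simp
    qed
    have J_basis: "d g \<in> J" if "g \<in> carrier G" for g
      using conn[OF that]
    proof (induction rule: rtrancl_induct)
      case base
      then show ?case using zero by (simp add: d_def)
    next
      case (step g h)
      have "(\<lambda>x. basis_elt h x + - basis_elt g x) \<in> J"
        using step(2)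
      proof
        assume "(g, h) \<in> right_mult_edges S"
        then show ?thesis using edge(1) unfolding right_mult_edges_def by blast
      next
        assume "(g, h) \<in> (right_mult_edges S)\<inverse>"
        then obtain s where "h \<in> carrier G" "s \<in> S" "g = h \<otimes> s" unfolding right_mult_edges_def by blast
        then show ?thesis using edge(2)[of h s] by (simp add: algebra_simps)
      qed
      from add[OF this step(3)] show ?case by (simp add: d_def algebra_simps)
    qed
    show "augmentation_ideal G \<subseteq> J"
    proof
      fix f assume "f \<in> augmentation_ideal G"
      then have f: "f \<in> carrier ?R" "augmentation f = 0" by (auto simp: augmentation_ideal_def)
      have fin: "finite (supp f)" and sub: "supp f \<subseteq> carrier G" using f by (auto simp: monoid_ring_carrier)
      have "(\<lambda>x. \<Sum>g\<in>A. f g * d g x) \<in> J" if "finite A" "A \<subseteq> carrier G" for A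
        using that
      proof (induction rule: finite_induct)
        case empty
        then show ?case using zero by simp
      next
        case (insert a A)
        then have "(\<lambda>x. f a * d a x) \<in> J" by (intro scale J_basis dc) auto
        then show ?case using insert add[of "\<lambda>x. f a * d a x"] by simp
      qed
      from this[OF fin sub] have "(\<lambda>x. \<Sum>g\<in>supp f. f g * d g x) \<in> J" .
      moreover have "(\<Sum>g\<in>supp f. f g * d g x) = f x" for x
      proof -
        have "(\<Sum>g\<in>supp f. f g * d g x) =
            (\<Sum>g\<in>supp f. f g * basis_elt g x) - (\<Sum>g\<in>supp f. f g) * basis_elt \<one> x"
          by (simp add: d_def right_diff_distrib sum_subtractf sum_distrib_right)
        also have "\<dots> = (\<Sum>g\<in>supp f. of_int (f g) * (if g = x then 1 else 0))"
          using f(2) by (auto simp: augmentation_def basis_elt_def intro!: sum.cong)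
        also have "\<dots> = f x"
          using apply_eq_linear_ext[OF fin, of x] by (simp add: linear_ext_def)
        finally show ?thesis .
      qed
      ultimately show "f \<in> J" by simp
    qed
  qed (use S d in auto)
qed

end


section \<open>Groups and actions given by a presentation\<close>

lemma words_append [simp]: "a @ b \<in> words X \<longleftrightarrow> a \<in> words X \<and> b \<in> words X"
  by (auto simp: words_def)

lemma words_Nil [simp]: "[] \<in> words X"
  by (simp add: words_def)

lemma words_Cons [simp]: "p # w \<in> words X \<longleftrightarrow> fst p \<in> X \<and> w \<in> words X"
  by (cases p) (auto simp: words_def)

lemma pres_cong_words: "(w, w') \<in> pres_cong X R \<Longrightarrow> w \<in> words X \<and> w' \<in> words X"
  by (induction rule: pres_cong.induct) auto

lemma equiv_pres_cong: "equiv (words X) (pres_cong X R)"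
  by (rule equivI)
    (use pres_cong_words in \<open>auto intro!: refl_onI symI transI intro: pres_cong.intros\<close>)

lemma pres_cong_context:
  assumes "(w, w') \<in> pres_cong X R" "a \<in> words X" "b \<in> words X"
  shows "(a @ w @ b, a @ w' @ b) \<in> pres_cong X R"
  using assms
proof (induction rule: pres_cong.induct)
  case (cong_refl w)
  then show ?case by (intro pres_cong.cong_refl) simp
next
  case (cong_sym w w')
  then show ?case by (blast intro: pres_cong.cong_sym)
next
  case (cong_trans w w' w'')
  then show ?case by (blast intro: pres_cong.cong_trans)
next
  case (cong_cancel c d x s)
  then show ?case
    using pres_cong.cong_cancel[of "a @ c" X "d @ b" x s R] by simp
next
  case (cong_rel c d r r')
  then show ?case
    using pres_cong.cong_rel[of "a @ c" X "d @ b" r r' R] by simp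
qed

lemma pres_cong_append:
  assumes "(v, v') \<in> pres_cong X R" "(w, w') \<in> pres_cong X R"
  shows "(v @ w, v' @ w') \<in> pres_cong X R"
proof -
  have "(v @ w, v' @ w) \<in> pres_cong X R" "(v' @ w, v' @ w') \<in> pres_cong X R"
    using pres_cong_context[OF assms(1), of "[]" w] pres_cong_context[OF assms(2), of v' "[]"]
      pres_cong_words[OF assms(1)] pres_cong_words[OF assms(2)] by simp_all
  then show ?thesis by (rule pres_cong.cong_trans)
qed

definition word_class :: "'x set \<Rightarrow> ('x word \<times> 'x word) set \<Rightarrow> 'x word \<Rightarrow> 'x word set" where
  "word_class X R w = pres_cong X R `` {w}"

lemma word_class_eqI: "(w, w') \<in> pres_cong X R \<Longrightarrow> word_class X R w = word_class X R w'"
  unfolding word_class_def by (rule equiv_class_eq[OF equiv_pres_cong])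

lemma word_class_carrier [simp]: "w \<in> words X \<Longrightarrow> word_class X R w \<in> carrier (pres_group X R)"
  by (simp add: pres_group_def word_class_def quotientI)

lemma pres_group_carrierE:
  assumes "g \<in> carrier (pres_group X R)"
  obtains w where "w \<in> words X" "g = word_class X R w"
  using assms by (auto simp: pres_group_def word_class_def elim: quotientE)

lemma word_class_mult:
  assumes "v \<in> words X" "w \<in> words X"
  shows "word_class X R v \<otimes>\<^bsub>pres_group X R\<^esub> word_class X R w = word_class X R (v @ w)"
proof -
  have "word_class X R (a @ b) = word_class X R (v @ w)"
    if "a \<in> word_class X R v" "b \<in> word_class X R w" for a b
    using that by (intro word_class_eqI pres_cong_append) (auto simp: word_class_def intro: pres_cong.cong_sym)
  moreover have "v \<in> word_class X R v" "w \<in> word_class X R w"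
    using assms by (auto simp: word_class_def intro: pres_cong.cong_refl)
  ultimately have "(\<Union>a\<in>word_class X R v. \<Union>b\<in>word_class X R w. word_class X R (a @ b)) = word_class X R (v @ w)"
    by blast
  then show ?thesis by (simp add: pres_group_def word_class_def)
qed

lemma word_class_one: "\<one>\<^bsub>pres_group X R\<^esub> = word_class X R []"
  by (simp add: pres_group_def word_class_def)

lemma word_class_cancel:
  assumes "x \<in> X"
  shows "word_class X R [(x, s), (x, \<not> s)] = word_class X R []"
  by (rule word_class_eqI) (use pres_cong.cong_cancel[of "[]" X "[]" x s R] assms in simp)

lemma pres_group_left_inverse:
  assumes "w \<in> words X"
  shows "\<exists>v\<in>words X. (v @ w, []) \<in> pres_cong X R"
  using assms
proof (induction w)
  case Nil
  then show ?case by (intro bexI[of _ "[]"]) (auto intro: pres_cong.cong_refl)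
next
  case (Cons p w)
  then obtain v where v: "v \<in> words X" "(v @ w, []) \<in> pres_cong X R" by auto
  obtain x s where p: "p = (x, s)" by (cases p)
  have "((v @ [(x, \<not> s)]) @ p # w, v @ w) \<in> pres_cong X R"
    using pres_cong.cong_cancel[of v X w x "\<not> s" R] v Cons.prems by (simp add: p)
  then have "((v @ [(x, \<not> s)]) @ p # w, []) \<in> pres_cong X R"
    using v(2) by (rule pres_cong.cong_trans)
  moreover have "v @ [(x, \<not> s)] \<in> words X" using v(1) Cons.prems by (simp add: p)
  ultimately show ?case by blast
qed

lemma group_pres_group: "group (pres_group X R)"
proof (rule groupI)
  fix g h assume "g \<in> carrier (pres_group X R)" "h \<in> carrier (pres_group X R)"
  then show "g \<otimes>\<^bsub>pres_group X R\<^esub> h \<in> carrier (pres_group X R)"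
    by (auto elim!: pres_group_carrierE simp: word_class_mult)
next
  show "\<one>\<^bsub>pres_group X R\<^esub> \<in> carrier (pres_group X R)" by (simp add: word_class_one)
next
  fix g h k assume "g \<in> carrier (pres_group X R)" "h \<in> carrier (pres_group X R)" "k \<in> carrier (pres_group X R)"
  then show "g \<otimes>\<^bsub>pres_group X R\<^esub> h \<otimes>\<^bsub>pres_group X R\<^esub> k = g \<otimes>\<^bsub>pres_group X R\<^esub> (h \<otimes>\<^bsub>pres_group X R\<^esub> k)"
    by (auto elim!: pres_group_carrierE simp: word_class_mult)
next
  fix g assume "g \<in> carrier (pres_group X R)"
  then show "\<one>\<^bsub>pres_group X R\<^esub> \<otimes>\<^bsub>pres_group X R\<^esub> g = g"
    by (auto elim!: pres_group_carrierE simp: word_class_mult word_class_one)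
next
  fix g assume "g \<in> carrier (pres_group X R)"
  then obtain w where w: "w \<in> words X" "g = word_class X R w" by (rule pres_group_carrierE)
  obtain v where v: "v \<in> words X" "(v @ w, []) \<in> pres_cong X R"
    using pres_group_left_inverse[OF w(1)] by blast
  have "word_class X R v \<otimes>\<^bsub>pres_group X R\<^esub> g = \<one>\<^bsub>pres_group X R\<^esub>"
    using word_class_mult[OF v(1) w(1)] word_class_eqI[OF v(2)] w(2) by (simp add: word_class_one)
  then show "\<exists>h\<in>carrier (pres_group X R). h \<otimes>\<^bsub>pres_group X R\<^esub> g = \<one>\<^bsub>pres_group X R\<^esub>"
    using v(1) by (intro bexI[of _ "word_class X R v"]) simp_all
qed

definition word_action :: "('x \<times> bool \<Rightarrow> 'm \<Rightarrow> 'm) \<Rightarrow> 'x word \<Rightarrow> 'm \<Rightarrow> 'm" where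
  "word_action T w = foldr (\<lambda>p f. T p \<circ> f) w id"

lemma word_action_simps [simp]:
  "word_action T [] = id"
  "word_action T (p # w) = T p \<circ> word_action T w"
  by (simp_all add: word_action_def)

lemma word_action_append: "word_action T (v @ w) = word_action T v \<circ> word_action T w"
  by (induction v) auto

lemma word_action_cong:
  assumes "(w, w') \<in> pres_cong X R"
    and inv: "\<And>x s. x \<in> X \<Longrightarrow> T (x, s) \<circ> T (x, \<not> s) = id"
    and rel: "\<And>r r'. (r, r') \<in> R \<Longrightarrow> r \<in> words X \<Longrightarrow> r' \<in> words X \<Longrightarrow> word_action T r = word_action T r'"
  shows "word_action T w = word_action T w'"
  using assms(1)
proof (induction rule: pres_cong.induct)
  case (cong_cancel a b x s)
  then show ?case using inv[of x s] by (simp add: word_action_append fun_eq_iff)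
next
  case (cong_rel a b r r')
  then show ?case using rel[of r r'] by (simp add: word_action_append)
qed simp_all

text \<open>The universal property of a presentation, for actions of the generators by bijections of a
  type.\<close>

lemma pres_group_action:
  assumes inv: "\<And>x s. x \<in> X \<Longrightarrow> T (x, s) \<circ> T (x, \<not> s) = id"
    and rel: "\<And>r r'. (r, r') \<in> R \<Longrightarrow> r \<in> words X \<Longrightarrow> r' \<in> words X \<Longrightarrow> word_action T r = word_action T r'"
  obtains \<Phi> where "\<And>w. w \<in> words X \<Longrightarrow> \<Phi> (word_class X R w) = word_action T w"
proof
  fix w assume w: "w \<in> words X"
  have "w \<in> word_class X R w"
    using w by (auto simp: word_class_def intro: pres_cong.cong_refl)
  then have "(w, SOME v. v \<in> word_class X R w) \<in> pres_cong X R"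
    by (metis Image_singleton_iff someI_ex word_class_def)
  from word_action_cong[OF this inv rel]
  show "(\<lambda>A. word_action T (SOME v. v \<in> A)) (word_class X R w) = word_action T w"
    by simp
qed


section \<open>Alternating products and Artin groups\<close>

fun alt_prod :: "('a, 'b) monoid_scheme \<Rightarrow> 'a \<Rightarrow> 'a \<Rightarrow> nat \<Rightarrow> 'a" where
  "alt_prod G p q 0 = \<one>\<^bsub>G\<^esub>"
| "alt_prod G p q (Suc n) = p \<otimes>\<^bsub>G\<^esub> alt_prod G q p n"

context group
begin

lemma alt_prod_closed [simp]:
  "p \<in> carrier G \<Longrightarrow> q \<in> carrier G \<Longrightarrow> alt_prod G p q n \<in> carrier G"
  by (induction n arbitrary: p q) auto

lemma alt_prod_Suc_right:
  "p \<in> carrier G \<Longrightarrow> q \<in> carrier G \<Longrightarrow>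
    alt_prod G p q (Suc n) = alt_prod G p q n \<otimes> (if even n then p else q)"
proof (induction n arbitrary: p q)
  case (Suc n)
  have "alt_prod G p q (Suc (Suc n)) = p \<otimes> (alt_prod G q p n \<otimes> (if even n then q else p))"
    using Suc by simp
  then show ?case using Suc.prems by (simp add: m_assoc)
qed simp

lemma alt_prod_double:
  assumes "p \<in> carrier G" "q \<in> carrier G"
  shows "alt_prod G p q (2 * k) = (p \<otimes> q) [^] k"
proof (induction k)
  case (Suc k)
  have "alt_prod G p q (2 * Suc k) = p \<otimes> (q \<otimes> (p \<otimes> q) [^] k)" using Suc by simp
  also have "\<dots> = (p \<otimes> q) \<otimes> (p \<otimes> q) [^] k" using assms by (simp add: m_assoc)
  also have "\<dots> = (p \<otimes> q) [^] Suc k" using assms by (metis m_closed nat_pow_Suc2)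
  finally show ?case .
qed simp

lemma alt_prod_inv:
  assumes "p \<in> carrier G" "q \<in> carrier G"
  shows "inv (alt_prod G p q n) =
    (if even n then alt_prod G (inv q) (inv p) n else alt_prod G (inv p) (inv q) n)"
proof (induction n)
  case (Suc n)
  show ?case
    unfolding alt_prod_Suc_right[OF assms]
    using Suc assms by (simp add: inv_mult_group)
qed simp

lemma braid_inv:
  assumes "p \<in> carrier G" "q \<in> carrier G" "alt_prod G p q n = alt_prod G q p n"
  shows "alt_prod G (inv p) (inv q) n = alt_prod G (inv q) (inv p) n"
  using arg_cong[OF assms(3), of "m_inv G"] assms(1,2) by (simp add: alt_prod_inv split: if_splits)

end

lemma labelled_graph_edgeD:
  assumes "labelled_graph V E l" "{u, v} \<in> E"
  shows "u \<in> V" "v \<in> V" "u \<noteq> v" "2 \<le> l {u, v}"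
  using assms by (auto simp: labelled_graph_def card_insert_if split: if_splits)

lemma word_class_append_letter:
  assumes "w \<in> words X" "x \<in> X"
  shows "word_class X R (w @ [(x, s)]) = word_class X R w \<otimes>\<^bsub>pres_group X R\<^esub> word_class X R [(x, s)]"
  using assms by (simp add: word_class_mult)

lemma word_class_inverse_letter:
  assumes "x \<in> X"
  shows "word_class X R [(x, False)] = inv\<^bsub>pres_group X R\<^esub> word_class X R [(x, True)]"
proof -
  interpret group "pres_group X R" by (rule group_pres_group)
  have "word_class X R [(x, False)] \<otimes>\<^bsub>pres_group X R\<^esub> word_class X R [(x, True)] = \<one>\<^bsub>pres_group X R\<^esub>"
    using word_class_cancel[OF assms, of R False] assms by (simp add: word_class_mult word_class_one)
  then show ?thesis using assms by (intro inv_equality[symmetric]) simp_all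
qed

lemma artin_gen_word_class: "artin_gen V E l v = word_class V (artin_relations E l) [(v, True)]"
  by (simp add: artin_gen_def word_class_def)

lemma artin_gen_carrier [simp]: "v \<in> V \<Longrightarrow> artin_gen V E l v \<in> carrier (artin_group V E l)"
  by (simp add: artin_gen_word_class artin_group_def)

lemma group_artin_group: "group (artin_group V E l)"
  by (simp add: artin_group_def group_pres_group)

lemma alt_word_words: "u \<in> V \<Longrightarrow> v \<in> V \<Longrightarrow> alt_word u v n \<in> words V"
  by (induction n arbitrary: u v) auto

lemma alt_prod_artin_gen:
  assumes "u \<in> V" "v \<in> V"
  shows "alt_prod (artin_group V E l) (artin_gen V E l u) (artin_gen V E l v) n =
    word_class V (artin_relations E l) (alt_word u v n)"
  using assms
proof (induction n arbitrary: u v)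
  case 0
  show ?case by (simp add: artin_group_def word_class_one)
next
  case (Suc n)
  then show ?case
    by (simp add: artin_gen_word_class artin_group_def word_class_mult alt_word_words)
qed

lemma artin_braid:
  assumes "labelled_graph V E l" "{u, v} \<in> E"
  shows "alt_prod (artin_group V E l) (artin_gen V E l u) (artin_gen V E l v) (l {u, v}) =
    alt_prod (artin_group V E l) (artin_gen V E l v) (artin_gen V E l u) (l {u, v})"
proof -
  note uv = labelled_graph_edgeD[OF assms]
  have "(alt_word u v (l {u, v}), alt_word v u (l {u, v})) \<in> artin_relations E l"
    using assms(2) by (auto simp: artin_relations_def)
  from pres_cong.cong_rel[of "[]" V "[]", OF _ _ this]
  have "(alt_word u v (l {u, v}), alt_word v u (l {u, v})) \<in> pres_cong V (artin_relations E l)"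
    using alt_word_words[OF uv(1,2)] alt_word_words[OF uv(2,1)] by simp
  then show ?thesis using uv by (simp add: alt_prod_artin_gen word_class_eqI)
qed

lemma (in group) hom_alt_prod_odd:
  assumes chi: "\<chi> \<in> hom G real_add_group" and pq: "p \<in> carrier G" "q \<in> carrier G"
  shows "\<chi> (alt_prod G p q (Suc (2 * k))) = real (Suc k) * \<chi> p + real k * \<chi> q"
proof -
  have mult: "\<chi> (x \<otimes> y) = \<chi> x + \<chi> y" if "x \<in> carrier G" "y \<in> carrier G" for x y
    using chi that by (simp add: hom_def real_add_group_def)
  have "\<chi> \<one> = 0" using mult[of \<one> \<one>] by simp
  then have "\<chi> ((q \<otimes> p) [^] k) = real k * (\<chi> p + \<chi> q)"
    using pq by (induction k) (simp_all add: mult algebra_simps)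
  then have "\<chi> (alt_prod G q p (2 * k)) = real k * (\<chi> p + \<chi> q)"
    using pq by (simp add: alt_prod_double)
  then show ?thesis using pq by (simp add: mult algebra_simps)
qed

text \<open>The two sides of a relation of odd length contain different numbers of letters \<open>u\<close> and \<open>v\<close>.\<close>

lemma odd_edge_same_value:
  assumes "labelled_graph V E l" "{u, v} \<in> E" "odd (l {u, v})"
    and chi: "\<chi> \<in> hom (artin_group V E l) real_add_group"
  shows "\<chi> (artin_gen V E l u) = \<chi> (artin_gen V E l v)"
proof -
  interpret group "artin_group V E l" by (rule group_artin_group)
  note uv = labelled_graph_edgeD[OF assms(1,2)]
  obtain k where k: "l {u, v} = Suc (2 * k)" using assms(3) by (auto elim: oddE)
  show ?thesis
    using arg_cong[OF artin_braid[OF assms(1,2)], of \<chi>] uv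
    unfolding k by (simp add: hom_alt_prod_odd[OF chi] del: alt_prod.simps) (simp add: algebra_simps)
qed

lemma character_nonzero_on_generator:
  assumes "\<chi> \<in> nonzero_characters (artin_group V E l)"
  shows "\<exists>v\<in>V. \<chi> (artin_gen V E l v) \<noteq> 0"
proof (rule ccontr)
  let ?R = "artin_relations E l"
  assume "\<not> ?thesis"
  then have zero: "\<chi> (word_class V ?R [(v, True)]) = 0" if "v \<in> V" for v
    using that by (simp add: artin_gen_word_class)
  interpret group "pres_group V ?R" by (rule group_pres_group)
  have chi: "\<chi> \<in> hom (pres_group V ?R) real_add_group"
    and nz: "\<exists>g\<in>carrier (pres_group V ?R). \<chi> g \<noteq> 0"
    using assms by (simp_all add: nonzero_characters_def characters_def artin_group_def)
  have mult: "\<chi> (x \<otimes>\<^bsub>pres_group V ?R\<^esub> y) = \<chi> x + \<chi> y"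
    if "x \<in> carrier (pres_group V ?R)" "y \<in> carrier (pres_group V ?R)" for x y
    using chi that by (simp add: hom_def real_add_group_def)
  have one: "\<chi> \<one>\<^bsub>pres_group V ?R\<^esub> = 0"
    using mult[of "\<one>\<^bsub>pres_group V ?R\<^esub>" "\<one>\<^bsub>pres_group V ?R\<^esub>"] by simp
  have inv: "\<chi> (inv\<^bsub>pres_group V ?R\<^esub> x) = - \<chi> x" if "x \<in> carrier (pres_group V ?R)" for x
    using mult[of x "inv\<^bsub>pres_group V ?R\<^esub> x"] that one by simp
  have letter: "\<chi> (word_class V ?R [(v, s)]) = 0" if "v \<in> V" for v s
    using that zero by (cases s) (simp_all add: word_class_inverse_letter inv)
  have "\<chi> (word_class V ?R w) = 0" if "w \<in> words V" for w
    using that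
  proof (induction w rule: rev_induct)
    case Nil
    then show ?case using one by (simp add: word_class_one)
  next
    case (snoc p w)
    then show ?case using letter by (cases p) (simp add: word_class_append_letter mult)
  qed
  then show False using nz by (metis pres_group_carrierE)
qed


section \<open>Connectivity of Cayley graphs above a level\<close>

text \<open>The Cayley graph with respect to \<open>Y\<close>, on which the character is regarded as a height function.\<close>

locale cayley_height = group G for G (structure) +
  fixes \<chi> :: "'a \<Rightarrow> real" and Y :: "'a set"
  assumes chi_hom: "\<chi> \<in> hom G real_add_group"
    and Y_closed: "Y \<subseteq> carrier G"
    and Y_inv: "y \<in> Y \<Longrightarrow> inv y \<in> Y"
begin

lemma Y_carrier [simp]: "y \<in> Y \<Longrightarrow> y \<in> carrier G"
  using Y_closed by blast

lemma chi_mult [simp]: "x \<in> carrier G \<Longrightarrow> y \<in> carrier G \<Longrightarrow> \<chi> (x \<otimes> y) = \<chi> x + \<chi> y"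
  using chi_hom by (simp add: hom_def real_add_group_def)

lemma chi_one [simp]: "\<chi> \<one> = 0"
  using chi_mult[of \<one> \<one>] by simp

lemma chi_inv [simp]: "x \<in> carrier G \<Longrightarrow> \<chi> (inv x) = - \<chi> x"
  using chi_mult[of x "inv x"] by simp

lemma chi_pow [simp]: "x \<in> carrier G \<Longrightarrow> \<chi> (x [^] (n::nat)) = real n * \<chi> x"
  by (induction n) (simp_all add: algebra_simps)

definition edge :: "real \<Rightarrow> ('a \<times> 'a) set" where
  "edge c = {(g, g \<otimes> y) | g y. g \<in> carrier G \<and> y \<in> Y \<and> c \<le> \<chi> g \<and> c \<le> \<chi> (g \<otimes> y)}"

definition path :: "real \<Rightarrow> 'a \<Rightarrow> 'a \<Rightarrow> bool" where
  "path c g h \<longleftrightarrow> (g, h) \<in> (edge c)\<^sup>*"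

text \<open>The slack \<open>\<epsilon>\<close> becomes uniform for finitely many paths and then bounds from below how far paths
  are lifted in one step.\<close>

definition path_above :: "real \<Rightarrow> 'a \<Rightarrow> 'a \<Rightarrow> bool" where
  "path_above c g h \<longleftrightarrow> (\<exists>\<epsilon>>0. path (c + \<epsilon>) g h)"

lemma path_refl [simp]: "path c g g"
  by (simp add: path_def)

lemma path_trans [trans]: "path c g h \<Longrightarrow> path c h k \<Longrightarrow> path c g k"
  unfolding path_def by (rule rtrancl_trans)

lemma path_edge: "g \<in> carrier G \<Longrightarrow> y \<in> Y \<Longrightarrow> c \<le> \<chi> g \<Longrightarrow> c \<le> \<chi> g + \<chi> y \<Longrightarrow> path c g (g \<otimes> y)"
  unfolding path_def edge_def by (rule r_into_rtrancl) auto

lemma path_mono: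
  assumes "path c g h" "d \<le> c"
  shows "path d g h"
proof -
  have "edge c \<subseteq> edge d" using assms(2) by (force simp: edge_def)
  then show ?thesis using assms(1) rtrancl_mono unfolding path_def by blast
qed

lemma edge_sym:
  assumes "(g, h) \<in> edge c"
  shows "(h, g) \<in> edge c"
proof -
  obtain y where y: "g \<in> carrier G" "y \<in> Y" "c \<le> \<chi> g" "c \<le> \<chi> (g \<otimes> y)" "h = g \<otimes> y"
    using assms unfolding edge_def by blast
  have "g = h \<otimes> inv y" using y by (simp add: m_assoc)
  then show ?thesis using y Y_inv[OF y(2)] unfolding edge_def by (auto intro!: exI[of _ h] exI[of _ "inv y"])
qed

lemma path_sym: "path c g h \<Longrightarrow> path c h g"
  unfolding path_def
  by (induction rule: rtrancl_induct) (auto intro: converse_rtrancl_into_rtrancl edge_sym)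

lemma path_translate:
  assumes "k \<in> carrier G" "path c g h" "d = c + \<chi> k"
  shows "path d (k \<otimes> g) (k \<otimes> h)"
  using assms(2) unfolding path_def
proof (induction rule: rtrancl_induct)
  case (step h i)
  then obtain y where y: "h \<in> carrier G" "y \<in> Y" "c \<le> \<chi> h" "c \<le> \<chi> (h \<otimes> y)" "i = h \<otimes> y"
    unfolding edge_def by blast
  then have "path d (k \<otimes> h) ((k \<otimes> h) \<otimes> y)" using assms by (intro path_edge) auto
  then show ?case using step.IH y assms(1) unfolding path_def by (simp add: m_assoc)
qed simp

lemma path_aboveI: "path d g h \<Longrightarrow> c < d \<Longrightarrow> path_above c g h"
  unfolding path_above_def by (rule exI[of _ "d - c"]) simp

lemma path_above_sym: "path_above c g h \<Longrightarrow> path_above c h g"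
  unfolding path_above_def using path_sym by blast

lemma path_above_trans [trans]:
  assumes "path_above c g h" "path_above c h k"
  shows "path_above c g k"
proof -
  obtain e f where ef: "e > 0" "path (c + e) g h" "f > 0" "path (c + f) h k"
    using assms unfolding path_above_def by blast
  have "path (c + min e f) g k"
    by (rule path_trans[of _ _ h]) (rule path_mono[OF ef(2)] path_mono[OF ef(4)], simp)+
  then show ?thesis using ef unfolding path_above_def by (intro exI[of _ "min e f"]) simp
qed

lemma path_above_mono: "path_above c g h \<Longrightarrow> d \<le> c \<Longrightarrow> path_above d g h"
  unfolding path_above_def using path_mono by (meson add_right_mono)

lemma path_above_translate:
  assumes "k \<in> carrier G" "path_above c g h" "d = c + \<chi> k"
  shows "path_above d (k \<otimes> g) (k \<otimes> h)"
proof -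
  obtain e where e: "e > 0" "path (c + e) g h" using assms(2) unfolding path_above_def by blast
  have "path (d + e) (k \<otimes> g) (k \<otimes> h)" by (rule path_translate[OF assms(1) e(2)]) (simp add: assms(3))
  then show ?thesis using e(1) unfolding path_above_def by blast
qed

text \<open>Right translation by \<open>t\<close> followed by a repair: the edge from \<open>h\<close> to \<open>h y\<close> is replaced by the
  translate by \<open>h\<close> of a path from \<open>t\<close> to \<open>y t\<close>.\<close>

lemma path_lift:
  assumes t: "t \<in> carrier G"
    and lift: "\<And>y. y \<in> Y \<Longrightarrow> path (min 0 (\<chi> y) + e) t (y \<otimes> t)"
    and "path c g h"
  shows "path (c + e) (g \<otimes> t) (h \<otimes> t)"
  using assms(3) unfolding path_def[of c]
proof (induction rule: rtrancl_induct)
  case (step h i)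
  then obtain y where y: "h \<in> carrier G" "y \<in> Y" "c \<le> \<chi> h" "c \<le> \<chi> (h \<otimes> y)" "i = h \<otimes> y"
    unfolding edge_def by blast
  have "path (min 0 (\<chi> y) + e + \<chi> h) (h \<otimes> t) (h \<otimes> (y \<otimes> t))"
    by (rule path_translate[OF y(1) lift[OF y(2)]]) simp
  moreover have "h \<otimes> (y \<otimes> t) = i \<otimes> t" using y t by (simp add: m_assoc)
  moreover have "c + e \<le> min 0 (\<chi> y) + e + \<chi> h" using y by simp
  ultimately have "path (c + e) (h \<otimes> t) (i \<otimes> t)" by (metis path_mono)
  then show ?case using step.IH path_trans by blast
qed simp

text \<open>The criterion of Brown and of Bieri, Neumann and Strebel.  Some path leads from 1 to \<open>g\<close>; each
  lift raises it by \<open>e\<close>, and as \<open>t\<close> has positive height, the endpoints of the lifted path are joined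
  to 1 and \<open>g\<close> by edges that do not go below 0.\<close>

lemma nonneg_connected:
  assumes fin: "finite Y"
    and t: "t \<in> Y" "\<chi> t > 0"
    and lift: "\<And>y. y \<in> Y \<Longrightarrow> path_above (min 0 (\<chi> y)) t (y \<otimes> t)"
    and gen: "\<And>g. g \<in> carrier G \<Longrightarrow> \<exists>c. path c \<one> g"
    and g: "g \<in> carrier G" "\<chi> g \<ge> 0"
  shows "path 0 \<one> g"
proof -
  have ex: "\<exists>e>0. \<forall>y\<in>Z. path (min 0 (\<chi> y) + e) t (y \<otimes> t)" if "finite Z" "Z \<subseteq> Y" for Z
    using that
  proof (induction rule: finite_induct)
    case empty
    show ?case by (intro exI[of _ 1]) simp
  next
    case (insert y Z)
    then obtain e where e: "e > 0" "\<forall>y\<in>Z. path (min 0 (\<chi> y) + e) t (y \<otimes> t)" by auto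
    obtain f where f: "f > 0" "path (min 0 (\<chi> y) + f) t (y \<otimes> t)"
      using lift[of y] insert.prems unfolding path_above_def by auto
    have "\<forall>z\<in>insert y Z. path (min 0 (\<chi> z) + min e f) t (z \<otimes> t)"
    proof
      fix z assume "z \<in> insert y Z"
      then show "path (min 0 (\<chi> z) + min e f) t (z \<otimes> t)"
        using e(2) f(2) by (auto intro: path_mono)
    qed
    then show ?case using e(1) f(1) by (intro exI[of _ "min e f"]) simp
  qed
  obtain e where e: "e > 0" "\<And>y. y \<in> Y \<Longrightarrow> path (min 0 (\<chi> y) + e) t (y \<otimes> t)"
    using ex[OF fin subset_refl] by auto
  have up: "path (min 0 (c + e)) \<one> g" if "path c \<one> g" for c
  proof -
    have "path 0 \<one> (\<one> \<otimes> t)" using t by (intro path_edge) auto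
    moreover have "path (c + e) (\<one> \<otimes> t) (g \<otimes> t)"
      by (rule path_lift[OF _ e(2) that]) (use t in auto)
    moreover have "path 0 (g \<otimes> t) g"
      using t g by (intro path_sym[OF path_edge]) auto
    ultimately show ?thesis
      by (meson min.cobounded1 min.cobounded2 path_mono path_trans)
  qed
  have iter: "path (- real n * e) \<one> g \<Longrightarrow> path 0 \<one> g" for n
  proof (induction n)
    case (Suc n)
    have "- real (Suc n) * e + e = - real n * e" by (simp add: algebra_simps)
    then have "path (min 0 (- real n * e)) \<one> g" using up[OF Suc.prems] by simp
    moreover have "min 0 (- real n * e) = - real n * e" using e(1) by simp
    ultimately show ?case using Suc.IH by simp
  qed simp
  obtain c where c: "path c \<one> g" using gen[OF g(1)] by blast
  obtain n where "- c < real n * e" using ex_less_of_nat_mult[OF e(1)] by blast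
  then have "path (- real n * e) \<one> g" by (intro path_mono[OF c]) simp
  then show ?thesis by (rule iter)
qed

lemma type_FP1_nonneg:
  assumes fin: "finite Y"
    and conn: "\<And>g. g \<in> carrier G \<Longrightarrow> \<chi> g \<ge> 0 \<Longrightarrow> path 0 \<one> g"
  shows "type_FP (monoid_ring (nonneg_submonoid G \<chi>)) (trivial_module :: ('a \<Rightarrow> int, int) module) 1"
proof -
  let ?M = "nonneg_submonoid G \<chi>"
  interpret M: Group.monoid ?M by (rule nonneg_submonoid_monoid[OF chi_hom])
  have Mc: "carrier ?M = {g \<in> carrier G. \<chi> g \<ge> 0}" and Mm: "x \<otimes>\<^bsub>?M\<^esub> y = x \<otimes> y"
    and M1: "\<one>\<^bsub>?M\<^esub> = \<one>" for x y
    by (simp_all add: nonneg_submonoid_def)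
  let ?S = "{y \<in> Y. \<chi> y \<ge> 0}"
  have "edge 0 \<subseteq> M.right_mult_edges ?S \<union> (M.right_mult_edges ?S)\<inverse>"
  proof
    fix p assume "p \<in> edge 0"
    then obtain g y where p: "p = (g, g \<otimes> y)" and y: "g \<in> carrier G" "y \<in> Y" "0 \<le> \<chi> g" "0 \<le> \<chi> (g \<otimes> y)"
      unfolding edge_def by blast
    show "p \<in> M.right_mult_edges ?S \<union> (M.right_mult_edges ?S)\<inverse>"
    proof (cases "\<chi> y \<ge> 0")
      case True
      then have "(g, g \<otimes> y) \<in> M.right_mult_edges ?S"
        using y unfolding M.right_mult_edges_def Mc Mm by blast
      then show ?thesis using p by simp
    next
      case False
      then have "inv y \<in> ?S" "g \<otimes> y \<in> carrier ?M" "g = (g \<otimes> y) \<otimes> inv y"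
        using y Y_inv by (simp_all add: m_assoc Mc)
      then have "(g \<otimes> y, g) \<in> M.right_mult_edges ?S"
        unfolding M.right_mult_edges_def Mm by blast
      then show ?thesis using p by simp
    qed
  qed
  then have "(\<one>, g) \<in> (M.right_mult_edges ?S \<union> (M.right_mult_edges ?S)\<inverse>)\<^sup>*"
    if "g \<in> carrier ?M" for g
    using conn[of g] that rtrancl_mono unfolding Mc path_def by blast
  then show ?thesis
    by (intro M.type_FP1_if_connected[of ?S]) (use fin in \<open>auto simp: Mc M1\<close>)
qed

end

context cayley_height
begin

lemma path_positive:
  assumes "p \<in> Y" "q \<in> Y" "0 \<le> \<chi> p" "0 \<le> \<chi> q" "g \<in> carrier G" "c \<le> \<chi> g"
  shows "path c g (g \<otimes> alt_prod G p q n)"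
  using assms
proof (induction n arbitrary: p q g)
  case (Suc n)
  have "path c g (g \<otimes> p)" using Suc.prems by (intro path_edge) auto
  also have "path c (g \<otimes> p) (g \<otimes> p \<otimes> alt_prod G q p n)" by (rule Suc.IH) (use Suc.prems in auto)
  finally show ?case using Suc.prems by (simp add: m_assoc)
qed simp

text \<open>Both elements lead upwards to the alternating product.\<close>

lemma same_sign_path:
  assumes "p \<in> Y" "q \<in> Y" "\<chi> p > 0" "\<chi> q > 0" and n: "n > 0"
    and braid: "alt_prod G p q n = alt_prod G q p n"
  shows "path_above 0 p q"
proof -
  obtain m where m: "n = Suc m" using n gr0_implies_Suc by blast
  let ?c = "min (\<chi> p) (\<chi> q)"
  have "path ?c p (p \<otimes> alt_prod G q p m)" "path ?c q (q \<otimes> alt_prod G p q m)"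
    using assms by (auto intro!: path_positive)
  then have "path ?c p q"
    using braid unfolding m alt_prod.simps by (metis path_sym path_trans)
  then show ?thesis by (rule path_aboveI) (use assms in auto)
qed

text \<open>If \<open>p q\<close> is not below 0, the powers of \<open>p q\<close> are reached from \<open>p\<close> without losing height, although
  the single letter \<open>q\<close> may lead downwards.\<close>

lemma zigzag_path:
  assumes p: "p \<in> Y" and q: "q \<in> Y" and s: "0 \<le> \<chi> p + \<chi> q" and c: "c \<le> \<chi> p" "c \<le> \<chi> p + \<chi> q"
    and k: "k > 0"
  shows "path c p ((p \<otimes> q) [^] (k::nat))"
proof -
  have "path c p ((p \<otimes> q) [^] Suc k)" for k
  proof (induction k)
    case 0
    then show ?case using p q c by (simp add: path_edge)
  next
    case (Suc k)
    let ?z = "(p \<otimes> q) [^] Suc k"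
    have z: "?z \<in> carrier G" "\<chi> ?z = real (Suc k) * (\<chi> p + \<chi> q)"
      using p q by (simp_all add: algebra_simps)
    have "\<chi> ?z \<ge> \<chi> p + \<chi> q" 
      using s mult_nonneg_nonneg[OF _ s, of "real k"] unfolding z(2) of_nat_Suc distrib_right by simp
    then have h: "c \<le> \<chi> ?z" "0 \<le> \<chi> ?z" using c s by linarith+
    note Suc.IH
    also have "path c ?z (?z \<otimes> p)"
      by (rule path_edge[OF z(1) p h(1)]) (use h c in linarith)
    also have "path c (?z \<otimes> p) (?z \<otimes> p \<otimes> q)"
    proof (rule path_edge)
      have "\<chi> (?z \<otimes> p) = \<chi> ?z + \<chi> p" by (rule chi_mult) (use z p in simp_all)
      then show "c \<le> \<chi> (?z \<otimes> p)" "c \<le> \<chi> (?z \<otimes> p) + \<chi> q" using h c by linarith+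
    qed (use z p q in \<open>simp_all del: nat_pow_Suc\<close>)
    also have "?z \<otimes> p \<otimes> q = (p \<otimes> q) [^] Suc (Suc k)" using p q by (simp add: m_assoc)
    finally show ?case .
  qed
  then show ?thesis using k gr0_implies_Suc by blast
qed

text \<open>The common power is central in the subgroup generated by \<open>p\<close> and \<open>q\<close>.\<close>

lemma pow_commute:
  assumes "p \<in> carrier G" "q \<in> carrier G" and pq: "(p \<otimes> q) [^] (k::nat) = (q \<otimes> p) [^] k"
  shows "q \<otimes> (p \<otimes> q) [^] k = (p \<otimes> q) [^] k \<otimes> q"
proof -
  have "q \<otimes> (p \<otimes> q) [^] j = (q \<otimes> p) [^] j \<otimes> q" for j :: nat
  proof (induction j)
    case (Suc j)
    have "q \<otimes> (p \<otimes> q) [^] Suc j = (q \<otimes> (p \<otimes> q) [^] j) \<otimes> (p \<otimes> q)" using assms by (simp add: m_assoc)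
    also have "\<dots> = (q \<otimes> p) [^] Suc j \<otimes> q" unfolding Suc using assms by (simp add: m_assoc)
    finally show ?case .
  qed (use assms in simp)
  from this[of k] show ?thesis by (metis pq)
qed

text \<open>With the central element $z = (bx)^k$ the path runs from \<open>b\<close> up to \<open>z\<close>, on to $zx = xz$ and
  down to \<open>x b\<close>, the last part being the translate by \<open>x\<close> of the first.\<close>

lemma dead_path:
  assumes b: "b \<in> Y" "\<chi> b > 0" and x: "x \<in> Y" "\<chi> x = 0" and k: "k > 0"
    and comm: "(b \<otimes> x) [^] (k::nat) = (x \<otimes> b) [^] k"
  shows "path_above 0 b (x \<otimes> b)"
proof -
  let ?z = "(b \<otimes> x) [^] k"
  have zc: "?z \<in> carrier G" using b x by simp
  have bz: "path (\<chi> b) b ?z" by (rule zigzag_path) (use b x k in auto)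
  have "path (\<chi> b) (x \<otimes> b) (x \<otimes> ?z)" by (rule path_translate[OF _ bz]) (use x in auto)
  moreover have "x \<otimes> ?z = ?z \<otimes> x" using pow_commute[of b x k] b x comm by simp
  moreover have "path (\<chi> b) ?z (?z \<otimes> x)"
    by (rule path_edge) (use zc b x k in \<open>simp_all add: mult_le_cancel_right1\<close>)
  ultimately have "path (\<chi> b) b (x \<otimes> b)" using bz path_sym path_trans by metis
  then show ?thesis by (rule path_aboveI) (rule b)
qed

text \<open>With the central element $z = (pq)^k$ of positive height the path runs from \<open>p\<close> up to \<open>z\<close>,
  on to $z q^{-1} = q^{-1} z$ and down to $q^{-1}$, the last part being the translate by $q^{-1}$ of a
  path from 1 to \<open>z\<close>.\<close>

lemma opposite_sign_path:
  assumes p: "p \<in> Y" "\<chi> p > 0" and q: "q \<in> Y" "\<chi> q < 0" and s: "\<chi> p + \<chi> q > 0" and k: "k > 0"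
    and comm: "(p \<otimes> q) [^] (k::nat) = (q \<otimes> p) [^] k"
  shows "path_above 0 p (inv q)"
proof -
  let ?z = "(p \<otimes> q) [^] k" and ?s = "\<chi> p + \<chi> q"
  let ?c = "min ?s (- \<chi> q)"
  have zc: "?z \<in> carrier G" and qi: "inv q \<in> Y" using p q Y_inv by simp_all
  have "\<chi> ?z = real k * ?s" using p q by simp
  also have "\<dots> \<ge> ?s" using k s by (simp add: mult_le_cancel_right1)
  finally have zs: "?s \<le> \<chi> ?z" .
  have "path ?c p ?z" by (rule zigzag_path) (use p q s k in auto)
  moreover have "path ?c ?z (?z \<otimes> inv q)"
    by (rule path_edge[OF zc qi]) (use zs q s in auto)
  moreover have "?z \<otimes> inv q = inv q \<otimes> ?z"
    using pow_commute[of p q k] p q comm zc by (metis Y_carrier inv_solve_left inv_solve_right m_assoc inv_closed m_closed)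
  moreover have "path ?c (inv q) (inv q \<otimes> ?z)"
  proof -
    have "path 0 \<one> (\<one> \<otimes> p)" using p by (intro path_edge) auto
    also have "path 0 (\<one> \<otimes> p) ?z" using zigzag_path[of p q 0 k] p q s k by simp
    finally have "path 0 \<one> ?z" .
    from path_translate[OF _ this, of "inv q" "- \<chi> q"] have "path (- \<chi> q) (inv q) (inv q \<otimes> ?z)"
      using q by simp
    then show ?thesis by (rule path_mono) simp
  qed
  ultimately have "path ?c p (inv q)" using path_sym path_trans by metis
  then show ?thesis by (rule path_aboveI) (use s q in auto)
qed

text \<open>For commuting generators of opposite sign the heights may cancel, and then the product \<open>p q\<close> cannot
  be used to gain height; the square with corner $p q^{-1}$ replaces it.\<close>

lemma commuting_path:
  assumes p: "p \<in> Y" "\<chi> p > 0" and q: "q \<in> Y" "\<chi> q < 0" and comm: "p \<otimes> q = q \<otimes> p"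
  shows "path_above 0 p (inv q)"
proof -
  let ?c = "min (\<chi> p) (- \<chi> q)"
  have qi: "inv q \<in> Y" using q Y_inv by simp
  have "path ?c p (p \<otimes> inv q)" by (rule path_edge) (use p q qi in auto)
  moreover have "path ?c (inv q) (inv q \<otimes> p)" by (rule path_edge) (use p q qi in auto)
  moreover have "p \<otimes> inv q = inv q \<otimes> p"
    using p q comm by (metis Y_carrier inv_solve_left inv_solve_right m_assoc inv_closed m_closed)
  ultimately have "path ?c p (inv q)" using path_sym path_trans by metis
  then show ?thesis by (rule path_aboveI) (use p q in auto)
qed

text \<open>If \<open>x\<close> has negative height, the edge from $x^{-1}$ to $x x^{-1} = 1$ does not go below 0, which is above
  the height of \<open>x\<close>.\<close>

lemma living_generator_path:
  assumes "x \<in> Y" "\<chi> x \<noteq> 0"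
  shows "path_above (min 0 (\<chi> x)) (if \<chi> x > 0 then x else inv x) (x \<otimes> (if \<chi> x > 0 then x else inv x))"
proof (cases "\<chi> x > 0")
  case True
  have "path (\<chi> x) x (x \<otimes> x)" by (rule path_edge) (use assms True in auto)
  then show ?thesis using True by (auto intro: path_aboveI)
next
  case False
  have "path 0 (inv x) (inv x \<otimes> x)" by (rule path_edge) (use assms False Y_inv in auto)
  then show ?thesis using False assms by (auto intro: path_aboveI)
qed

lemma path_above_inverse:
  assumes x: "x \<in> carrier G" and t: "t \<in> carrier G" and p: "path_above (min 0 (\<chi> x)) t (x \<otimes> t)"
  shows "path_above (min 0 (\<chi> (inv x))) t (inv x \<otimes> t)"
proof -
  have "path_above (min 0 (\<chi> (inv x))) (inv x \<otimes> t) (inv x \<otimes> (x \<otimes> t))"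
    by (rule path_above_translate[OF _ p]) (use x in auto)
  moreover have "inv x \<otimes> (x \<otimes> t) = t" using x t by (simp add: m_assoc[symmetric])
  ultimately show ?thesis using path_above_sym by simp
qed

end


section \<open>Connected and dominant living subgraphs\<close>

text \<open>For a living vertex \<open>v\<close> let \<open>pos v\<close> be \<open>v\<close> or its inverse, whichever has positive height.  Edges
  of the living subgraph join these elements above height 0, so they are all equivalent to
  \<open>pos v0\<close> for one living vertex \<open>v0\<close>.  For each generator \<open>x\<close> some \<open>pos u\<close> can be moved to
  \<open>x pos u\<close>: one takes \<open>u = x\<close> if \<open>x\<close> is living and a living neighbour otherwise.\<close>

lemma type_FP1_if_living_connected_dominant:
  fixes V :: "'v set"
  assumes graph: "labelled_graph V E l"
    and chi: "\<chi> \<in> nonzero_characters (artin_group V E l)"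
  defines "c \<equiv> \<lambda>v. \<chi> (artin_gen V E l v)"
  assumes conn: "graph_connected (living_verts V c) (living_edges V E l c)"
    and dom: "living_dominant V E c"
  shows "type_FP (monoid_ring (nonneg_submonoid (artin_group V E l) \<chi>))
    (trivial_module :: ('v word set \<Rightarrow> int, int) module) 1"
proof -
  let ?G = "artin_group V E l" and ?R = "artin_relations E l"
  define x where "x = artin_gen V E l"
  have chi_hom: "\<chi> \<in> hom ?G real_add_group"
    using chi by (simp add: nonzero_characters_def characters_def)
  interpret group ?G by (rule group_artin_group)
  have xc [simp]: "v \<in> V \<Longrightarrow> x v \<in> carrier ?G" for v by (simp add: x_def)
  define Y where "Y = x ` V \<union> (\<lambda>v. inv\<^bsub>?G\<^esub> x v) ` V"
  interpret cayley_height ?G \<chi> Y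
    by unfold_locales (use chi_hom in \<open>auto simp: Y_def\<close>)
  have xY [simp]: "v \<in> V \<Longrightarrow> x v \<in> Y" "v \<in> V \<Longrightarrow> inv\<^bsub>?G\<^esub> x v \<in> Y" for v
    by (auto simp: Y_def)
  have chix [simp]: "\<chi> (x v) = c v" for v by (simp add: x_def c_def)
  have braid: "alt_prod ?G (x u) (x v) (l {u, v}) = alt_prod ?G (x v) (x u) (l {u, v})"
    if "{u, v} \<in> E" for u v
    using artin_braid[OF graph that] by (simp add: x_def)
  have even_braid: "(x u \<otimes>\<^bsub>?G\<^esub> x v) [^]\<^bsub>?G\<^esub> k = (x v \<otimes>\<^bsub>?G\<^esub> x u) [^]\<^bsub>?G\<^esub> k"
    "(inv\<^bsub>?G\<^esub> x u \<otimes>\<^bsub>?G\<^esub> inv\<^bsub>?G\<^esub> x v) [^]\<^bsub>?G\<^esub> k = (inv\<^bsub>?G\<^esub> x v \<otimes>\<^bsub>?G\<^esub> inv\<^bsub>?G\<^esub> x u) [^]\<^bsub>?G\<^esub> k"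
    if "{u, v} \<in> E" "l {u, v} = 2 * k" for u v and k :: nat
  proof -
    have uv: "u \<in> V" "v \<in> V" using labelled_graph_edgeD[OF graph that(1)] by auto
    show "(x u \<otimes>\<^bsub>?G\<^esub> x v) [^]\<^bsub>?G\<^esub> k = (x v \<otimes>\<^bsub>?G\<^esub> x u) [^]\<^bsub>?G\<^esub> k"
      using braid[OF that(1)] uv unfolding that(2) by (simp add: alt_prod_double)
    show "(inv\<^bsub>?G\<^esub> x u \<otimes>\<^bsub>?G\<^esub> inv\<^bsub>?G\<^esub> x v) [^]\<^bsub>?G\<^esub> k = (inv\<^bsub>?G\<^esub> x v \<otimes>\<^bsub>?G\<^esub> inv\<^bsub>?G\<^esub> x u) [^]\<^bsub>?G\<^esub> k"
      using braid_inv[OF _ _ braid[OF that(1)]] uv unfolding that(2) by (simp add: alt_prod_double)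
  qed
  define pos where "pos v = (if c v > 0 then x v else inv\<^bsub>?G\<^esub> x v)" for v
  have posY [simp]: "v \<in> V \<Longrightarrow> pos v \<in> Y" for v by (simp add: pos_def)
  have opposite: "path_above 0 (pos u) (pos v)"
    if e: "{u, v} \<in> living_edges V E l c" and u: "c u > 0" and v: "c v < 0" for u v
  proof -
    have eE: "{u, v} \<in> E" and nd: "\<not> dead_edge l c {u, v}" using e by (auto simp: living_edges_def)
    note uv = labelled_graph_edgeD[OF graph eE]
    have pu: "pos u = x u" "pos v = inv\<^bsub>?G\<^esub> x v" using u v by (simp_all add: pos_def)
    have "even (l {u, v})"
      using odd_edge_same_value[OF graph eE _ chi_hom] u v unfolding c_def by force
    then obtain k where k: "l {u, v} = 2 * k" by (elim evenE)
    have k0: "k > 0" using k uv by simp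
    consider "c u + c v > 0" | "c u + c v < 0" | "c u + c v = 0" by linarith
    then show ?thesis
    proof cases
      case 1
      show ?thesis
        unfolding pu by (rule opposite_sign_path[OF _ _ _ _ _ k0 even_braid(1)[OF eE k]]) (use uv u v 1 in auto)
    next
      case 2
      have "path_above 0 (inv\<^bsub>?G\<^esub> x v) (inv\<^bsub>?G\<^esub> (inv\<^bsub>?G\<^esub> x u))"
        by (rule opposite_sign_path[OF _ _ _ _ _ k0 even_braid(2)[OF eE k, symmetric]]) (use uv u v 2 in auto)
      then show ?thesis unfolding pu using uv path_above_sym by simp
    next
      case 3
      have "\<not> l {u, v} \<ge> 4" using nd 3 uv k unfolding dead_edge_def by auto
      then have "k = 1" using k k0 by simp
      then have "x u \<otimes>\<^bsub>?G\<^esub> x v = x v \<otimes>\<^bsub>?G\<^esub> x u" using even_braid(1)[OF eE k] uv by simp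
      then show ?thesis unfolding pu by (intro commuting_path) (use uv u v in auto)
    qed
  qed
  have living_edge_path: "path_above 0 (pos u) (pos v)" if e: "{u, v} \<in> living_edges V E l c" for u v
  proof -
    have eE: "{u, v} \<in> E" and nz: "c u \<noteq> 0" "c v \<noteq> 0"
      using e by (auto simp: living_edges_def living_verts_def)
    note uv = labelled_graph_edgeD[OF graph eE]
    have l0: "l {u, v} > 0" using uv by simp
    consider "c u > 0 \<and> c v > 0" | "c u < 0 \<and> c v < 0" | "c u > 0 \<and> c v < 0" | "c u < 0 \<and> c v > 0"
      using nz by linarith
    then show ?thesis
    proof cases
      case 1
      then show ?thesis
        using same_sign_path[OF _ _ _ _ l0 braid[OF eE]] uv by (simp add: pos_def)
    next
      case 2
      then show ?thesis
        using same_sign_path[OF _ _ _ _ l0 braid_inv[OF _ _ braid[OF eE]]] uv by (simp add: pos_def)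
    next
      case 3
      then show ?thesis using opposite[OF e] by simp
    next
      case 4
      then show ?thesis using opposite[of v u] e path_above_sym by (simp add: insert_commute)
    qed
  qed
  obtain v0 where v0: "v0 \<in> V" "c v0 \<noteq> 0" using character_nonzero_on_generator[OF chi] by (auto simp: c_def)
  have to_living: "path_above 0 (pos v0) (pos v)" if v: "v \<in> living_verts V c" for v
  proof -
    have "(v0, v) \<in> {(a, b). {a, b} \<in> living_edges V E l c}\<^sup>*"
      using conn v v0 unfolding graph_connected_def living_verts_def by blast
    then show ?thesis
    proof (induction rule: rtrancl_induct)
      case base
      show ?case by (rule path_aboveI[of 1]) simp_all
    next
      case (step u w)
      then show ?case using living_edge_path path_above_trans by blast
    qed
  qed
  have base_path: "path_above (min 0 (c v)) (pos v0) (x v \<otimes>\<^bsub>?G\<^esub> pos v0)" if v: "v \<in> V" for v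
  proof -
    have "\<exists>u\<in>living_verts V c. path_above (min 0 (c v)) (pos u) (x v \<otimes>\<^bsub>?G\<^esub> pos u)"
    proof (cases "c v = 0")
      case False
      then have "path_above (min 0 (c v)) (pos v) (x v \<otimes>\<^bsub>?G\<^esub> pos v)"
        using living_generator_path[of "x v"] v by (simp add: pos_def)
      then show ?thesis using False v by (auto simp: living_verts_def)
    next
      case True
      then obtain u where u: "u \<in> living_verts V c" "{u, v} \<in> E"
        using dom v unfolding living_dominant_def living_verts_def by blast
      have cu: "c u \<noteq> 0" using u by (simp add: living_verts_def)
      note uv = labelled_graph_edgeD[OF graph u(2)]
      have "even (l {u, v})"
        using odd_edge_same_value[OF graph u(2) _ chi_hom] cu True unfolding c_def by force
      then obtain k where k: "l {u, v} = 2 * k" by (elim evenE)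
      have k0: "k > 0" using k uv by simp
      have "path_above 0 (pos u) (x v \<otimes>\<^bsub>?G\<^esub> pos u)"
      proof (cases "c u > 0")
        case pu: True
        have "path_above 0 (x u) (x v \<otimes>\<^bsub>?G\<^esub> x u)"
          by (rule dead_path[OF _ _ _ _ k0 even_braid(1)[OF u(2) k]]) (use uv pu True in auto)
        then show ?thesis using pu by (simp add: pos_def)
      next
        case False
        \<comment> \<open>The central power is available for the two inverses, not for one inverse and one generator.\<close>
        have "path_above 0 (inv\<^bsub>?G\<^esub> x u) (inv\<^bsub>?G\<^esub> x v \<otimes>\<^bsub>?G\<^esub> inv\<^bsub>?G\<^esub> x u)"
          by (rule dead_path[OF _ _ _ _ k0 even_braid(2)[OF u(2) k]]) (use uv False cu True in auto)
        then show ?thesis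
          using path_above_inverse[of "inv\<^bsub>?G\<^esub> x v" "inv\<^bsub>?G\<^esub> x u"] uv True False by (simp add: pos_def)
      qed
      then show ?thesis using u(1) True by auto
    qed
    then obtain u where u: "u \<in> living_verts V c"
      and p: "path_above (min 0 (c v)) (pos u) (x v \<otimes>\<^bsub>?G\<^esub> pos u)" by blast
    have uV: "u \<in> V" using u by (simp add: living_verts_def)
    have 1: "path_above (min 0 (c v)) (pos v0) (pos u)"
      by (rule path_above_mono[OF to_living[OF u]]) simp
    have "path_above (c v) (x v \<otimes>\<^bsub>?G\<^esub> pos u) (x v \<otimes>\<^bsub>?G\<^esub> pos v0)"
      by (rule path_above_translate[OF _ path_above_sym[OF to_living[OF u]]]) (use v in auto)
    then have 2: "path_above (min 0 (c v)) (x v \<otimes>\<^bsub>?G\<^esub> pos u) (x v \<otimes>\<^bsub>?G\<^esub> pos v0)"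
      by (rule path_above_mono) simp
    show ?thesis using 1 p 2 path_above_trans by blast
  qed
  have lift: "path_above (min 0 (\<chi> y)) (pos v0) (y \<otimes>\<^bsub>?G\<^esub> pos v0)" if "y \<in> Y" for y
  proof -
    have "pos v0 \<in> carrier ?G" using v0 by simp
    then show ?thesis
      using that base_path path_above_inverse[of "x _" "pos v0"] unfolding Y_def by auto
  qed
  have gen: "\<exists>d. path d \<one>\<^bsub>?G\<^esub> g" if g: "g \<in> carrier ?G" for g
  proof -
    obtain w where w: "w \<in> words V" "g = word_class V ?R w"
      using g unfolding artin_group_def by (rule pres_group_carrierE)
    have "\<exists>d. path d \<one>\<^bsub>?G\<^esub> (word_class V ?R w)"
      using w(1)
    proof (induction w rule: rev_induct)
      case Nil
      show ?case using path_refl by (auto simp: artin_group_def word_class_one)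
    next
      case (snoc p w)
      obtain v s where p: "p = (v, s)" by (cases p)
      have vw: "v \<in> V" "w \<in> words V" using snoc.prems p by auto
      obtain d where d: "path d \<one>\<^bsub>?G\<^esub> (word_class V ?R w)" using snoc.IH vw by blast
      define y where "y = word_class V ?R [(v, s)]"
      have y: "y \<in> Y"
        using vw by (cases s) (auto simp: y_def Y_def x_def artin_gen_word_class artin_group_def word_class_inverse_letter)
      have wc: "word_class V ?R w \<in> carrier ?G" using vw by (simp add: artin_group_def)
      have eq: "word_class V ?R (w @ [p]) = word_class V ?R w \<otimes>\<^bsub>?G\<^esub> y"
        using vw p by (simp add: y_def artin_group_def word_class_append_letter)
      let ?d = "min d (min (\<chi> (word_class V ?R w)) (\<chi> (word_class V ?R w) + \<chi> y))"
      have "path ?d \<one>\<^bsub>?G\<^esub> (word_class V ?R w)" by (rule path_mono[OF d]) simp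
      also have "path ?d (word_class V ?R w) (word_class V ?R w \<otimes>\<^bsub>?G\<^esub> y)"
        by (rule path_edge[OF wc y]) auto
      finally show ?case unfolding eq by blast
    qed
    then show ?thesis using w(2) by simp
  qed
  have fin: "finite Y" using graph by (simp add: Y_def labelled_graph_def)
  show ?thesis
  proof (rule type_FP1_nonneg[OF fin])
    fix g assume "g \<in> carrier ?G" "\<chi> g \<ge> 0"
    then show "path 0 \<one>\<^bsub>?G\<^esub> g"
      by (intro nonneg_connected[OF fin _ _ lift gen]) (use v0 in \<open>auto simp: pos_def\<close>)
  qed
qed


section \<open>Derivations as an obstruction to $FP_1$\<close>

text \<open>The pair \<open>(i, r)\<close> indexes the coefficient of $t^r$ in the \<open>i\<close>-th component of a vector of formal
  series in \<open>t\<close> with real exponents; the predicate bounds the \<open>t\<close>-adic valuation from below.\<close>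

definition vanishes_below :: "real \<Rightarrow> ('i \<times> real \<Rightarrow> complex) \<Rightarrow> bool" where
  "vanishes_below c m \<longleftrightarrow> (\<forall>i r. r < c \<longrightarrow> m (i, r) = 0)"

text \<open>The affine maps by which an element of height \<open>a\<close> may act.  The amounts \<open>a\<close> add up under composition,
  so that the property need only be checked for the generators of a group.\<close>

definition shift_affine ::
  "real \<Rightarrow> (('i \<times> real \<Rightarrow> complex) \<Rightarrow> ('i \<times> real \<Rightarrow> complex)) \<Rightarrow> bool" where
  "shift_affine a f \<longleftrightarrow>
     (\<forall>x y. f (x + y) - f 0 = (f x - f 0) + (f y - f 0)) \<and>
     (\<forall>c m. vanishes_below c m \<longrightarrow> vanishes_below (c + a) (f m - f 0)) \<and>
     (\<exists>c. vanishes_below c (f 0))"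

lemma vanishes_below_mono: "vanishes_below c m \<Longrightarrow> c' \<le> c \<Longrightarrow> vanishes_below c' m"
  by (auto simp: vanishes_below_def)

lemma vanishes_below_zero [simp]: "vanishes_below c 0"
  by (simp add: vanishes_below_def)

lemma vanishes_below_add: "vanishes_below c m \<Longrightarrow> vanishes_below c n \<Longrightarrow> vanishes_below c (m + n)"
  by (simp add: vanishes_below_def)

lemma vanishes_below_mult: "vanishes_below c m \<Longrightarrow> vanishes_below c (a * m)"
  by (simp add: vanishes_below_def)

lemma vanishes_below_sum:
  "(\<And>x. x \<in> A \<Longrightarrow> vanishes_below c (f x)) \<Longrightarrow> vanishes_below c (sum f A)"
  by (induction A rule: infinite_finite_induct) (simp_all add: vanishes_below_add)

lemma shift_affine_linear:
  assumes "shift_affine a f"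
  shows "f (x + y) - f 0 = (f x - f 0) + (f y - f 0)"
    and "vanishes_below c m \<Longrightarrow> vanishes_below (c + a) (f m - f 0)"
  using assms unfolding shift_affine_def by blast+

lemma shift_affine_id: "shift_affine 0 id"
  by (auto simp: shift_affine_def)

lemma shift_affine_comp:
  assumes f: "shift_affine a f" and g: "shift_affine b g"
  shows "shift_affine (a + b) (f \<circ> g)"
proof -
  have lin: "f (g x) - f (g 0) = f (g x - g 0) - f 0" for x
    using shift_affine_linear(1)[OF f, of "g x - g 0" "g 0"] by (simp add: algebra_simps)
  have "(f \<circ> g) (x + y) - (f \<circ> g) 0 = ((f \<circ> g) x - (f \<circ> g) 0) + ((f \<circ> g) y - (f \<circ> g) 0)" for x y
  proof -
    have "f (g (x + y) - g 0) - f 0 = (f (g x - g 0) - f 0) + (f (g y - g 0) - f 0)"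
      unfolding shift_affine_linear(1)[OF g, of x y] by (rule shift_affine_linear(1)[OF f])
    then show ?thesis by (simp only: comp_apply lin)
  qed
  moreover have "vanishes_below (c + (a + b)) ((f \<circ> g) m - (f \<circ> g) 0)" if "vanishes_below c m" for c m
    using shift_affine_linear(2)[OF f shift_affine_linear(2)[OF g that]]
    by (simp add: lin ac_simps)
  moreover have "\<exists>c. vanishes_below c ((f \<circ> g) 0)"
  proof -
    obtain c where c: "vanishes_below c (f 0)" using f unfolding shift_affine_def by blast
    obtain d where d: "vanishes_below d (g 0)" using g unfolding shift_affine_def by blast
    have "vanishes_below (min c (d + a)) (f 0 + (f (g 0) - f 0))"
      by (intro vanishes_below_add vanishes_below_mono[OF c] vanishes_below_mono[OF shift_affine_linear(2)[OF f d]])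
        auto
    then show ?thesis by auto
  qed
  ultimately show ?thesis unfolding shift_affine_def by blast
qed

lemma additive_of_int:
  fixes L :: "'m::ring_1 \<Rightarrow> 'm"
  assumes add: "\<And>x y. L (x + y) = L x + L y"
  shows "L (of_int k * x) = of_int k * L x"
proof -
  have zero: "L 0 = 0" using add[of 0 0] by simp
  have minus: "L (- x) = - L x" for x using add[of x "- x"] zero by (simp add: eq_neg_iff_add_eq_0 add.commute)
  have nat: "L (of_nat n * x) = of_nat n * L x" for n x
    by (induction n) (simp_all add: zero add distrib_right)
  show ?thesis
  proof (cases "k \<ge> 0")
    case True
    then have "of_int k = (of_nat (nat k) :: 'm)" by simp
    then show ?thesis using nat by metis
  next
    case False
    then have "of_int k = - (of_nat (nat (- k)) :: 'm)" by simp
    then show ?thesis using nat minus by (metis mult_minus_left)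
  qed
qed

lemma additive_sum:
  fixes L :: "'m::ring_1 \<Rightarrow> 'm"
  assumes add: "\<And>x y. L (x + y) = L x + L y"
  shows "L (sum f A) = (\<Sum>x\<in>A. L (f x))"
proof -
  have "L 0 = 0" using add[of 0 0] by simp
  then show ?thesis by (induction A rule: infinite_finite_induct) (simp_all add: add)
qed

text \<open>The translation parts \<open>D g = \<Phi> g 0\<close> satisfy \<open>D (g h) = D g + L g (D h)\<close>, where \<open>L g\<close> is the linear
  part of \<open>\<Phi> g\<close>.  On the augmentation ideal the additive extension of \<open>D\<close> is therefore linear over the
  monoid ring.  Elements of the submonoid do not lower valuations, so a bound that holds at
  finitely many generators of the augmentation ideal holds on all of it, in particular at \<open>g - 1\<close>.\<close>

lemma (in group) derivation_bounded_below:
  fixes \<Phi> :: "'a \<Rightarrow> ('i \<times> real \<Rightarrow> complex) \<Rightarrow> ('i \<times> real \<Rightarrow> complex)"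
  assumes chi: "\<chi> \<in> hom G real_add_group"
    and FP: "type_FP (monoid_ring (nonneg_submonoid G \<chi>)) trivial_module 1"
    and Phi_mult: "\<And>g h. g \<in> carrier G \<Longrightarrow> h \<in> carrier G \<Longrightarrow> \<Phi> (g \<otimes> h) = \<Phi> g \<circ> \<Phi> h"
    and Phi_one: "\<Phi> \<one> = id"
    and Phi: "\<And>g. g \<in> carrier G \<Longrightarrow> shift_affine (\<chi> g) (\<Phi> g)"
  obtains c where "\<And>g. g \<in> carrier G \<Longrightarrow> \<chi> g \<ge> 0 \<Longrightarrow> vanishes_below c (\<Phi> g 0)"
proof -
  let ?M = "nonneg_submonoid G \<chi>"
  let ?R = "monoid_ring ?M"
  interpret M: Group.monoid ?M by (rule nonneg_submonoid_monoid[OF chi])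
  have Mc: "carrier ?M = {g \<in> carrier G. \<chi> g \<ge> 0}" and Mm: "x \<otimes>\<^bsub>?M\<^esub> y = x \<otimes> y"
    and M1: "\<one>\<^bsub>?M\<^esub> = \<one>" for x y
    by (simp_all add: nonneg_submonoid_def)
  define D where "D g = \<Phi> g 0" for g
  define L where "L g m = \<Phi> g m - \<Phi> g 0" for g m
  have L_add: "L g (x + y) = L g x + L g y" if "g \<in> carrier G" for g x y
    using shift_affine_linear(1)[OF Phi[OF that]] by (simp add: L_def)
  have L_van: "vanishes_below c (L g m)" if "g \<in> carrier ?M" "vanishes_below c m" for g c m
    using shift_affine_linear(2)[OF Phi, of g c m] that
    by (auto simp: L_def Mc intro: vanishes_below_mono)
  have D_mult: "D (g \<otimes> h) = D g + L g (D h)" if "g \<in> carrier G" "h \<in> carrier G" for g h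
    using Phi_mult[OF that] by (simp add: D_def L_def)
  have D_bound: "\<exists>c. vanishes_below c (D g)" if "g \<in> carrier G" for g
    using Phi[OF that] by (simp add: D_def shift_affine_def)
  obtain T where T: "finite T" "T \<subseteq> augmentation_ideal ?M"
    and gen: "\<And>J. left_ideal ?R J \<Longrightarrow> T \<subseteq> J \<Longrightarrow> augmentation_ideal ?M \<subseteq> J"
    using M.augmentation_ideal_fg[OF FP] by auto
  have ext_bound: "\<exists>c. vanishes_below c (linear_ext D f)" if "f \<in> carrier ?R" for f
  proof -
    have fin: "finite (supp f)" and sub: "supp f \<subseteq> carrier G"
      using that by (auto simp: monoid_ring_carrier Mc)
    have "\<exists>c. vanishes_below c (\<Sum>x\<in>A. of_int (f x) * D x)" if "finite A" "A \<subseteq> carrier G" for A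
      using that
    proof (induction rule: finite_induct)
      case (insert x A)
      then obtain c where c: "vanishes_below c (\<Sum>x\<in>A. of_int (f x) * D x)" by blast
      obtain d where d: "vanishes_below d (D x)" using D_bound insert by auto
      have "vanishes_below (min c d) (\<Sum>x\<in>insert x A. of_int (f x) * D x)"
        unfolding sum.insert[OF insert(1,2)]
        by (intro vanishes_below_add vanishes_below_mult vanishes_below_mono[OF c] vanishes_below_mono[OF d]) auto
      then show ?case by blast
    qed simp
    then show ?thesis unfolding linear_ext_def using fin sub by blast
  qed
  have "\<exists>c. \<forall>t\<in>T. vanishes_below c (linear_ext D t)"
    using T
  proof (induction rule: finite_induct)
    case (insert t T)
    then obtain c where c: "\<forall>t\<in>T. vanishes_below c (linear_ext D t)" by blast
    obtain d where d: "vanishes_below d (linear_ext D t)" using ext_bound[of t] insert.prems unfolding augmentation_ideal_def by blast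
    have "\<forall>s\<in>insert t T. vanishes_below (min c d) (linear_ext D s)"
      using c d by (auto intro: vanishes_below_mono)
    then show ?case by blast
  qed simp
  then obtain c where c: "\<And>t. t \<in> T \<Longrightarrow> vanishes_below c (linear_ext D t)" by blast
  define J where "J = {f \<in> carrier ?R. augmentation f = 0 \<and> vanishes_below c (linear_ext D f)}"
  have J_mult: "a \<otimes>\<^bsub>?R\<^esub> f \<in> J" if a: "a \<in> carrier ?R" and f: "f \<in> J" for a f
  proof -
    have f': "f \<in> carrier ?R" "augmentation f = 0" "vanishes_below c (linear_ext D f)"
      using f by (auto simp: J_def)
    have fa: "finite (supp a)" "supp a \<subseteq> carrier ?M" and ff: "finite (supp f)" "supp f \<subseteq> carrier ?M"
      using a f' by (auto simp: monoid_ring_carrier)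
    have "linear_ext D (a \<otimes>\<^bsub>?R\<^esub> f) =
        (\<Sum>y\<in>supp a. \<Sum>z\<in>supp f. of_int (a y) * (of_int (f z) * D (y \<otimes> z)))"
      using linear_ext_mult[OF fa(1) ff(1) subset_refl subset_refl, of D ?M] by (simp add: Mm)
    also have "\<dots> = (\<Sum>y\<in>supp a. of_int (a y) * L y (linear_ext D f))"
    proof (rule sum.cong[OF refl])
      fix y assume "y \<in> supp a"
      then have y: "y \<in> carrier G" using fa by (auto simp: Mc)
      have "(\<Sum>z\<in>supp f. of_int (a y) * (of_int (f z) * D (y \<otimes> z))) =
          (\<Sum>z\<in>supp f. of_int (a y) * (of_int (f z) * D y + of_int (f z) * L y (D z)))"
        by (rule sum.cong) (use ff y D_mult in \<open>auto simp: Mc distrib_left\<close>)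
      also have "\<dots> = of_int (a y) * ((\<Sum>z\<in>supp f. of_int (f z) * D y) + (\<Sum>z\<in>supp f. of_int (f z) * L y (D z)))"
        unfolding sum_distrib_left[symmetric] sum.distrib ..
      also have "(\<Sum>z\<in>supp f. of_int (f z) * D y) = of_int (augmentation f) * D y"
        by (simp add: augmentation_def sum_distrib_right)
      also have "(\<Sum>z\<in>supp f. of_int (f z) * L y (D z)) = L y (linear_ext D f)"
        unfolding linear_ext_def additive_sum[of "L y", OF L_add[OF y]] additive_of_int[of "L y", OF L_add[OF y]] ..
      finally show "(\<Sum>z\<in>supp f. of_int (a y) * (of_int (f z) * D (y \<otimes> z))) =
          of_int (a y) * L y (linear_ext D f)"
        unfolding f'(2) of_int_0 mult_zero_left add_0_left .
    qed
    finally have "vanishes_below c (linear_ext D (a \<otimes>\<^bsub>?R\<^esub> f))"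
      using f'(3) fa(2) L_van by (auto intro!: vanishes_below_sum vanishes_below_mult)
    then show ?thesis
      using M.monoid_ring_mult_closed[OF a f'(1)] augmentation_mult[OF fa(1) ff(1), of ?M] f'(2) by (simp add: J_def)
  qed
  have J_add: "(\<lambda>g. x g + y g) \<in> J" if "x \<in> J" "y \<in> J" for x y
    using that M.monoid_ring_add_closed[of x y] linear_ext_add[of x y D] augmentation_add[of x y]
    by (simp add: J_def monoid_ring_carrier vanishes_below_add)
  have "left_ideal ?R J"
    using J_add J_mult M.monoid_ring_zero_closed
    by (auto simp: left_ideal_def J_def augmentation_def linear_ext_def)
  moreover have "T \<subseteq> J" using T c by (auto simp: J_def augmentation_ideal_def)
  ultimately have J: "f \<in> J" if "f \<in> carrier ?R" "augmentation f = 0" for f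
    using gen[of J] that by (auto simp: augmentation_ideal_def)
  show thesis
  proof (rule that)
    fix g assume g: "g \<in> carrier G" "\<chi> g \<ge> 0"
    have bg: "basis_elt g \<in> carrier ?R" using g by (intro basis_elt_carrier) (simp add: Mc)
    have b1: "(\<lambda>x. - basis_elt \<one> x) \<in> carrier ?R"
      using M.monoid_ring_uminus_closed[OF basis_elt_carrier[OF M.one_closed]] by (simp add: M1)
    have fin: "finite (supp (basis_elt g))" "finite (supp (\<lambda>x. - basis_elt \<one> x))"
      using bg b1 by (simp_all add: monoid_ring_carrier)
    have "(\<lambda>x. basis_elt g x + - basis_elt \<one> x) \<in> J"
      by (rule J[OF M.monoid_ring_add_closed[OF bg b1]])
        (subst augmentation_add[OF fin], simp add: augmentation_uminus augmentation_basis)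
    moreover have "linear_ext D (\<lambda>x. basis_elt g x + - basis_elt \<one> x) = D g - D \<one>"
      by (subst linear_ext_add[OF fin]) (simp add: linear_ext_uminus linear_ext_basis)
    moreover have "D \<one> = 0" using Phi_one by (simp add: D_def)
    ultimately show "vanishes_below c (\<Phi> g 0)" by (simp add: J_def D_def)
  qed
qed

text \<open>Since \<open>a\<close> fixes 0, the element $a^n b a^{-n-N}$ has the translation part $a^n (D b)$, whose
  valuation tends to minus infinity with \<open>n\<close>, while a fixed large \<open>N\<close> makes the height
  $\chi(b) - N \chi(a)$ non-negative.\<close>

lemma (in group) not_type_FP1_if_affine_action:
  fixes \<Phi> :: "'a \<Rightarrow> ('i \<times> real \<Rightarrow> complex) \<Rightarrow> ('i \<times> real \<Rightarrow> complex)"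
  assumes chi: "\<chi> \<in> hom G real_add_group"
    and Phi_mult: "\<And>g h. g \<in> carrier G \<Longrightarrow> h \<in> carrier G \<Longrightarrow> \<Phi> (g \<otimes> h) = \<Phi> g \<circ> \<Phi> h"
    and Phi_one: "\<Phi> \<one> = id"
    and Phi: "\<And>g. g \<in> carrier G \<Longrightarrow> shift_affine (\<chi> g) (\<Phi> g)"
    and a: "a \<in> carrier G" "\<chi> a < 0" "\<Phi> a 0 = 0"
    and b: "b \<in> carrier G" "\<Phi> b 0 \<noteq> 0"
  shows "\<not> type_FP (monoid_ring (nonneg_submonoid G \<chi>)) trivial_module 1"
proof
  assume FP: "type_FP (monoid_ring (nonneg_submonoid G \<chi>)) trivial_module 1"
  obtain c where c: "\<And>g. g \<in> carrier G \<Longrightarrow> \<chi> g \<ge> 0 \<Longrightarrow> vanishes_below c (\<Phi> g 0)"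
    using derivation_bounded_below[OF chi FP Phi_mult Phi_one Phi] by blast
  obtain i r where r: "\<Phi> b 0 (i, r) \<noteq> 0" using b(2) by (auto simp: fun_eq_iff)
  have chi_mult: "\<chi> (x \<otimes> y) = \<chi> x + \<chi> y" if "x \<in> carrier G" "y \<in> carrier G" for x y
    using chi that by (simp add: hom_def real_add_group_def)
  have chi_one: "\<chi> \<one> = 0" using chi_mult[of \<one> \<one>] by simp
  have chi_inv: "\<chi> (inv x) = - \<chi> x" if "x \<in> carrier G" for x
    using chi_mult[of x "inv x"] chi_one that by simp
  have chi_pow: "\<chi> (a [^] n) = real n * \<chi> a" for n :: nat
    by (induction n) (simp_all add: chi_one chi_mult a(1) algebra_simps)
  have Phi_pow: "\<Phi> (a [^] n) 0 = 0" for n :: nat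
  proof (induction n)
    case 0
    show ?case by (simp only: nat_pow_0 Phi_one id_apply)
  next
    case (Suc n)
    have "\<Phi> (a [^] Suc n) 0 = \<Phi> (a [^] n) (\<Phi> a 0)"
      using a(1) by (simp only: nat_pow_Suc Phi_mult nat_pow_closed comp_apply)
    then show ?case by (simp only: a(3) Suc.IH)
  qed
  have Phi_inv: "\<Phi> (inv x) (\<Phi> x m) = m" if "x \<in> carrier G" for x m
    using Phi_mult[of "inv x" x] that Phi_one by (metis comp_apply id_apply inv_closed l_inv)
  have Phi_inv_pow: "\<Phi> (inv (a [^] n)) 0 = 0" for n :: nat
    using Phi_inv[of "a [^] n" 0] Phi_pow a(1) by simp
  obtain n where n: "real n * - \<chi> a > r - c"
    using ex_less_of_nat_mult[of "- \<chi> a" "r - c"] a(2) by auto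
  obtain N where N: "real N * - \<chi> a > - \<chi> b"
    using ex_less_of_nat_mult[of "- \<chi> a" "- \<chi> b"] a(2) by auto
  define g where "g = a [^] n \<otimes> (b \<otimes> inv (a [^] (n + N)))"
  have g: "g \<in> carrier G" using a(1) b(1) by (simp add: g_def)
  have "\<chi> g = \<chi> b - real N * \<chi> a"
    using a(1) b(1) by (simp add: g_def chi_mult chi_inv chi_pow algebra_simps)
  then have "vanishes_below c (\<Phi> g 0)" using c[OF g] N by simp
  moreover have "\<Phi> g 0 = \<Phi> (a [^] n) (\<Phi> b 0)"
    using a(1) b(1) by (simp add: g_def Phi_mult Phi_inv_pow)
  ultimately have "vanishes_below c (\<Phi> (a [^] n) (\<Phi> b 0))" by simp
  from shift_affine_linear(2)[OF Phi this, of "inv (a [^] n)"]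
  have "vanishes_below (c - real n * \<chi> a) (\<Phi> b 0)"
    using a(1) by (simp add: Phi_inv Phi_inv_pow chi_inv chi_pow)
  then show False using r n by (simp add: vanishes_below_def)
qed

lemma not_type_FP1_if_generator_action:
  fixes T :: "'x \<times> bool \<Rightarrow> ('i \<times> real \<Rightarrow> complex) \<Rightarrow> ('i \<times> real \<Rightarrow> complex)"
  assumes chi: "\<chi> \<in> hom (pres_group X R) real_add_group"
    and inv: "\<And>x s. x \<in> X \<Longrightarrow> T (x, s) \<circ> T (x, \<not> s) = id"
    and rel: "\<And>r r'. (r, r') \<in> R \<Longrightarrow> r \<in> words X \<Longrightarrow> r' \<in> words X \<Longrightarrow> word_action T r = word_action T r'"
    and shift: "\<And>x s. x \<in> X \<Longrightarrow> shift_affine (\<chi> (word_class X R [(x, s)])) (T (x, s))"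
    and a: "a \<in> X" "\<chi> (word_class X R [(a, s)]) < 0" "T (a, s) 0 = 0"
    and b: "b \<in> X" "T (b, t) 0 \<noteq> 0"
  shows "\<not> type_FP (monoid_ring (nonneg_submonoid (pres_group X R) \<chi>)) trivial_module 1"
proof -
  let ?G = "pres_group X R" and ?c = "word_class X R"
  interpret G: group ?G by (rule group_pres_group)
  obtain \<Phi> where Phi: "\<And>w. w \<in> words X \<Longrightarrow> \<Phi> (?c w) = word_action T w"
    using pres_group_action[of X T R, OF inv rel] by blast
  have chi_mult: "\<chi> (x \<otimes>\<^bsub>?G\<^esub> y) = \<chi> x + \<chi> y" if "x \<in> carrier ?G" "y \<in> carrier ?G" for x y
    using chi that by (simp add: hom_def real_add_group_def)
  have chi_one: "\<chi> (?c []) = 0"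
    using chi_mult[of "?c []" "?c []"] word_class_mult[of "[]" X "[]" R] by simp
  have word_shift: "shift_affine (\<chi> (?c w)) (word_action T w)" if "w \<in> words X" for w
    using that
  proof (induction w)
    case Nil
    show ?case unfolding chi_one word_action_simps by (rule shift_affine_id)
  next
    case (Cons p w)
    have "\<chi> (?c (p # w)) = \<chi> (?c [p]) + \<chi> (?c w)"
      using chi_mult[of "?c [p]" "?c w"] word_class_mult[of "[p]" X w R] Cons.prems by simp
    moreover have "shift_affine (\<chi> (?c [p])) (T p)" using shift[of "fst p" "snd p"] Cons.prems by simp
    moreover have "shift_affine (\<chi> (?c w)) (word_action T w)" using Cons by simp
    ultimately show ?case unfolding word_action_simps by (metis shift_affine_comp)
  qed
  show ?thesis
  proof (rule G.not_type_FP1_if_affine_action[of \<chi> \<Phi> "?c [(a, s)]" "?c [(b, t)]"])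
    fix g h assume "g \<in> carrier ?G" "h \<in> carrier ?G"
    moreover obtain v where "v \<in> words X" "g = ?c v" using \<open>g \<in> carrier ?G\<close> by (rule pres_group_carrierE)
    moreover obtain w where "w \<in> words X" "h = ?c w" using \<open>h \<in> carrier ?G\<close> by (rule pres_group_carrierE)
    ultimately show "\<Phi> (g \<otimes>\<^bsub>?G\<^esub> h) = \<Phi> g \<circ> \<Phi> h"
      by (simp add: word_class_mult Phi word_action_append)
  next
    fix g assume "g \<in> carrier ?G"
    then obtain w where "w \<in> words X" "g = ?c w" by (rule pres_group_carrierE)
    then show "shift_affine (\<chi> g) (\<Phi> g)" using word_shift Phi by simp
  next
    show "\<Phi> \<one>\<^bsub>?G\<^esub> = id" unfolding word_class_one using Phi[of "[]"] by simp
    show "\<Phi> (?c [(a, s)]) 0 = 0" "\<Phi> (?c [(b, t)]) 0 \<noteq> 0" using Phi a b by simp_all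
  qed (use chi a b in simp_all)
qed


section \<open>Affine actions of Artin groups\<close>

fun alt_comp :: "('m \<Rightarrow> 'm) \<Rightarrow> ('m \<Rightarrow> 'm) \<Rightarrow> nat \<Rightarrow> 'm \<Rightarrow> 'm" where
  "alt_comp f g 0 = id"
| "alt_comp f g (Suc n) = f \<circ> alt_comp g f n"

lemma alt_comp_double: "alt_comp f g (2 * k) = (f \<circ> g) ^^ k"
  by (induction k) (simp_all add: comp_assoc)

lemma alt_comp_commute:
  assumes "f \<circ> g = g \<circ> f" "even n"
  shows "alt_comp f g n = alt_comp g f n"
proof -
  obtain k where "n = 2 * k" using assms(2) by (elim evenE)
  then show ?thesis using assms(1) by (simp only: alt_comp_double)
qed

lemma add_diff_id: "e + (m - e) = (m::'m::ab_group_add)"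
  by simp

text \<open>Maps that are conjugated by the same translation satisfy the relations of the original maps.\<close>

lemma alt_comp_conj:
  fixes e :: "'m::ab_group_add"
  assumes "\<And>m. f m = e + F (m - e)" "\<And>m. g m = e + H (m - e)"
  shows "alt_comp f g n m = e + alt_comp F H n (m - e)"
  using assms
proof (induction n arbitrary: f g F H)
  case 0
  show ?case by (simp only: alt_comp.simps id_apply add_diff_id)
next
  case (Suc n)
  have "alt_comp g f n m = e + alt_comp H F n (m - e)" by (rule Suc.IH) (rule Suc.prems)+
  then show ?case
    unfolding alt_comp.simps comp_apply Suc.prems(1)[of "alt_comp g f n m"] by (simp only: add_diff_cancel_left')
qed

lemma word_action_alt_word:
  "word_action T (alt_word u v n) = alt_comp (T (u, True)) (T (v, True)) n"
  by (induction n arbitrary: u v) simp_all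

lemma shift_affine_conj:
  fixes e :: "'i \<times> real \<Rightarrow> complex"
  assumes add: "\<And>x y. L (x + y) = L x + L y"
    and shift: "\<And>d m. vanishes_below d m \<Longrightarrow> vanishes_below (d + a) (L m)"
    and e: "vanishes_below d0 e"
    and f: "\<And>m. f m = e + L (m - e)"
  shows "shift_affine a f"
proof -
  have L0: "L 0 = 0" using add[of 0 0] by simp
  have lin: "f m - f 0 = L m" for m
  proof -
    have "L (m - e) = L m + L (0 - e)" using add[of m "0 - e"] by simp
    then show ?thesis unfolding f by simp
  qed
  have neg: "vanishes_below d (0 - m)" if "vanishes_below d m" for d m
    using that by (simp add: vanishes_below_def)
  have "vanishes_below (min d0 (d0 + a)) (f 0)"
    unfolding f by (intro vanishes_below_add vanishes_below_mono[OF e] vanishes_below_mono[OF shift[OF neg[OF e]]]) auto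
  then show ?thesis unfolding shift_affine_def lin using add shift by blast
qed

text \<open>The generator \<open>v\<close> acts by the linear map \<open>L v\<close> conjugated by the translation by \<open>e v\<close>; so \<open>e v\<close> is
  a fixed point of \<open>v\<close>.\<close>

lemma artin_not_type_FP1:
  fixes L L' :: "'v \<Rightarrow> ('i \<times> real \<Rightarrow> complex) \<Rightarrow> ('i \<times> real \<Rightarrow> complex)"
    and e :: "'v \<Rightarrow> 'i \<times> real \<Rightarrow> complex"
  assumes graph: "labelled_graph V E l"
    and chi: "\<chi> \<in> hom (artin_group V E l) real_add_group"
  defines "c \<equiv> \<lambda>v. \<chi> (artin_gen V E l v)"
    and "\<sigma> \<equiv> \<lambda>v m. e v + L v (m - e v)"
  assumes add: "\<And>v x y. v \<in> V \<Longrightarrow> L v (x + y) = L v x + L v y"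
    and inv: "\<And>v m. v \<in> V \<Longrightarrow> L v (L' v m) = m" "\<And>v m. v \<in> V \<Longrightarrow> L' v (L v m) = m"
    and shift: "\<And>v d m. v \<in> V \<Longrightarrow> vanishes_below d m \<Longrightarrow> vanishes_below (d + c v) (L v m)"
      "\<And>v d m. v \<in> V \<Longrightarrow> vanishes_below d m \<Longrightarrow> vanishes_below (d + - c v) (L' v m)"
    and e: "\<And>v. v \<in> V \<Longrightarrow> vanishes_below 0 (e v)"
    and braid: "\<And>u v. {u, v} \<in> E \<Longrightarrow> alt_comp (\<sigma> u) (\<sigma> v) (l {u, v}) = alt_comp (\<sigma> v) (\<sigma> u) (l {u, v})"
    and a: "a \<in> V" "c a \<noteq> 0" "e a = 0"
    and b: "b \<in> V" "\<sigma> b 0 \<noteq> 0"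
  shows "\<not> type_FP (monoid_ring (nonneg_submonoid (artin_group V E l) \<chi>)) trivial_module 1"
proof -
  let ?R = "artin_relations E l" and ?G = "artin_group V E l"
  interpret group ?G by (rule group_artin_group)
  define T where "T p m = (if snd p then e (fst p) + L (fst p) (m - e (fst p))
      else e (fst p) + L' (fst p) (m - e (fst p)))" for p m
  have add': "L' v (x + y) = L' v x + L' v y" if "v \<in> V" for v x y
  proof -
    have "L v (L' v x + L' v y) = x + y" unfolding add[OF that] inv(1)[OF that] ..
    then show ?thesis using inv(2)[OF that] by metis
  qed
  have T_True: "T (v, True) = \<sigma> v" for v by (rule ext) (simp only: T_def \<sigma>_def fst_conv snd_conv if_True)
  have L0: "L v 0 = 0" "L' v 0 = 0" if "v \<in> V" for v
    using add[OF that, of 0 0] add'[OF that, of 0 0] by simp_all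
  have chi_inv: "\<chi> (word_class V ?R [(v, False)]) = - c v" if "v \<in> V" for v
  proof -
    have mult: "\<chi> (x \<otimes>\<^bsub>?G\<^esub> y) = \<chi> x + \<chi> y" if "x \<in> carrier ?G" "y \<in> carrier ?G" for x y
      using chi that by (simp add: hom_def real_add_group_def)
    have "\<chi> \<one>\<^bsub>?G\<^esub> = 0" using mult[of "\<one>\<^bsub>?G\<^esub>" "\<one>\<^bsub>?G\<^esub>"] by simp
    moreover have "word_class V ?R [(v, False)] = inv\<^bsub>?G\<^esub> artin_gen V E l v"
      using that by (simp add: artin_group_def artin_gen_word_class word_class_inverse_letter)
    ultimately show ?thesis
      using mult[of "artin_gen V E l v" "inv\<^bsub>?G\<^esub> artin_gen V E l v"] that by (simp add: c_def)
  qed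
  have chi_gen: "\<chi> (word_class V ?R [(v, True)]) = c v" for v by (simp add: c_def artin_gen_word_class)
  have "\<not> type_FP (monoid_ring (nonneg_submonoid (pres_group V ?R) \<chi>)) trivial_module 1"
  proof (rule not_type_FP1_if_generator_action[of \<chi> V ?R T a "c a < 0" b True])
    show "\<chi> \<in> hom (pres_group V ?R) real_add_group" using chi by (simp only: artin_group_def)
    fix v s assume v: "v \<in> V"
    show "T (v, s) \<circ> T (v, \<not> s) = id"
    proof
      fix m
      show "(T (v, s) \<circ> T (v, \<not> s)) m = id m"
        unfolding T_def comp_apply fst_conv snd_conv id_apply
        by (cases s) (simp_all only: if_True if_False not_True_eq_False not_False_eq_True
            add_diff_cancel_left' inv[OF v] add_diff_id)
    qed
    show "shift_affine (\<chi> (word_class V ?R [(v, s)])) (T (v, s))"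
    proof (cases s)
      case True
      then have S: "s = True" by simp
      show ?thesis unfolding S chi_gen
        by (rule shift_affine_conj[OF add[OF v] shift(1)[OF v] e[OF v]])
          (simp_all only: T_def fst_conv snd_conv if_True)
    next
      case False
      then have F: "s = False" by simp
      show ?thesis unfolding F chi_inv[OF v]
        by (rule shift_affine_conj[OF add'[OF v] shift(2)[OF v] e[OF v]])
          (simp_all only: T_def fst_conv snd_conv if_False)
    qed
  next
    fix r r' assume "(r, r') \<in> ?R"
    then obtain u v where uv: "{u, v} \<in> E" "r = alt_word u v (l {u, v})" "r' = alt_word v u (l {u, v})"
      unfolding artin_relations_def by blast
    show "word_action T r = word_action T r'"
      unfolding uv(2,3) word_action_alt_word T_True by (rule braid[OF uv(1)])
  next
    show "\<chi> (word_class V ?R [(a, c a < 0)]) < 0"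
      using a(2) chi_gen[of a] chi_inv[OF a(1)] by (cases "c a < 0") auto
    show "T (a, c a < 0) 0 = 0"
      unfolding T_def fst_conv snd_conv a(3) using L0[OF a(1)] by (simp only: diff_self add_0_left if_cancel)
    show "T (b, True) 0 \<noteq> 0" unfolding T_True by (rule b(2))
  qed (rule a b)+
  then show ?thesis unfolding artin_group_def .
qed


section \<open>Disconnected living subgraphs\<close>

definition unit_root :: "nat \<Rightarrow> complex" where
  "unit_root n = cis (2 * pi / real n)"

lemma unit_root_power: "n > 0 \<Longrightarrow> unit_root n ^ n = 1"
  by (simp add: unit_root_def DeMoivre)

lemma unit_root_nonzero: "unit_root n \<noteq> 0"
  by (simp add: unit_root_def)

lemma unit_root_neq_one:
  assumes "n \<ge> 2"
  shows "unit_root n \<noteq> 1"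
proof
  assume "unit_root n = 1"
  moreover have "inj_on (\<lambda>k. cis (2 * pi * real k / real n)) {..<n}"
    using bij_betw_roots_unity[of n] assms by (simp add: bij_betw_def)
  ultimately have "(1::nat) = 0"
    using assms by (elim inj_onD) (simp_all add: unit_root_def)
  then show False by simp
qed

definition scale_shift :: "complex \<Rightarrow> real \<Rightarrow> ('i \<times> real \<Rightarrow> complex) \<Rightarrow> 'i \<times> real \<Rightarrow> complex" where
  "scale_shift z a m = (\<lambda>(i, r). z * m (i, r - a))"

lemma scale_shift_apply [simp]: "scale_shift z a m (i, r) = z * m (i, r - a)"
  by (simp add: scale_shift_def)

lemma scale_shift_add: "scale_shift z a (x + y) = scale_shift z a x + scale_shift z a y"
  by (auto simp: fun_eq_iff algebra_simps)

lemma scale_shift_scale_shift: "scale_shift z a (scale_shift w b m) = scale_shift (z * w) (a + b) m"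
  by (auto simp: fun_eq_iff algebra_simps)

lemma scale_shift_one: "scale_shift 1 0 m = m"
  by (auto simp: fun_eq_iff)

lemma vanishes_below_scale_shift: "vanishes_below d m \<Longrightarrow> vanishes_below (d + a) (scale_shift z a m)"
  by (auto simp: vanishes_below_def)

text \<open>As \<open>\<zeta> \<noteq> 1\<close>, the map has a fixed point, around which it is multiplication by \<open>\<zeta>\<close>.\<close>

lemma affine_root_of_unity_period:
  assumes f: "\<And>m i r. f m (i, r) = \<zeta> * m (i, r) + (b (i, r) :: complex)"
    and z: "\<zeta> \<noteq> 1" "\<zeta> ^ k = 1"
  shows "f ^^ k = id"
proof -
  define p where "p i r = b (i, r) / (1 - \<zeta>)" for i r
  have p: "b (i, r) = p i r - \<zeta> * p i r" for i r
  proof -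
    have "(1 - \<zeta>) * p i r = b (i, r)" using z(1) by (simp add: p_def)
    then show ?thesis by (simp add: algebra_simps)
  qed
  have "(f ^^ n) m (i, r) = \<zeta> ^ n * (m (i, r) - p i r) + p i r" for n m i r
  proof (induction n)
    case (Suc n)
    have "(f ^^ Suc n) m (i, r) = \<zeta> * (\<zeta> ^ n * (m (i, r) - p i r) + p i r) + (p i r - \<zeta> * p i r)"
      using Suc f p by simp
    then show ?case by (simp add: algebra_simps)
  qed simp
  then have "(f ^^ k) m = m" for m using z(2) by (auto simp: fun_eq_iff)
  then show ?thesis by (auto simp: fun_eq_iff)
qed

text \<open>Edges between two dead vertices may satisfy \<open>dead_edge\<close> as well, because 0 + 0 = 0; they belong to a
  relation between generators that will act trivially.\<close>

definition dead_living_edges :: "'v set \<Rightarrow> 'v set set \<Rightarrow> ('v set \<Rightarrow> nat) \<Rightarrow> ('v \<Rightarrow> real) \<Rightarrow> 'v set set" where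
  "dead_living_edges V E l c = {e \<in> E. dead_edge l c e \<and> e \<subseteq> living_verts V c}"

text \<open>The scalars define a complex character of the Artin group that is trivial on dead vertices.
  The last condition says that multiplication by \<open>lam u * lam v\<close> has the trivial \<open>k\<close>-th power but no
  non-zero fixed vector, where $2k$ is the label of the dead edge.\<close>

definition admissible_scalars ::
  "'v set \<Rightarrow> 'v set set \<Rightarrow> ('v set \<Rightarrow> nat) \<Rightarrow> ('v \<Rightarrow> real) \<Rightarrow> ('v \<Rightarrow> complex) \<Rightarrow> bool" where
  "admissible_scalars V E l c lam \<longleftrightarrow>
     (\<forall>v\<in>V. lam v \<noteq> 0 \<and> (c v = 0 \<longrightarrow> lam v = 1)) \<and>
     (\<forall>u v. {u, v} \<in> E \<longrightarrow> odd (l {u, v}) \<longrightarrow> lam u = lam v) \<and>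
     (\<forall>u v. {u, v} \<in> dead_living_edges V E l c \<longrightarrow>
        lam u * lam v \<noteq> 1 \<and> (lam u * lam v) ^ (l {u, v} div 2) = 1)"

text \<open>Let \<open>C\<close> be the component of a living vertex \<open>b\<close>.  Every vertex acts on one-dimensional series as
  multiplication by its scalar times $t^{c v}$, fixing the constant series \<open>\<delta>\<close> if it lies in \<open>C\<close>
  and 0 otherwise.  Edges inside \<open>C\<close> or outside \<open>C\<close> and edges at a dead vertex give commuting or
  equal maps.  On a dead edge between living vertices the products \<open>u v\<close> and \<open>v u\<close> do not shift
  degrees, and admissibility makes their \<open>k\<close>-th powers trivial wherever the fixed points are.\<close>

lemma not_type_FP1_if_living_disconnected:
  fixes lam :: "'v \<Rightarrow> complex"
  assumes graph: "labelled_graph V E l"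
    and chi: "\<chi> \<in> hom (artin_group V E l) real_add_group"
  defines "c \<equiv> \<lambda>v. \<chi> (artin_gen V E l v)"
  assumes scalars: "admissible_scalars V E l c lam"
    and disc: "\<not> graph_connected (living_verts V c) (living_edges V E l c)"
  shows "\<not> type_FP (monoid_ring (nonneg_submonoid (artin_group V E l) \<chi>)) trivial_module 1"
proof -
  have lam: "v \<in> V \<Longrightarrow> lam v \<noteq> 0" "v \<in> V \<Longrightarrow> c v = 0 \<Longrightarrow> lam v = 1"
    "{u, v} \<in> E \<Longrightarrow> odd (l {u, v}) \<Longrightarrow> lam u = lam v"
    "{u, v} \<in> dead_living_edges V E l c \<Longrightarrow>
      lam u * lam v \<noteq> 1 \<and> (lam u * lam v) ^ (l {u, v} div 2) = 1" for u v
    using scalars unfolding admissible_scalars_def by blast+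
  let ?A = "{(a, b). {a, b} \<in> living_edges V E l c}"
  obtain b a where b: "b \<in> living_verts V c" and a: "a \<in> living_verts V c" and ba: "(b, a) \<notin> ?A\<^sup>*"
    using disc unfolding graph_connected_def by blast
  define C where "C = {w \<in> living_verts V c. (b, w) \<in> ?A\<^sup>*}"
  define \<delta> where "\<delta> = (\<lambda>(i::unit, r::real). if r = 0 then 1 else 0 :: complex)"
  define e where "e v = (if v \<in> C then \<delta> else 0)" for v
  define L where "L v = (scale_shift (lam v) (c v) :: (unit \<times> real \<Rightarrow> complex) \<Rightarrow> _)" for v
  define L' where "L' v = (scale_shift (inverse (lam v)) (- c v) :: (unit \<times> real \<Rightarrow> complex) \<Rightarrow> _)" for v
  define \<sigma> where "\<sigma> v m = e v + L v (m - e v)" for v m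
  have C_edge: "u \<in> C \<longleftrightarrow> v \<in> C" if "{u, v} \<in> living_edges V E l c" for u v
  proof -
    have "(u, v) \<in> ?A" "(v, u) \<in> ?A" using that by (auto simp: insert_commute)
    moreover have "u \<in> living_verts V c" "v \<in> living_verts V c" using that by (auto simp: living_edges_def)
    ultimately show ?thesis unfolding C_def by (auto intro: rtrancl_into_rtrancl)
  qed
  have L_commute: "L u (L v m) = L v (L u m)" for u v m
    unfolding L_def scale_shift_scale_shift by (simp only: mult.commute add.commute)
  have dead_id: "\<sigma> v = id" if "v \<in> V" "c v = 0" for v
  proof
    fix m
    have "v \<notin> C" using that by (simp add: C_def living_verts_def)
    then show "\<sigma> v m = id m"
      unfolding \<sigma>_def L_def e_def using that lam(2) by (simp only: if_False scale_shift_one diff_zero add_0_left id_apply)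
  qed
  have L_diff: "L v (x - y) = L v x - L v y" for v x y
    unfolding L_def by (auto simp: fun_eq_iff algebra_simps)
  have L_zero: "L v 0 = 0" for v
    unfolding L_def by (auto simp: fun_eq_iff)
  have L_add: "L v (x + y) = L v x + L v y" for v x y
    unfolding L_def by (rule scale_shift_add)
  have braid: "alt_comp (\<sigma> u) (\<sigma> v) (l {u, v}) = alt_comp (\<sigma> v) (\<sigma> u) (l {u, v})" if uvE: "{u, v} \<in> E" for u v
  proof (cases "odd (l {u, v})")
    case True
    have cuv: "c u = c v" unfolding c_def by (rule odd_edge_same_value[OF graph uvE True chi])
    note uv = labelled_graph_edgeD[OF graph uvE]
    have "\<sigma> u = \<sigma> v"
    proof (cases "c u = 0")
      case True
      then show ?thesis using dead_id uv cuv by metis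
    next
      case False
      then have "{u, v} \<in> living_edges V E l c"
        using uvE uv cuv True by (auto simp: living_edges_def living_verts_def dead_edge_def)
      then have "e u = e v" unfolding e_def using C_edge by simp
      moreover have "L u = L v" unfolding L_def cuv lam(3)[OF uvE True] ..
      ultimately show ?thesis unfolding \<sigma>_def by simp
    qed
    then show ?thesis by simp
  next
    case False
    then have ev: "even (l {u, v})" by simp
    note uv = labelled_graph_edgeD[OF graph uvE]
    consider "c u = 0 \<or> c v = 0" | "{u, v} \<in> living_edges V E l c" | "c u \<noteq> 0" "c v \<noteq> 0" "dead_edge l c {u, v}"
      using uvE uv by (auto simp: living_edges_def living_verts_def)
    then show ?thesis
    proof cases
      case 1
      then have "\<sigma> u = id \<or> \<sigma> v = id" using dead_id uv by blast
      then have "\<sigma> u \<circ> \<sigma> v = \<sigma> v \<circ> \<sigma> u" by auto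
      then show ?thesis using ev by (rule alt_comp_commute)
    next
      case 2
      have euv: "e u = e v" unfolding e_def using C_edge[OF 2] by simp
      have "L u \<circ> L v = L v \<circ> L u" by (rule ext) (simp only: comp_apply L_commute)
      then have Lb: "alt_comp (L u) (L v) (l {u, v}) = alt_comp (L v) (L u) (l {u, v})"
        using ev by (rule alt_comp_commute)
      show ?thesis
      proof
        fix m
        have "alt_comp (\<sigma> u) (\<sigma> v) (l {u, v}) m = e u + alt_comp (L u) (L v) (l {u, v}) (m - e u)"
          by (rule alt_comp_conj) (simp_all only: \<sigma>_def euv)
        moreover have "alt_comp (\<sigma> v) (\<sigma> u) (l {u, v}) m = e u + alt_comp (L v) (L u) (l {u, v}) (m - e u)"
          by (rule alt_comp_conj) (simp_all only: \<sigma>_def euv)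
        ultimately show "alt_comp (\<sigma> u) (\<sigma> v) (l {u, v}) m = alt_comp (\<sigma> v) (\<sigma> u) (l {u, v}) m"
          by (simp only: Lb)
      qed
    next
      case 3
      have sum0: "c u + c v = 0"
        using 3(3) unfolding dead_edge_def by (auto simp: doubleton_eq_iff)
      obtain k where k: "l {u, v} = 2 * k" using ev by (elim evenE)
      have z: "lam u * lam v \<noteq> 1" "(lam u * lam v) ^ k = 1"
        using lam(4)[of u v] 3 uv uvE k
        by (auto simp: dead_living_edges_def living_verts_def)
      have id: "(\<sigma> x \<circ> \<sigma> y) ^^ k = id" if "c x + c y = 0" "lam x * lam y = lam u * lam v" for x y
      proof (rule affine_root_of_unity_period[OF _ z])
        fix m i r
        have "(\<sigma> x \<circ> \<sigma> y) m = L x (L y m) + (\<sigma> x (\<sigma> y 0))"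
          unfolding comp_apply \<sigma>_def L_add L_diff L_zero by (simp add: algebra_simps)
        moreover have "L x (L y m) (i, r) = (lam u * lam v) * m (i, r)"
          unfolding L_def scale_shift_scale_shift that by simp
        ultimately show "(\<sigma> x \<circ> \<sigma> y) m (i, r) = (lam u * lam v) * m (i, r) + (\<sigma> x (\<sigma> y 0)) (i, r)"
          by (simp only: plus_fun_apply)
      qed
      have "(\<sigma> u \<circ> \<sigma> v) ^^ k = id" by (rule id) (use sum0 in auto)
      moreover have "(\<sigma> v \<circ> \<sigma> u) ^^ k = id" by (rule id) (use sum0 in auto)
      ultimately show ?thesis unfolding k alt_comp_double by simp
    qed
  qed
  show ?thesis
  proof (rule artin_not_type_FP1[OF graph chi, where L = L and L' = L' and e = e and a = a and b = b])
    fix v :: 'v and m :: "unit \<times> real \<Rightarrow> complex" and d :: real assume v: "v \<in> V"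
    show "L v (L' v m) = m" "L' v (L v m) = m"
      unfolding L_def L'_def scale_shift_scale_shift using lam(1)[OF v] by (simp_all add: scale_shift_one)
    show "vanishes_below 0 (e v)" by (simp add: e_def \<delta>_def vanishes_below_def)
  next
    fix v :: 'v and m :: "unit \<times> real \<Rightarrow> complex" and d :: real assume "vanishes_below d m"
    then show "vanishes_below (d + \<chi> (artin_gen V E l v)) (L v m)"
      "vanishes_below (d + - \<chi> (artin_gen V E l v)) (L' v m)"
      unfolding L_def L'_def c_def by (rule vanishes_below_scale_shift)+
  next
    fix u v assume "{u, v} \<in> E"
    from braid[OF this] show "alt_comp (\<lambda>m. e u + L u (m - e u)) (\<lambda>m. e v + L v (m - e v)) (l {u, v}) =
        alt_comp (\<lambda>m. e v + L v (m - e v)) (\<lambda>m. e u + L u (m - e u)) (l {u, v})"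
      unfolding \<sigma>_def .
  next
    have "a \<notin> C" using ba by (simp add: C_def)
    then show "e a = 0" by (simp only: e_def if_False)
    have "b \<in> C" using b by (simp add: C_def)
    then have "(e b + L b (0 - e b)) ((), 0) = 1"
      using b by (simp add: e_def L_def \<delta>_def living_verts_def)
    then show "e b + L b (0 - e b) \<noteq> 0" by (metis zero_fun_apply zero_neq_one)
  qed (use a b L_add in \<open>auto simp: living_verts_def c_def\<close>)
qed


section \<open>Living subgraphs that are not dominant\<close>

text \<open>The contragredient reflection representation with Cartan matrix \<open>B\<close>.  In contrast to the action
  on roots, the indicator function of \<open>w\<close> is fixed by all \<open>u \<noteq> w\<close>.\<close>

definition reflection :: "('v \<Rightarrow> 'v \<Rightarrow> complex) \<Rightarrow> 'v \<Rightarrow> ('v \<Rightarrow> complex) \<Rightarrow> 'v \<Rightarrow> complex" where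
  "reflection B u x = (\<lambda>w. x w - B u w * x u)"

lemma reflection_involution:
  assumes "B u u = 2"
  shows "reflection B u (reflection B u x) = x"
  using assms by (auto simp: reflection_def fun_eq_iff algebra_simps)

text \<open>The product of the two reflections changes a vector by combinations of the rows \<open>B u\<close> and
  \<open>B v\<close>.  In their span $z \cdot B_u + B_v$ and $i \cdot B_u + B_v$ are eigenvectors with eigenvalues
  $z^2$ and $i^2 = z^{-2}$.  From $z^2 \neq 1$ it follows that $z \neq i$, so the values of a vector at \<open>u\<close> and \<open>v\<close> are
  those of a combination of the two; the remainder vanishes at \<open>u\<close> and \<open>v\<close> and is fixed.\<close>

lemma reflection_product_order:
  fixes B :: "'v \<Rightarrow> 'v \<Rightarrow> complex"
  assumes B: "B u u = 2" "B v v = 2" "B u v = - (z + i)" "B v u = - (z + i)"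
    and zi: "z * i = 1" and z2: "z\<^sup>2 \<noteq> 1" and zn: "z ^ n = 1"
  shows "((reflection B u \<circ> reflection B v) ^^ n) x = x"
proof -
  let ?T = "reflection B u \<circ> reflection B v"
  define y where "y P Q x0 = (\<lambda>w. x0 w + P * (z * B u w + B v w) + Q * (i * B u w + B v w))"
    for P Q :: complex and x0 :: "'v \<Rightarrow> complex"
  have zzi: "z * (z + i) = z\<^sup>2 + 1" and izi: "i * (z + i) = 1 + i\<^sup>2"
    using zi by (simp_all add: algebra_simps power2_eq_square)
  have zzi': "z * (z * i) = z" "i * (z * i) = i" using zi by simp_all
  have cube: "(z + i) * (1 - z\<^sup>2) = i - z ^ 3" "(z + i) * (1 - i\<^sup>2) = z - i ^ 3"
    using zzi' by (simp_all add: algebra_simps power2_eq_square power3_eq_cube)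
  have step: "?T (y P Q x0) = y (P * z\<^sup>2) (Q * i\<^sup>2) x0" if x0: "x0 u = 0" "x0 v = 0" for P Q x0
  proof
    fix w
    have yv: "y P Q x0 v = P * (1 - z\<^sup>2) + Q * (1 - i\<^sup>2)"
      unfolding y_def x0 B mult_minus_right zzi izi by (simp add: algebra_simps)
    have yu: "y P Q x0 u = (P - Q) * (z - i)"
      unfolding y_def x0 B by (simp add: algebra_simps)
    have "(P - Q) * (z - i) - - (z + i) * (P * (1 - z\<^sup>2) + Q * (1 - i\<^sup>2)) =
        (P - Q) * (z - i) + P * ((z + i) * (1 - z\<^sup>2)) + Q * ((z + i) * (1 - i\<^sup>2))"
      by (simp add: algebra_simps)
    also have "\<dots> = P * (z - z ^ 3) + Q * (i - i ^ 3)"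
      unfolding cube by (simp add: algebra_simps)
    finally have coeff: "(P - Q) * (z - i) - - (z + i) * (P * (1 - z\<^sup>2) + Q * (1 - i\<^sup>2)) =
        P * (z - z ^ 3) + Q * (i - i ^ 3)" .
    have "?T (y P Q x0) w = y P Q x0 w - B v w * y P Q x0 v
        - B u w * (y P Q x0 u - B v u * y P Q x0 v)"
      by (simp add: reflection_def)
    also have "\<dots> = y (P * z\<^sup>2) (Q * i\<^sup>2) x0 w"
      unfolding yv yu B(4) coeff unfolding y_def
      by (simp add: algebra_simps power2_eq_square power3_eq_cube)
    finally show "?T (y P Q x0) w = y (P * z\<^sup>2) (Q * i\<^sup>2) x0 w" .
  qed
  have iter: "(?T ^^ k) (y P Q x0) = y (P * (z ^ k)\<^sup>2) (Q * (i ^ k)\<^sup>2) x0"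
    if x0: "x0 u = 0" "x0 v = 0" for P Q x0 k
  proof (induction k)
    case (Suc k)
    have "(?T ^^ Suc k) (y P Q x0) = ?T (y (P * (z ^ k)\<^sup>2) (Q * (i ^ k)\<^sup>2) x0)"
      unfolding Suc[symmetric] funpow.simps by (rule comp_apply)
    also have "\<dots> = y (P * (z ^ k)\<^sup>2 * z\<^sup>2) (Q * (i ^ k)\<^sup>2 * i\<^sup>2) x0" by (rule step[OF x0])
    also have "\<dots> = y (P * (z ^ Suc k)\<^sup>2) (Q * (i ^ Suc k)\<^sup>2) x0"
      by (simp add: power_mult_distrib ac_simps)
    finally show ?case .
  qed simp
  have "i ^ n = 1" using zi zn by (metis mult_1 power_mult_distrib power_one)
  have d: "z - i \<noteq> 0"
  proof
    assume "z - i = 0"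
    then have "z\<^sup>2 = 1" using zi by (simp add: power2_eq_square)
    then show False using z2 by simp
  qed
  define P where "P = - (x v + i * x u) / (z - i)\<^sup>2"
  define Q where "Q = P - x u / (z - i)"
  have PQ: "(P - Q) * (z - i) = x u" using d by (simp add: Q_def)
  have P2: "P * (z - i)\<^sup>2 = - (x v + i * x u)" using d by (simp add: P_def)
  \<comment> \<open>\<open>P\<close> and \<open>Q\<close> solve the linear system which says that the remainder \<open>x0\<close> vanishes at \<open>u\<close> and \<open>v\<close>.\<close>
  define x0 where "x0 = (\<lambda>w. x w - P * (z * B u w + B v w) - Q * (i * B u w + B v w))"
  have "x0 u = x u - (P - Q) * (z - i)" unfolding x0_def B by (simp add: algebra_simps)
  then have x0u: "x0 u = 0" using PQ by simp
  have "x0 v = x v - P * (1 - z\<^sup>2) - Q * (1 - i\<^sup>2)"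
    unfolding x0_def B mult_minus_right zzi izi by (simp add: algebra_simps)
  also have "1 - z\<^sup>2 = - z * (z - i)" using zi by (simp add: algebra_simps power2_eq_square)
  also have "1 - i\<^sup>2 = i * (z - i)" using zi by (simp add: algebra_simps power2_eq_square)
  also have "x v - P * (- z * (z - i)) - Q * (i * (z - i)) =
      x v + i * ((P - Q) * (z - i)) + P * (z - i)\<^sup>2"
    by (simp add: algebra_simps power2_eq_square)
  also have "\<dots> = 0" unfolding PQ P2 by simp
  finally have x0v: "x0 v = 0" .
  have x: "x = y P Q x0" by (auto simp: y_def x0_def)
  show ?thesis using iter[OF x0u x0v, of n P Q] zn \<open>i ^ n = 1\<close> unfolding x[symmetric] by (simp add: x[symmetric])
qed

text \<open>The composition of the two sides $(fg)^k f$ and $g(fg)^k$ is $(fg)^{2k+1}$, the identity, and both are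
  involutions because they are palindromes in \<open>f\<close> and \<open>g\<close>; so they agree.\<close>

lemma involutions_braid:
  assumes f: "\<And>x. f (f x) = x" and g: "\<And>x. g (g x) = x"
    and per: "\<And>x. ((f \<circ> g) ^^ (Suc (2 * k))) x = x"
  shows "alt_comp f g (Suc (2 * k)) = alt_comp g f (Suc (2 * k))"
proof
  fix x
  let ?T = "f \<circ> g"
  \<comment> \<open>The involution \<open>f\<close> conjugates \<open>f g\<close> to its inverse.\<close>
  have sw: "(?T ^^ j) (f ((?T ^^ j) x)) = f x" for j x
  proof (induction j arbitrary: x)
    case (Suc j)
    have "(?T ^^ Suc j) (f ((?T ^^ Suc j) x)) = ?T ((?T ^^ j) (f ((?T ^^ j) (?T x))))"
      by (simp only: funpow_swap1 funpow.simps comp_apply)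
    also have "\<dots> = f x" unfolding Suc[of "?T x"] using f g by simp
    finally show ?case .
  qed simp
  have inj: "a = b" if "(?T ^^ Suc k) a = (?T ^^ Suc k) b" for a b
  proof -
    have "(?T ^^ k) ((?T ^^ Suc k) c) = c" for c
      using per[of c] by (simp add: funpow_add[symmetric] mult_2) (metis comp_apply funpow_add funpow_swap1)
    then show ?thesis using that by metis
  qed
  have slide: "f (((g \<circ> f) ^^ j) x) = (?T ^^ j) (f x)" for j x
    by (induction j arbitrary: x) (simp_all add: funpow_swap1)
  have "(?T ^^ Suc k) ((?T ^^ k) (f x)) = f x"
    using per[of "f x"] by (metis comp_apply funpow_add add_Suc mult_2)
  also have "\<dots> = (?T ^^ Suc k) (f ((?T ^^ Suc k) x))" by (rule sw[symmetric])
  finally have "(?T ^^ k) (f x) = f ((?T ^^ Suc k) x)" by (rule inj)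
  also have "\<dots> = g ((?T ^^ k) x)" using f by simp
  finally show "alt_comp f g (Suc (2 * k)) x = alt_comp g f (Suc (2 * k)) x"
    by (simp only: alt_comp.simps alt_comp_double comp_apply slide)
qed

text \<open>Let \<open>w0\<close> be a dead vertex without living neighbours.  The vertex \<open>u\<close> acts as its reflection times
  $t^{c u}$, where even labels are treated like the label 2, so that the reflections commute, and an
  odd label \<open>m\<close> uses an \<open>m\<close>-th root of unity.  The vector \<open>\<delta>\<close>, which is concentrated at \<open>w0\<close> and in degree 0,
  is moved by \<open>w0\<close> but fixed by all neighbours of \<open>w0\<close>: they are dead, so they shift no degrees.
  Therefore \<open>w0\<close> may be conjugated by the translation by \<open>\<delta>\<close> while all other vertices act linearly;
  in a relation involving \<open>w0\<close> both maps may be regarded as conjugated.\<close>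

lemma not_type_FP1_if_not_dominant:
  fixes V :: "'v set"
  assumes graph: "labelled_graph V E l"
    and chi: "\<chi> \<in> nonzero_characters (artin_group V E l)"
  defines "c \<equiv> \<lambda>v. \<chi> (artin_gen V E l v)"
  assumes not_dom: "\<not> living_dominant V E c"
  shows "\<not> type_FP (monoid_ring (nonneg_submonoid (artin_group V E l) \<chi>)) trivial_module 1"
proof -
  have chi_hom: "\<chi> \<in> hom (artin_group V E l) real_add_group"
    using chi by (simp add: nonzero_characters_def characters_def)
  obtain w0 where w0: "w0 \<in> V" "c w0 = 0" and nb: "\<And>u. u \<in> V \<Longrightarrow> {u, w0} \<in> E \<Longrightarrow> c u = 0"
    using not_dom unfolding living_dominant_def living_verts_def by blast
  obtain a where a: "a \<in> V" "c a \<noteq> 0" using character_nonzero_on_generator[OF chi] by (auto simp: c_def)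
  define B where "B u w = (if u = w then 2 else if {u, w} \<in> E \<and> odd (l {u, w})
      then - (unit_root (l {u, w}) + inverse (unit_root (l {u, w}))) else 0)" for u w
  define L where "L u m = (\<lambda>(w, r). m (w, r - c u) - B u w * m (u, r - c u))"
    for u and m :: "'v \<times> real \<Rightarrow> complex"
  define L' where "L' u m = (\<lambda>(w, r). m (w, r + c u) - B u w * m (u, r + c u))"
    for u and m :: "'v \<times> real \<Rightarrow> complex"
  define \<delta> where "\<delta> = (\<lambda>(w, r::real). if w = w0 \<and> r = 0 then 1 else 0 :: complex)"
  define e where "e v = (if v = w0 then \<delta> else 0)" for v
  have B_diag: "B u u = 2" for u by (simp add: B_def)
  have B_sym: "B u w = B w u" for u w by (simp add: B_def insert_commute)
  have L_apply: "L u m (w, r) = m (w, r - c u) - B u w * m (u, r - c u)"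
    "L' u m (w, r) = m (w, r + c u) - B u w * m (u, r + c u)" for u m w r
    by (simp_all add: L_def L'_def)
  have L_add: "L u (x + y) = L u x + L u y" for u x y
    by (auto simp: fun_eq_iff L_apply algebra_simps)
  have L_zero: "L u 0 = 0" for u
    by (auto simp: fun_eq_iff L_apply)
  have L_diff: "L u (x - y) = L u x - L u y" for u x y
    by (auto simp: fun_eq_iff L_apply algebra_simps)
  have braid: "alt_comp (L u) (L v) (l {u, v}) = alt_comp (L v) (L u) (l {u, v})" if uvE: "{u, v} \<in> E" for u v
  proof (cases "even (l {u, v})")
    case True
    note uv = labelled_graph_edgeD[OF graph uvE]
    have "B u v = 0" "B v u = 0" using uv True by (simp_all add: B_def insert_commute)
    then have "L u \<circ> L v = L v \<circ> L u"
      by (auto simp: fun_eq_iff L_apply algebra_simps)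
    then show ?thesis using True by (rule alt_comp_commute)
  next
    case False
    note uv = labelled_graph_edgeD[OF graph uvE]
    have cuv: "c u = c v" unfolding c_def by (rule odd_edge_same_value[OF graph uvE False chi_hom])
    have alt: "alt_comp (L x) (L y) n m (w, r) =
        alt_comp (reflection B x) (reflection B y) n (\<lambda>w. m (w, r - real n * c u)) w"
      if "c x = c u" "c y = c u" for x y n m w r
      using that
    proof (induction n arbitrary: x y w r)
      case (Suc n)
      have "alt_comp (L x) (L y) (Suc n) m (w, r) =
          reflection B x (\<lambda>w. alt_comp (L y) (L x) n m (w, r - c u)) w"
        using Suc.prems by (simp add: L_apply reflection_def)
      also have "(\<lambda>w. alt_comp (L y) (L x) n m (w, r - c u)) =
          alt_comp (reflection B y) (reflection B x) n (\<lambda>w. m (w, r - c u - real n * c u))"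
        by (rule ext, rule Suc.IH) (use Suc.prems in auto)
      finally show ?case by (simp add: algebra_simps)
    qed simp
    obtain k where k: "l {u, v} = Suc (2 * k)" using False by (auto elim: oddE)
    have dihedral: "alt_comp (reflection B u) (reflection B v) (l {u, v}) =
        alt_comp (reflection B v) (reflection B u) (l {u, v})"
      unfolding k
    proof (rule involutions_braid)
      show "reflection B u (reflection B u x) = x" "reflection B v (reflection B v x) = x" for x
        by (rule reflection_involution, rule B_diag)+
      let ?z = "unit_root (l {u, v})"
      have zn: "?z ^ Suc (2 * k) = 1" using unit_root_power[of "l {u, v}"] uv k by simp
      have z1: "?z \<noteq> 1" using unit_root_neq_one uv by simp
      have "?z\<^sup>2 \<noteq> 1"
      proof
        assume "?z\<^sup>2 = 1"
        then have "?z ^ (2 * k) = 1" by (simp only: power_mult power_one)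
        then show False using zn z1 by simp
      qed
      moreover have "B u v = - (?z + inverse ?z)" "B v u = - (?z + inverse ?z)"
        using uv uvE False by (simp_all add: B_def insert_commute)
      moreover have "?z * inverse ?z = 1" using unit_root_nonzero by simp
      ultimately show "((reflection B u \<circ> reflection B v) ^^ Suc (2 * k)) x = x" for x
        using zn B_diag by (intro reflection_product_order[of B u v ?z "inverse ?z"])
    qed
    show ?thesis
    proof (intro ext)
      fix m and p :: "'v \<times> real"
      obtain w r where p: "p = (w, r)" by (cases p)
      show "alt_comp (L u) (L v) (l {u, v}) m p = alt_comp (L v) (L u) (l {u, v}) m p"
        unfolding p alt[OF refl cuv[symmetric]] alt[OF cuv[symmetric] refl] dihedral ..
    qed
  qed
  have fixed: "L v \<delta> = \<delta>" if "{v, w0} \<in> E" for v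
  proof -
    note uv = labelled_graph_edgeD[OF graph that]
    have "c v = 0" using nb uv that by simp
    then show ?thesis using uv by (auto simp: fun_eq_iff L_apply \<delta>_def)
  qed
  have \<sigma>: "e v + L v (m - e v) = \<delta> + L v (m - \<delta>)" if "v = w0 \<or> {v, w0} \<in> E" for v m
  proof (cases "v = w0")
    case True
    then have "e v = \<delta>" unfolding e_def by (rule if_P)
    then show ?thesis by (simp only:)
  next
    case False
    then have "L v \<delta> = \<delta>" using fixed that by simp
    then show ?thesis unfolding e_def L_diff using False L_zero by simp
  qed
  show ?thesis
  proof (rule artin_not_type_FP1[OF graph chi_hom, where L = L and L' = L' and e = e and a = a and b = w0])
    fix v and m :: "'v \<times> real \<Rightarrow> complex"
    show "L v (L' v m) = m" "L' v (L v m) = m"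
      by (auto simp: fun_eq_iff L_apply B_diag algebra_simps)
    show "vanishes_below 0 (e v)" by (simp add: e_def \<delta>_def vanishes_below_def)
  next
    fix v and m :: "'v \<times> real \<Rightarrow> complex" and d :: real assume "vanishes_below d m"
    then show "vanishes_below (d + \<chi> (artin_gen V E l v)) (L v m)"
      "vanishes_below (d + - \<chi> (artin_gen V E l v)) (L' v m)"
      by (simp_all add: vanishes_below_def L_apply c_def)
  next
    fix u v assume uvE: "{u, v} \<in> E"
    show "alt_comp (\<lambda>m. e u + L u (m - e u)) (\<lambda>m. e v + L v (m - e v)) (l {u, v}) =
        alt_comp (\<lambda>m. e v + L v (m - e v)) (\<lambda>m. e u + L u (m - e u)) (l {u, v})"
    proof -
      \<comment> \<open>Common fixed point of \<open>u\<close> and \<open>v\<close>.\<close>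
      define t where "t = (if u = w0 \<or> v = w0 then \<delta> else 0)"
      have t: "e u + L u (m - e u) = t + L u (m - t)" "e v + L v (m - e v) = t + L v (m - t)" for m
      proof -
        show "e u + L u (m - e u) = t + L u (m - t)"
        proof (cases "u = w0 \<or> v = w0")
          case True
          then have "u = w0 \<or> {u, w0} \<in> E" using uvE by auto
          then show ?thesis unfolding t_def if_P[OF True] by (rule \<sigma>)
        next
          case False
          then show ?thesis by (simp add: t_def e_def)
        qed
        show "e v + L v (m - e v) = t + L v (m - t)"
        proof (cases "u = w0 \<or> v = w0")
          case True
          then have "v = w0 \<or> {v, w0} \<in> E" using uvE by (auto simp: insert_commute)
          then show ?thesis unfolding t_def if_P[OF True] by (rule \<sigma>)
        next
          case False
          then show ?thesis by (simp add: t_def e_def)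
        qed
      qed
      show ?thesis
      proof
        fix m
        show "alt_comp (\<lambda>m. e u + L u (m - e u)) (\<lambda>m. e v + L v (m - e v)) (l {u, v}) m =
            alt_comp (\<lambda>m. e v + L v (m - e v)) (\<lambda>m. e u + L u (m - e u)) (l {u, v}) m"
          unfolding alt_comp_conj[of "\<lambda>m. e u + L u (m - e u)" t "L u" "\<lambda>m. e v + L v (m - e v)" "L v", OF t]
            alt_comp_conj[of "\<lambda>m. e v + L v (m - e v)" t "L v" "\<lambda>m. e u + L u (m - e u)" "L u", OF t(2,1)]
            braid[OF uvE] ..
      qed
    qed
  next
    have "a \<noteq> w0" using a w0 by auto
    then show "e a = 0" by (simp only: e_def if_False)
    have "(e w0 + L w0 (0 - e w0)) (w0, 0) = 2"
      using w0 by (simp add: e_def \<delta>_def L_apply B_diag)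
    then show "e w0 + L w0 (0 - e w0) \<noteq> 0" by (metis zero_fun_apply zero_neq_numeral)
  qed (use a w0 L_add in \<open>auto simp: c_def\<close>)
qed


section \<open>Colourings of graphs whose cycles are even\<close>

definition simple_path :: "('w, 'e) multigraph \<Rightarrow> 'e set \<Rightarrow> 'w list \<Rightarrow> 'e list \<Rightarrow> bool" where
  "simple_path \<Lambda> F ws es \<longleftrightarrow> length ws = Suc (length es) \<and> distinct ws \<and> set es \<subseteq> F \<and>
     (\<forall>i<length es. ends \<Lambda> (es ! i) = {ws ! i, ws ! Suc i})"

lemma simple_path_exists:
  assumes "(x, y) \<in> {(a, b). \<exists>f\<in>F. ends \<Lambda> f = {a, b}}\<^sup>*"
  shows "\<exists>ws es. simple_path \<Lambda> F ws es \<and> ws ! 0 = x \<and> ws ! length es = y"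
  using assms
proof (induction rule: rtrancl_induct)
  case base
  have "simple_path \<Lambda> F [x] []" by (simp add: simple_path_def)
  then show ?case by (intro exI[of _ "[x]"] exI[of _ "[]"]) simp
next
  case (step y z)
  then obtain ws es f where p: "simple_path \<Lambda> F ws es" "ws ! 0 = x" "ws ! length es = y"
    and f: "f \<in> F" "ends \<Lambda> f = {y, z}" by blast
  have len: "length ws = Suc (length es)" using p by (simp add: simple_path_def)
  show ?case
  proof (cases "z \<in> set ws")
    case True
    then obtain k where k: "k \<le> length es" "ws ! k = z"
      using len by (auto simp: in_set_conv_nth less_Suc_eq_le)
    have "simple_path \<Lambda> F (take (Suc k) ws) (take k es)"
      using p k by (auto simp: simple_path_def dest: in_set_takeD)
    moreover have "take (Suc k) ws ! 0 = x" "take (Suc k) ws ! length (take k es) = z"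
      using p k by (simp_all add: min_absorb2)
    ultimately show ?thesis by blast
  next
    case False
    have "ends \<Lambda> ((es @ [f]) ! i) = {(ws @ [z]) ! i, (ws @ [z]) ! Suc i}" if "i < length (es @ [f])" for i
    proof (cases "i < length es")
      case True
      then show ?thesis using p by (simp add: simple_path_def nth_append)
    next
      case False
      then have "i = length es" using that by simp
      then show ?thesis using f p(3) len by (simp add: nth_append)
    qed
    then have "simple_path \<Lambda> F (ws @ [z]) (es @ [f])"
      using p False f by (auto simp: simple_path_def)
    moreover have "(ws @ [z]) ! 0 = x" "(ws @ [z]) ! length (es @ [f]) = z"
      using p len by (simp_all add: nth_append)
    ultimately show ?thesis by blast
  qed
qed

lemma simple_path_distinct_edges:
  assumes "simple_path \<Lambda> F ws es"
  shows "distinct es"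
proof -
  have "es ! i \<noteq> es ! j" if "i < j" "j < length es" for i j
  proof
    assume "es ! i = es ! j"
    then have "{ws ! i, ws ! Suc i} = {ws ! j, ws ! Suc j}"
      using assms that by (simp add: simple_path_def) (metis order.strict_trans)
    then have "ws ! i = ws ! j \<or> ws ! i = ws ! Suc j" by (auto simp: doubleton_eq_iff)
    moreover have "distinct ws" "length ws = Suc (length es)" using assms by (simp_all add: simple_path_def)
    ultimately show False using that by (auto simp: nth_eq_iff_index_eq)
  qed
  then show ?thesis unfolding distinct_conv_nth by (metis linorder_neqE_nat)
qed

text \<open>Here \<open>\<phi>\<close> colours vertices and \<open>P\<close> marks the edges along which the colour changes.\<close>

lemma colour_change_parity:
  fixes \<phi> :: "'w \<Rightarrow> bool"
  assumes "\<And>i. i < length es \<Longrightarrow> (\<phi> (ws ! i) \<noteq> \<phi> (ws ! Suc i)) = P (es ! i)"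
  shows "(\<phi> (ws ! 0) \<noteq> \<phi> (ws ! length es)) = odd (length (filter P es))"
proof -
  have "k \<le> length es \<Longrightarrow> (\<phi> (ws ! 0) \<noteq> \<phi> (ws ! k)) = odd (length (filter P (take k es)))" for k
  proof (induction k)
    case (Suc k)
    then show ?case using assms[of k] by (auto simp: take_Suc_conv_app_nth)
  qed simp
  then show ?thesis by (metis order_refl take_all)
qed

text \<open>The edges are added one at a time.  If the ends of the new edge are already joined by a path, then
  a simple path together with the new edge is a cycle and the hypothesis fixes the parity
  of its marked edges, so that the old colouring is right for the new edge.  Otherwise the colours can be
  exchanged on the component of one end.\<close>

lemma cycle_even_colouring:
  fixes \<Lambda> :: "('w, 'e) multigraph"
  assumes "finite F" "F \<subseteq> edges \<Lambda>"
    and ends: "\<And>e. e \<in> F \<Longrightarrow> \<exists>x\<in>verts \<Lambda>. \<exists>y\<in>verts \<Lambda>. x \<noteq> y \<and> ends \<Lambda> e = {x, y}"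
    and cyc: "\<And>ws es. is_cycle \<Lambda> ws es \<Longrightarrow> set es \<subseteq> F \<Longrightarrow> even (card {e \<in> set es. P e})"
  shows "\<exists>\<phi>::'w \<Rightarrow> bool. \<forall>e\<in>F. \<forall>x y. ends \<Lambda> e = {x, y} \<longrightarrow> (\<phi> x \<noteq> \<phi> y) = P e"
  using assms
proof (induction F rule: finite_induct)
  case empty
  then show ?case by simp
next
  case (insert e F)
  have "\<exists>\<phi>::'w \<Rightarrow> bool. \<forall>e\<in>F. \<forall>x y. ends \<Lambda> e = {x, y} \<longrightarrow> (\<phi> x \<noteq> \<phi> y) = P e"
  proof (rule insert.IH)
    fix ws es assume "is_cycle \<Lambda> ws es" "set es \<subseteq> F"
    then show "even (card {e \<in> set es. P e})" by (intro insert.prems(3)) auto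
  qed (use insert.prems in auto)
  then obtain \<phi> :: "'w \<Rightarrow> bool" where phi': "\<forall>e\<in>F. \<forall>x y. ends \<Lambda> e = {x, y} \<longrightarrow> (\<phi> x \<noteq> \<phi> y) = P e" ..
  have phi: "(\<phi> x \<noteq> \<phi> y) = P e" if "e \<in> F" "ends \<Lambda> e = {x, y}" for e x y
    using phi' that by simp
  obtain x y where xy: "x \<in> verts \<Lambda>" "y \<in> verts \<Lambda>" "x \<noteq> y" "ends \<Lambda> e = {x, y}"
    using insert.prems(2)[OF insertI1] by (elim bexE conjE)
  define A where "A = {(a, b). \<exists>f\<in>F. ends \<Lambda> f = {a, b}}"
  have A_sym: "(b, a) \<in> A" if "(a, b) \<in> A" for a b
    using that by (auto simp: A_def insert_commute)
  show ?case
  proof (cases "(x, y) \<in> A\<^sup>*")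
    case True
    have "\<exists>ws es. simple_path \<Lambda> F ws es \<and> ws ! 0 = x \<and> ws ! length es = y"
      using True unfolding A_def by (rule simple_path_exists)
    then obtain ws es where p: "simple_path \<Lambda> F ws es" "ws ! 0 = x" "ws ! length es = y"
      by (elim exE conjE)
    have len: "length ws = Suc (length es)" and dw: "distinct ws" and esF: "set es \<subseteq> F"
      and edge: "\<And>i. i < length es \<Longrightarrow> ends \<Lambda> (es ! i) = {ws ! i, ws ! Suc i}"
      using p by (auto simp: simple_path_def)
    have de: "distinct es" by (rule simple_path_distinct_edges[OF p(1)])
    have wsv: "ws ! i \<in> verts \<Lambda>" if i: "i < length ws" for i
    proof (cases "i = length es")
      case True
      then show ?thesis using p(3) xy by simp
    next
      case False
      then have i': "i < length es" using i len by simp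
      then have "es ! i \<in> insert e F" using esF nth_mem by blast
      then show ?thesis using insert.prems(2)[of "es ! i"] edge[OF i'] by (auto simp: doubleton_eq_iff)
    qed
    have "ends \<Lambda> ((es @ [e]) ! i) = {ws ! i, ws ! (Suc i mod length ws)}" if "i < length (es @ [e])" for i
    proof (cases "i < length es")
      case True
      then show ?thesis using edge len by (simp add: nth_append)
    next
      case False
      then have "i = length es" using that by simp
      then show ?thesis using xy p len by (simp add: insert_commute)
    qed
    then have "is_cycle \<Lambda> ws (es @ [e])"
      unfolding is_cycle_def using len dw de esF insert.hyps(2) insert.prems(1) wsv
      by (auto simp: set_conv_nth[of ws])
    from insert.prems(3)[OF this] have "even (card {f \<in> set (es @ [e]). P f})"
      using esF by auto
    moreover have "card {f \<in> set (es @ [e]). P f} = length (filter P (es @ [e]))"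
      using de esF insert.hyps(2) by (subst distinct_length_filter) (auto intro: arg_cong[where f=card])
    moreover have "(\<phi> x \<noteq> \<phi> y) = odd (length (filter P es))"
    proof -
      have "(\<phi> (ws ! i) \<noteq> \<phi> (ws ! Suc i)) = P (es ! i)" if "i < length es" for i
        by (rule phi[OF _ edge[OF that]]) (use that esF nth_mem in blast)
      from colour_change_parity[of es \<phi> ws P, OF this] show ?thesis unfolding p(2,3) .
    qed
    ultimately have "(\<phi> x \<noteq> \<phi> y) = P e" by auto
    then have "(\<phi> a \<noteq> \<phi> b) = P e" if "ends \<Lambda> e = {a, b}" for a b
      using that xy by (auto simp: doubleton_eq_iff)
    then show ?thesis using phi by (intro exI[of _ \<phi>] ballI allI impI) (metis insertE)
  next
    case False
    define \<psi> where "\<psi> z = (if (x, z) \<in> A\<^sup>* then (if (\<phi> x \<noteq> \<phi> y) = P e then \<phi> z else \<not> \<phi> z) else \<phi> z)" for z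
    have "(\<psi> a \<noteq> \<psi> b) = P f" if "f \<in> F" "ends \<Lambda> f = {a, b}" for f a b
    proof -
      have "(a, b) \<in> A" using that by (auto simp: A_def)
      then have "(x, a) \<in> A\<^sup>* \<longleftrightarrow> (x, b) \<in> A\<^sup>*"
        using A_sym[of a b] rtrancl_into_rtrancl[of x a A b] rtrancl_into_rtrancl[of x b A a] by blast
      then show ?thesis using phi[OF that] by (auto simp: \<psi>_def)
    qed
    moreover have "(\<psi> a \<noteq> \<psi> b) = P e" if "ends \<Lambda> e = {a, b}" for a b
    proof -
      have "(\<psi> x \<noteq> \<psi> y) = P e" using False by (auto simp: \<psi>_def)
      then show ?thesis using that xy by (auto simp: doubleton_eq_iff)
    qed
    ultimately show ?thesis by (intro exI[of _ \<psi>] ballI allI impI) (metis insertE)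
  qed
qed

text \<open>The predicate \<open>s\<close> alternates along the cycle.\<close>

lemma cycle_length_even:
  assumes "is_cycle \<Lambda> ws es"
    and flip: "\<And>e x y. e \<in> set es \<Longrightarrow> ends \<Lambda> e = {x, y} \<Longrightarrow> s x \<noteq> (s y :: bool)"
  shows "even (length es)"
proof -
  have len: "length ws = length es" and ne: "es \<noteq> []"
    and edge: "\<And>i. i < length es \<Longrightarrow> ends \<Lambda> (es ! i) = {ws ! i, ws ! (Suc i mod length ws)}"
    using assms(1) by (auto simp: is_cycle_def)
  let ?n = "length es - 1"
  have "(s (ws ! 0) \<noteq> s (ws ! length (butlast es))) = odd (length (filter (\<lambda>_. True) (butlast es)))"
  proof (rule colour_change_parity)
    fix i assume "i < length (butlast es)"
    then have "i < length es" "Suc i mod length ws = Suc i" using len by auto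
    then show "(s (ws ! i) \<noteq> s (ws ! Suc i)) = True"
      using edge[of i] flip[of "es ! i"] nth_mem by auto
  qed
  moreover have "s (ws ! ?n) \<noteq> s (ws ! 0)"
    using edge[of ?n] flip[of "es ! ?n"] len ne by simp
  ultimately show ?thesis using ne by auto
qed


section \<open>Scalars from the divisibility hypotheses\<close>

lemma dead_living_edgeE:
  assumes "e \<in> dead_living_edges V E l c"
  obtains u v where "e = {u, v}" "{u, v} \<in> E" "u \<in> V" "v \<in> V" "c u + c v = 0" "c u \<noteq> 0"
    "even (l {u, v})" "l {u, v} > 2"
  using assms by (force simp: dead_living_edges_def dead_edge_def living_verts_def)

lemma odd_rel_same_value:
  assumes "\<And>u v. {u, v} \<in> E \<Longrightarrow> odd (l {u, v}) \<Longrightarrow> c u = c v"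
    and "(u, v) \<in> odd_rel V E l"
  shows "c u = c v"
proof -
  have "(u, v) \<in> {(a, b). {a, b} \<in> E \<and> odd (l {a, b})}\<^sup>*" using assms(2) by (simp add: odd_rel_def)
  then show ?thesis
    by (induction rule: rtrancl_induct) (use assms(1) in auto)
qed

lemma odd_rel_class_eq:
  assumes "labelled_graph V E l" "{u, v} \<in> E" "odd (l {u, v})"
  shows "odd_rel V E l `` {u} = odd_rel V E l `` {v}"
proof -
  let ?A = "{(a, b). {a, b} \<in> E \<and> odd (l {a, b})}"
  have uv: "(u, v) \<in> ?A" "(v, u) \<in> ?A" using assms(2,3) by (auto simp: insert_commute)
  then have "(u, w) \<in> ?A\<^sup>* \<longleftrightarrow> (v, w) \<in> ?A\<^sup>*" for w
    by (meson converse_rtrancl_into_rtrancl)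
  then show ?thesis
    using labelled_graph_edgeD[OF assms(1,2)] unfolding odd_rel_def by auto
qed

text \<open>The character has opposite signs at the ends of a dead edge, and the sign is constant on the
  classes of vertices joined by odd edges.  So cycles of dead edges are even, and being balanced
  makes the number of their edges of each colour even.\<close>

lemma balanced_parity_colourings:
  fixes V :: "'v set" and c :: "'v \<Rightarrow> real"
  assumes graph: "labelled_graph V E l"
    and odd: "\<And>u v. {u, v} \<in> E \<Longrightarrow> odd (l {u, v}) \<Longrightarrow> c u = c v"
    and bal: "balanced_artin V E l"
  shows "\<exists>n C. \<exists>\<phi>::nat \<Rightarrow> 'v set \<Rightarrow> bool. balanced_colouring (even_graph V E l) n C \<and>
    (\<forall>i\<in>{1..n}. \<forall>u v. {u, v} \<in> dead_living_edges V E l c \<longrightarrow>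
      (\<phi> i (odd_rel V E l `` {u}) \<noteq> \<phi> i (odd_rel V E l `` {v})) = (C {u, v} = i))"
proof -
  let ?Lam = "even_graph V E l" and ?F = "dead_living_edges V E l c"
  let ?cl = "\<lambda>v. odd_rel V E l `` {v}"
  obtain n C where col: "balanced_colouring ?Lam n C"
    and cyc: "\<And>ws es i. is_cycle ?Lam ws es \<Longrightarrow> even (length es) \<Longrightarrow> i \<in> {1..n} \<Longrightarrow>
      card {e \<in> set es. C e = i} \<in> {0, 2}"
    using bal unfolding balanced_artin_def balanced_graph_def by blast
  have finE: "finite E"
  proof -
    have "E \<subseteq> Pow V" "finite V" using graph by (auto simp: labelled_graph_def)
    then show ?thesis using finite_subset by blast
  qed
  have F_fin: "finite ?F" using finE by (simp add: dead_living_edges_def)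
  have F_edges: "?F \<subseteq> edges ?Lam"
    by (auto simp: dead_living_edges_def even_graph_def dead_edge_def)
  define s where "s K = (\<exists>v\<in>K. c v > 0)" for K
  have s_class: "s (?cl v) \<longleftrightarrow> c v > 0" if "v \<in> V" for v
  proof -
    have "v \<in> ?cl v" using that by (simp add: odd_rel_def)
    moreover have "c w = c v" if "w \<in> ?cl v" for w
      using odd_rel_same_value[of E l c v w V] odd that by simp
    ultimately show ?thesis unfolding s_def by metis
  qed
  have ends: "\<exists>u\<in>V. \<exists>v\<in>V. e = {u, v} \<and> ends ?Lam e = {?cl u, ?cl v} \<and> s (?cl u) \<noteq> s (?cl v)" if "e \<in> ?F" for e
    using that
  proof (rule dead_living_edgeE)
    fix u v assume h: "e = {u, v}" "u \<in> V" "v \<in> V" "c u + c v = 0" "c u \<noteq> 0"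
    have 1: "s (?cl u) \<noteq> s (?cl v)" using s_class[OF h(2)] s_class[OF h(3)] h(4,5) by auto
    have 2: "ends ?Lam e = {?cl u, ?cl v}" using h(1) by (simp add: even_graph_def)
    show ?thesis by (rule bexI[OF _ h(2)], rule bexI[OF _ h(3)]) (intro conjI h(1) 1 2)
  qed
  have verts: "?cl v \<in> verts ?Lam" if "v \<in> V" for v
    using that by (simp add: even_graph_def quotientI)
  have "\<exists>\<phi>::'v set \<Rightarrow> bool. \<forall>e\<in>?F. \<forall>x y. ends ?Lam e = {x, y} \<longrightarrow> (\<phi> x \<noteq> \<phi> y) = (C e = i)"
    if i: "i \<in> {1..n}" for i
  proof (rule cycle_even_colouring[OF F_fin F_edges])
    fix e assume "e \<in> ?F"
    then show "\<exists>x\<in>verts ?Lam. \<exists>y\<in>verts ?Lam. x \<noteq> y \<and> ends ?Lam e = {x, y}"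
      using ends[of e] verts by metis
  next
    fix ws es assume cy: "is_cycle ?Lam ws es" "set es \<subseteq> ?F"
    have "even (length es)"
    proof (rule cycle_length_even[OF cy(1), of s])
      fix e x y assume "e \<in> set es" "ends ?Lam e = {x, y}"
      then show "s x \<noteq> s y" using ends[of e] cy(2) by (auto simp: doubleton_eq_iff)
    qed
    from cyc[OF cy(1) this i] have "card {e \<in> set es. C e = i} = 0 \<or> card {e \<in> set es. C e = i} = 2"
      by blast
    then show "even (card {e \<in> set es. C e = i})" by (rule disjE) (simp_all only: dvd_0_right dvd_refl)
  qed
  then have "\<forall>i\<in>{1..n}. \<exists>\<phi>::'v set \<Rightarrow> bool. \<forall>e\<in>?F. \<forall>x y.
      ends ?Lam e = {x, y} \<longrightarrow> (\<phi> x \<noteq> \<phi> y) = (C e = i)" by (rule ballI)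
  from bchoice[OF this] obtain \<phi> :: "nat \<Rightarrow> 'v set \<Rightarrow> bool" where phi:
    "\<forall>i\<in>{1..n}. \<forall>e\<in>?F. \<forall>x y. ends ?Lam e = {x, y} \<longrightarrow> (\<phi> i x \<noteq> \<phi> i y) = (C e = i)" ..
  show ?thesis
  proof (intro exI[of _ n] exI[of _ C] exI[of _ \<phi>] conjI col ballI allI impI)
    fix i u v assume iF: "i \<in> {1..n}" "{u, v} \<in> ?F"
    have "ends ?Lam {u, v} = {?cl u, ?cl v}" by (simp add: even_graph_def)
    then show "(\<phi> i (?cl u) \<noteq> \<phi> i (?cl v)) = (C {u, v} = i)"
      using bspec[OF bspec[OF phi iF(1)] iF(2)] by blast
  qed
qed

text \<open>Exactly one end of a dead edge has positive height, so the product of the scalars is the chosen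
  root of unity.\<close>

lemma admissible_scalars_if_common_prime:
  assumes odd: "\<And>u v. {u, v} \<in> E \<Longrightarrow> odd (l {u, v}) \<Longrightarrow> c u = c v"
    and p: "prime (p::nat)" "\<And>e. e \<in> E \<Longrightarrow> even (l e) \<Longrightarrow> l e > 2 \<Longrightarrow> p dvd l e div 2"
  shows "\<exists>lam. admissible_scalars V E l c lam"
proof
  let ?lam = "\<lambda>v. if c v > 0 then unit_root p else 1"
  have p2: "p \<ge> 2" using p(1) by (rule prime_ge_2_nat)
  have "?lam u * ?lam v \<noteq> 1 \<and> (?lam u * ?lam v) ^ (l {u, v} div 2) = 1"
    if e: "{u, v} \<in> dead_living_edges V E l c" for u v
    using e
  proof (rule dead_living_edgeE)
    fix a b assume h: "{u, v} = {a, b}" "{a, b} \<in> E" "c a + c b = 0" "c a \<noteq> 0" "even (l {a, b})" "l {a, b} > 2"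
    then have "c u + c v = 0" "c u \<noteq> 0" by (auto simp: doubleton_eq_iff)
    then have "?lam u * ?lam v = unit_root p" by auto
    moreover have "p dvd l {u, v} div 2" using p(2)[of "{a, b}"] h by simp
    then obtain k where "l {u, v} div 2 = p * k" by (elim dvdE)
    ultimately show ?thesis
      using unit_root_neq_one[OF p2] unit_root_power[of p] p2 by (simp add: power_mult)
  qed
  then show "admissible_scalars V E l c ?lam"
    using odd unit_root_nonzero unfolding admissible_scalars_def by auto
qed

text \<open>For each colour \<open>i\<close> the factor \<open>f v i\<close> is a \<open>p i\<close>-th root of unity or 1, according to the vertex
  colouring; it is inverted on vertices of negative height.  Along a dead edge of another colour the
  two factors are therefore inverse to each other, and along a dead edge of colour \<open>i\<close> exactly one
  of them is non-trivial.\<close>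

lemma admissible_scalars_if_balanced:
  fixes V :: "'v set"
  assumes graph: "labelled_graph V E l"
    and odd: "\<And>u v. {u, v} \<in> E \<Longrightarrow> odd (l {u, v}) \<Longrightarrow> c u = c v"
    and bal: "balanced_artin V E l"
  shows "\<exists>lam. admissible_scalars V E l c lam"
proof -
  let ?cl = "\<lambda>v. odd_rel V E l `` {v}"
  have ex: "\<exists>n C. \<exists>\<phi>::nat \<Rightarrow> 'v set \<Rightarrow> bool. balanced_colouring (even_graph V E l) n C \<and>
    (\<forall>i\<in>{1..n}. \<forall>u v. {u, v} \<in> dead_living_edges V E l c \<longrightarrow>
      (\<phi> i (?cl u) \<noteq> \<phi> i (?cl v)) = (C {u, v} = i))"
    by (rule balanced_parity_colourings[OF graph _ bal]) (rule odd)
  obtain n C and \<phi> :: "nat \<Rightarrow> 'v set \<Rightarrow> bool" where col: "balanced_colouring (even_graph V E l) n C"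
    and phi': "\<forall>i\<in>{1..n}. \<forall>u v. {u, v} \<in> dead_living_edges V E l c \<longrightarrow>
      (\<phi> i (?cl u) \<noteq> \<phi> i (?cl v)) = (C {u, v} = i)"
    using ex by (elim exE conjE)
  have phi: "(\<phi> i (?cl u) \<noteq> \<phi> i (?cl v)) = (C {u, v} = i)"
    if "i \<in> {1..n}" "{u, v} \<in> dead_living_edges V E l c" for i u v
    using bspec[OF phi' that(1)] that(2) by simp
  have "\<forall>i\<in>{1..n}. \<exists>p::nat. prime p \<and> (\<forall>e\<in>edges (even_graph V E l). C e = i \<longrightarrow> p dvd l e div 2)"
    using col by (simp add: balanced_colouring_def even_graph_def)
  from bchoice[OF this] obtain p :: "nat \<Rightarrow> nat" where
    p': "\<forall>i\<in>{1..n}. prime (p i) \<and> (\<forall>e\<in>edges (even_graph V E l). C e = i \<longrightarrow> p i dvd l e div 2)" ..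
  have p: "prime (p i)" "e \<in> edges (even_graph V E l) \<Longrightarrow> C e = i \<Longrightarrow> p i dvd l e div 2"
    if "i \<in> {1..n}" for i e
    using bspec[OF p' that] by simp_all
  define f where "f v i = (if \<phi> i (?cl v) then (if c v > 0 then unit_root (p i) else inverse (unit_root (p i))) else 1)" for v i
  let ?lam = "\<lambda>v. if c v = 0 then 1 else (\<Prod>i\<in>{1..n}. f v i)"
  have nz: "f v i \<noteq> 0" for v i using unit_root_nonzero by (simp add: f_def)
  have "?lam u * ?lam v \<noteq> 1 \<and> (?lam u * ?lam v) ^ (l {u, v} div 2) = 1"
    if e: "{u, v} \<in> dead_living_edges V E l c" for u v
    using e
  proof (rule dead_living_edgeE)
    fix a b assume h: "{u, v} = {a, b}" "{a, b} \<in> E" "c a + c b = 0" "c a \<noteq> 0" "even (l {a, b})" "l {a, b} > 2"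
    then have cuv: "c u + c v = 0" "c u \<noteq> 0" "c v \<noteq> 0" by (auto simp: doubleton_eq_iff)
    have edge: "{u, v} \<in> edges (even_graph V E l)" using h by (simp add: even_graph_def)
    define j where "j = C {u, v}"
    have j: "j \<in> {1..n}" using col edge unfolding j_def balanced_colouring_def by blast
    let ?z = "f u j * f v j"
    have "f u i * f v i = (if i = j then ?z else 1)" if "i \<in> {1..n}" for i
    proof (cases "i = j")
      case False
      then have "\<phi> i (?cl u) = \<phi> i (?cl v)" using phi[OF that e] by (simp add: j_def)
      then show ?thesis using False cuv unit_root_nonzero by (auto simp: f_def)
    qed simp
    then have "(\<Prod>i\<in>{1..n}. f u i * f v i) = (\<Prod>i\<in>{1..n}. if i = j then ?z else 1)"
      by (rule prod.cong[OF refl])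
    also have "\<dots> = ?z" using j by simp
    finally have lam: "?lam u * ?lam v = ?z" using cuv by (simp add: prod.distrib)
    have "\<phi> j (?cl u) \<noteq> \<phi> j (?cl v)" using phi[OF j e] by (simp add: j_def)
    then have z: "?z = unit_root (p j) \<or> ?z = inverse (unit_root (p j))" by (auto simp: f_def)
    have pj: "p j \<ge> 2" using p(1)[OF j] by (rule prime_ge_2_nat)
    have "p j dvd l {u, v} div 2" by (rule p(2)[OF j edge]) (simp add: j_def)
    then obtain k where k: "l {u, v} div 2 = p j * k" by (elim dvdE)
    have "unit_root (p j) ^ (p j * k) = 1" using unit_root_power[of "p j"] pj by (simp add: power_mult)
    then show ?thesis
      unfolding lam k using z unit_root_neq_one[OF pj] by (auto simp: power_inverse)
  qed
  moreover have "?lam u = ?lam v" if "{u, v} \<in> E" "odd (l {u, v})" for u v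
    unfolding f_def odd[OF that] odd_rel_class_eq[OF graph that] ..
  ultimately have "admissible_scalars V E l c ?lam"
    using nz unfolding admissible_scalars_def by auto
  then show ?thesis by (rule exI[of _ ?lam])
qed


section \<open>The invariant of an Artin group\<close>

lemma type_FP1_iff_living_connected_dominant:
  fixes V :: "'v set"
  assumes graph: "labelled_graph V E l"
    and cond: "balanced_artin V E l \<or>
      (\<exists>p::nat. prime p \<and> (\<forall>e\<in>E. even (l e) \<and> l e > 2 \<longrightarrow> p dvd l e div 2))"
    and chi: "\<chi> \<in> nonzero_characters (artin_group V E l)"
  defines "c \<equiv> \<lambda>v. \<chi> (artin_gen V E l v)"
  shows "type_FP (monoid_ring (nonneg_submonoid (artin_group V E l) \<chi>))
      (trivial_module :: ('v word set \<Rightarrow> int, int) module) 1 \<longleftrightarrow>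
    graph_connected (living_verts V c) (living_edges V E l c) \<and> living_dominant V E c"
proof -
  have hom: "\<chi> \<in> hom (artin_group V E l) real_add_group"
    using chi by (simp add: nonzero_characters_def characters_def)
  have odd: "c u = c v" if "{u, v} \<in> E" "odd (l {u, v})" for u v
    unfolding c_def by (rule odd_edge_same_value[OF graph that hom])
  have "\<exists>lam. admissible_scalars V E l c lam"
    using cond
  proof
    assume bal: "balanced_artin V E l"
    show ?thesis by (rule admissible_scalars_if_balanced[OF graph _ bal]) (rule odd)
  next
    assume "\<exists>p::nat. prime p \<and> (\<forall>e\<in>E. even (l e) \<and> l e > 2 \<longrightarrow> p dvd l e div 2)"
    then obtain p :: nat where p: "prime p" "\<And>e. e \<in> E \<Longrightarrow> even (l e) \<Longrightarrow> l e > 2 \<Longrightarrow> p dvd l e div 2"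
      by auto
    show ?thesis by (rule admissible_scalars_if_common_prime[OF _ p]) (rule odd)
  qed
  then obtain lam where lam: "admissible_scalars V E l c lam" ..
  show ?thesis
    using type_FP1_if_living_connected_dominant[OF graph chi]
      not_type_FP1_if_living_disconnected[OF graph hom lam[unfolded c_def]]
      not_type_FP1_if_not_dominant[OF graph chi]
    unfolding c_def by blast
qed

theorem theorem1p2:
  fixes V :: "'v set" and E :: "'v set set" and l :: "'v set \<Rightarrow> nat"
  assumes "labelled_graph V E l"
    and "balanced_artin V E l \<or>
      (\<exists>p::nat. prime p \<and> (\<forall>e\<in>E. even (l e) \<and> l e > 2 \<longrightarrow> p dvd l e div 2))"
  shows "Sigma1 (artin_group V E l) =
    {char_class (artin_group V E l) \<chi> | \<chi>.
       \<chi> \<in> nonzero_characters (artin_group V E l) \<and>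
       graph_connected
         (living_verts V (\<lambda>v. \<chi> (artin_gen V E l v)))
         (living_edges V E l (\<lambda>v. \<chi> (artin_gen V E l v))) \<and>
       living_dominant V E (\<lambda>v. \<chi> (artin_gen V E l v))}"
  unfolding Sigma1_def using type_FP1_iff_living_connected_dominant[OF assms] by blast

end
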